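(* Let $p$ be an odd prime and let $L/K$ be a Galois extension of fields with Galois group $\Gamma$ cyclic of order $p^n$. Let the $K$-Hopf algebra $H$ give a Hopf Galois structure on $L/K$. Then $H$ has type $G$ where $G\cong\Gamma$, and the Galois correspondence for that Hopf Galois structure holds in its strong form.
   Context: For a finite-dimensional cocommutative $K$-Hopf algebra $H$ with counit $\epsilon$, a finite extension $L/K$ is $H$-Hopf Galois ($H$ gives a Hopf Galois structure on $L/K$) if $L$ is an $H$-module algebra and the map $L\otimes_K H\to\mathrm{End}_K(L)$, $x\otimes h\mapsto(y\mapsto x\,(hy))$, is bijective. The Galois correspondence $\mathcal F$ sends a $K$-sub-Hopf algebra $J$ of $H$ to the intermediate field $\mathcal F(J)=L^J=\{x\in L: hx=\epsilon(h)x\ \text{for all }h\in J\}$; by Chase–Sweedler it is an injection from the set of $K$-sub-Hopf algebras of $H$ to the set of fields $E$ with $K\subseteq E\subseteq L$. The Galois correspondence holds in its strong form if $\mathcal F$ is also surjective onto that set. By Greither–Pareigis, Hopf Galois structures on the Galois extension $L/K$ with group $\Gamma$ correspond bijectively to regular (i.e. simply transitive) subgroups $N$ of $\mathrm{Perm}(\Gamma)$, the permutation group of $\Gamma$, that are normalized by $\lambda(\Gamma)$, where $\lambda(\gamma)(\delta)=\gamma\delta$: $N$ corresponds to $H=L[N]^\Gamma$, where $\Gamma$ acts on $L$ as Galois group and on $N$ by conjugation via $\lambda$, with action on $L$ given by $(\sum_\eta s_\eta\eta)x=\sum_\eta s_\eta\,\eta^{-1}(1_\Gamma)(x)$; then $L\otimes_K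 H\cong L[N]$. $H$ has type $G$ if $N=\alpha(G)$ for an injective homomorphism $\alpha:G\to\mathrm{Perm}(\Gamma)$ (so $G\cong N$). *)

theory Defs
  imports
    Complex_Main
    "HOL-Library.Poly_Mapping"
    "HOL-Computational_Algebra.Primes"
    "HOL-Algebra.Bij"
    "HOL-Algebra.Elementary_Groups"
begin

section \<open>Free vector spaces and tensor products\<close>

text \<open>
  The base field K is a type \<open>'k::field\<close>; a vector space over it is given by its scalar
  multiplication, as in \<open>HOL.Vector_Spaces\<close>.  The free K-vector space on the elements of \<open>'x\<close> is
  the type \<open>'x \<Rightarrow>\<^sub>0 'k\<close>.
\<close>

definition free_scale :: "'k::field \<Rightarrow> ('x \<Rightarrow>\<^sub>0 'k) \<Rightarrow> ('x \<Rightarrow>\<^sub>0 'k)" where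
  "free_scale c = Poly_Mapping.map ((*) c)"

lemma lookup_free_scale: "Poly_Mapping.lookup (free_scale c x) i = c * Poly_Mapping.lookup x i"
  by (simp add: free_scale_def Poly_Mapping.map.rep_eq when_def)

lemma vector_space_free_scale: "vector_space free_scale"
  by unfold_locales
    (auto intro!: poly_mapping_eqI simp: lookup_free_scale lookup_add algebra_simps)

abbreviation basis_vec :: "'x \<Rightarrow> ('x \<Rightarrow>\<^sub>0 'k::field)" where
  "basis_vec i \<equiv> Poly_Mapping.single i 1"

text \<open>The extension of \<open>f\<close> to formal linear combinations: \<open>\<Sum> c\<^sub>i i \<mapsto> \<Sum> c\<^sub>i (f i)\<close>.\<close>

definition lin_ext :: "('k::zero \<Rightarrow> 'b \<Rightarrow> 'b) \<Rightarrow> ('x \<Rightarrow> 'b) \<Rightarrow> ('x \<Rightarrow>\<^sub>0 'k) \<Rightarrow> 'b::comm_monoid_add" where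
  "lin_ext s f x = (\<Sum>i\<in>Poly_Mapping.keys x. s (Poly_Mapping.lookup x i) (f i))"

text \<open>
  The tensor product of A and B is the free vector space on \<open>A \<times> B\<close> modulo the subspace generated by
  the bilinearity relations.  Elements of it are handled through formal combinations of pairs, with
  \<open>tensor_eq\<close> as their equality in the tensor product.
\<close>

definition tensor_null ::
  "('k::field \<Rightarrow> 'a::ab_group_add \<Rightarrow> 'a) \<Rightarrow> ('k \<Rightarrow> 'b::ab_group_add \<Rightarrow> 'b) \<Rightarrow> ('a \<times> 'b \<Rightarrow>\<^sub>0 'k) set" where
  "tensor_null sA sB = module.span free_scale
     ({basis_vec (a + a', b) - basis_vec (a, b) - basis_vec (a', b) | a a' b. True} \<union>
      {basis_vec (a, b + b') - basis_vec (a, b) - basis_vec (a, b') | a b b'. True} \<union>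
      {basis_vec (sA c a, b) - free_scale c (basis_vec (a, b)) | c a b. True} \<union>
      {basis_vec (a, sB c b) - free_scale c (basis_vec (a, b)) | c a b. True})"

definition tensor_eq ::
  "('k::field \<Rightarrow> 'a::ab_group_add \<Rightarrow> 'a) \<Rightarrow> ('k \<Rightarrow> 'b::ab_group_add \<Rightarrow> 'b)
    \<Rightarrow> ('a \<times> 'b \<Rightarrow>\<^sub>0 'k) \<Rightarrow> ('a \<times> 'b \<Rightarrow>\<^sub>0 'k) \<Rightarrow> bool" where
  "tensor_eq sA sB x y \<longleftrightarrow> x - y \<in> tensor_null sA sB"

definition tensor_space ::
  "('k::field \<Rightarrow> 'a::ab_group_add \<Rightarrow> 'a) \<Rightarrow> ('k \<Rightarrow> 'b::ab_group_add \<Rightarrow> 'b)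
    \<Rightarrow> ('a \<times> 'b \<Rightarrow>\<^sub>0 'k) set set" where
  "tensor_space sA sB = UNIV // {(x, y). tensor_eq sA sB x y}"

text \<open>Equality in the threefold tensor product of H with itself.\<close>

definition tensor3_eq ::
  "('k::field \<Rightarrow> 'h::ab_group_add \<Rightarrow> 'h) \<Rightarrow> ('h \<times> 'h \<times> 'h \<Rightarrow>\<^sub>0 'k) \<Rightarrow> ('h \<times> 'h \<times> 'h \<Rightarrow>\<^sub>0 'k) \<Rightarrow> bool" where
  "tensor3_eq s x y \<longleftrightarrow> x - y \<in> module.span free_scale
     ({basis_vec (a + a', b, c) - basis_vec (a, b, c) - basis_vec (a', b, c) | a a' b c. True} \<union>
      {basis_vec (a, b + b', c) - basis_vec (a, b, c) - basis_vec (a, b', c) | a b b' c. True} \<union>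
      {basis_vec (a, b, c + c') - basis_vec (a, b, c) - basis_vec (a, b, c') | a b c c'. True} \<union>
      {basis_vec (s k a, b, c) - free_scale k (basis_vec (a, b, c)) | k a b c. True} \<union>
      {basis_vec (a, s k b, c) - free_scale k (basis_vec (a, b, c)) | k a b c. True} \<union>
      {basis_vec (a, b, s k c) - free_scale k (basis_vec (a, b, c)) | k a b c. True})"

section \<open>Hopf algebras\<close>

locale K_algebra = vector_space scale
  for scale :: "'k::field \<Rightarrow> 'a::ring_1 \<Rightarrow> 'a" +
  assumes scale_mult_left: "scale c (x * y) = scale c x * y"
    and scale_mult_right: "scale c (x * y) = x * scale c y"

definition finite_dimensional :: "('k::field \<Rightarrow> 'a::ab_group_add \<Rightarrow> 'a) \<Rightarrow> bool" where
  "finite_dimensional s \<longleftrightarrow> (\<exists>B. finite B \<and> module.span s B = UNIV)"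

text \<open>
  The comultiplication is given by a representative \<open>\<Delta> h = \<Sum> c\<^sub>i (a\<^sub>i, b\<^sub>i)\<close> of the element
  \<open>\<Sum> c\<^sub>i a\<^sub>i \<otimes> b\<^sub>i\<close>; all axioms are read modulo the tensor relations, so that the choice of
  representatives is immaterial.
\<close>

locale hopf_algebra = K_algebra scale
  for scale :: "'k::field \<Rightarrow> 'h::ring_1 \<Rightarrow> 'h" +
  fixes \<Delta> :: "'h \<Rightarrow> ('h \<times> 'h \<Rightarrow>\<^sub>0 'k)" and \<epsilon> :: "'h \<Rightarrow> 'k" and S :: "'h \<Rightarrow> 'h"
  assumes comult_add: "tensor_eq scale scale (\<Delta> (a + b)) (\<Delta> a + \<Delta> b)"
    and comult_scale: "tensor_eq scale scale (\<Delta> (scale c a)) (free_scale c (\<Delta> a))"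
    and comult_mult: "tensor_eq scale scale (\<Delta> (a * b))
      (lin_ext free_scale (\<lambda>(a1, a2). lin_ext free_scale (\<lambda>(b1, b2). basis_vec (a1 * b1, a2 * b2)) (\<Delta> b)) (\<Delta> a))"
    and comult_one: "tensor_eq scale scale (\<Delta> 1) (basis_vec (1, 1))"
    and coassoc: "tensor3_eq scale
      (lin_ext free_scale (\<lambda>(a, b). lin_ext free_scale (\<lambda>(a1, a2). basis_vec (a1, a2, b)) (\<Delta> a)) (\<Delta> h))
      (lin_ext free_scale (\<lambda>(a, b). lin_ext free_scale (\<lambda>(b1, b2). basis_vec (a, b1, b2)) (\<Delta> b)) (\<Delta> h))"
    and counit_linear: "Vector_Spaces.linear scale (*) \<epsilon>"
    and counit_mult: "\<epsilon> (a * b) = \<epsilon> a * \<epsilon> b"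
    and counit_one: "\<epsilon> 1 = 1"
    and counit_left: "lin_ext scale (\<lambda>(a, b). scale (\<epsilon> a) b) (\<Delta> h) = h"
    and counit_right: "lin_ext scale (\<lambda>(a, b). scale (\<epsilon> b) a) (\<Delta> h) = h"
    and antipode_linear: "Vector_Spaces.linear scale scale S"
    and antipode_left: "lin_ext scale (\<lambda>(a, b). S a * b) (\<Delta> h) = scale (\<epsilon> h) 1"
    and antipode_right: "lin_ext scale (\<lambda>(a, b). a * S b) (\<Delta> h) = scale (\<epsilon> h) 1"

locale fd_cocomm_hopf_algebra = hopf_algebra +
  assumes cocommutative:
      "tensor_eq scale scale (lin_ext free_scale (\<lambda>(a, b). basis_vec (b, a)) (\<Delta> h)) (\<Delta> h)"
    and fin_dim: "finite_dimensional scale"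

text \<open>
  The condition on \<open>\<Delta>\<close> says that \<open>\<Delta> h\<close> lies in the image of \<open>J \<otimes> J\<close> in \<open>H \<otimes> H\<close>; as K is a field,
  \<open>J \<otimes> J\<close> embeds there.
\<close>

definition sub_hopf_algebra ::
  "('k::field \<Rightarrow> 'h::ring_1 \<Rightarrow> 'h) \<Rightarrow> ('h \<Rightarrow> ('h \<times> 'h \<Rightarrow>\<^sub>0 'k)) \<Rightarrow> ('h \<Rightarrow> 'h) \<Rightarrow> 'h set \<Rightarrow> bool" where
  "sub_hopf_algebra scale \<Delta> S J \<longleftrightarrow>
     module.subspace scale J \<and> 1 \<in> J \<and> (\<forall>a\<in>J. \<forall>b\<in>J. a * b \<in> J) \<and> (\<forall>a\<in>J. S a \<in> J) \<and>
     (\<forall>h\<in>J. \<exists>x. Poly_Mapping.keys x \<subseteq> J \<times> J \<and> tensor_eq scale scale (\<Delta> h) x)"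

section \<open>Galois extensions\<close>

text \<open>
  A field extension L/K is a K-algebra structure on the field type \<open>'l\<close>; the image of K in L is
  \<open>{c \<cdot> 1 | c \<in> K}\<close>.
\<close>

definition gal_group :: "('k::field \<Rightarrow> 'l::field \<Rightarrow> 'l) \<Rightarrow> ('l \<Rightarrow> 'l) monoid" where
  "gal_group sL =
     \<lparr>carrier = {\<sigma>. bij \<sigma> \<and> Vector_Spaces.linear sL sL \<sigma> \<and> \<sigma> 1 = 1 \<and> (\<forall>x y. \<sigma> (x * y) = \<sigma> x * \<sigma> y)},
      mult = (\<circ>), one = id\<rparr>"

locale galois_extension = K_algebra sL
  for sL :: "'k::field \<Rightarrow> 'l::field \<Rightarrow> 'l" +
  assumes finite_ext: "finite_dimensional sL"
    and fixed_field: "{x. \<forall>\<sigma>\<in>carrier (gal_group sL). \<sigma> x = x} = range (\<lambda>c. sL c 1)"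

definition intermediate_field :: "('k::field \<Rightarrow> 'l::field \<Rightarrow> 'l) \<Rightarrow> 'l set \<Rightarrow> bool" where
  "intermediate_field sL E \<longleftrightarrow> range (\<lambda>c. sL c 1) \<subseteq> E \<and>
     (\<forall>x\<in>E. \<forall>y\<in>E. x - y \<in> E \<and> x * y \<in> E) \<and> (\<forall>x\<in>E. inverse x \<in> E)"

section \<open>Hopf Galois structures\<close>

locale module_algebra = L: K_algebra sL + hopf_algebra sH \<Delta> \<epsilon> S
  for sL :: "'k::field \<Rightarrow> 'l::field \<Rightarrow> 'l"
    and sH :: "'k \<Rightarrow> 'h::ring_1 \<Rightarrow> 'h"
    and \<Delta> :: "'h \<Rightarrow> ('h \<times> 'h \<Rightarrow>\<^sub>0 'k)" and \<epsilon> :: "'h \<Rightarrow> 'k" and S :: "'h \<Rightarrow> 'h" +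
  fixes act :: "'h \<Rightarrow> 'l \<Rightarrow> 'l"
  assumes act_linear_left: "Vector_Spaces.linear sH sL (\<lambda>h. act h x)"
    and act_linear_right: "Vector_Spaces.linear sL sL (act h)"
    and act_one_left: "act 1 x = x"
    and act_mult_left: "act (g * h) x = act g (act h x)"
    and act_one_right: "act h 1 = sL (\<epsilon> h) 1"
    and act_mult_right: "act h (x * y) = lin_ext sL (\<lambda>(a, b). act a x * act b y) (\<Delta> h)"

text \<open>\<open>x \<otimes> h \<mapsto> (y \<mapsto> x (h y))\<close>, on representatives\<close>

definition galois_map ::
  "('k::field \<Rightarrow> 'l::field \<Rightarrow> 'l) \<Rightarrow> ('h \<Rightarrow> 'l \<Rightarrow> 'l) \<Rightarrow> ('l \<times> 'h \<Rightarrow>\<^sub>0 'k) \<Rightarrow> 'l \<Rightarrow> 'l" where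
  "galois_map sL act t = (\<lambda>y. lin_ext sL (\<lambda>(x, h). x * act h y) t)"

text \<open>
  \<open>galois_map\<close> is constant on every class \<open>X\<close> in \<open>L \<otimes> H\<close>; \<open>the_elem\<close> picks its value there.
\<close>

locale hopf_galois_structure =
  module_algebra sL sH \<Delta> \<epsilon> S act + fd_cocomm_hopf_algebra sH \<Delta> \<epsilon> S
  for sL :: "'k::field \<Rightarrow> 'l::field \<Rightarrow> 'l"
    and sH :: "'k \<Rightarrow> 'h::ring_1 \<Rightarrow> 'h"
    and \<Delta> :: "'h \<Rightarrow> ('h \<times> 'h \<Rightarrow>\<^sub>0 'k)" and \<epsilon> :: "'h \<Rightarrow> 'k" and S :: "'h \<Rightarrow> 'h"
    and act :: "'h \<Rightarrow> 'l \<Rightarrow> 'l" +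
  assumes finite_ext: "finite_dimensional sL"
    and galois_bij: "bij_betw (\<lambda>X. the_elem (galois_map sL act ` X))
      (tensor_space sL sH) {f. Vector_Spaces.linear sL sL f}"

definition fixed_subfield ::
  "('k::field \<Rightarrow> 'l::field \<Rightarrow> 'l) \<Rightarrow> ('h \<Rightarrow> 'k) \<Rightarrow> ('h \<Rightarrow> 'l \<Rightarrow> 'l) \<Rightarrow> 'h set \<Rightarrow> 'l set" where
  "fixed_subfield sL \<epsilon> act J = {x. \<forall>h\<in>J. act h x = sL (\<epsilon> h) x}"

definition strong_galois_correspondence ::
  "('k::field \<Rightarrow> 'l::field \<Rightarrow> 'l) \<Rightarrow> ('k \<Rightarrow> 'h::ring_1 \<Rightarrow> 'h) \<Rightarrow> ('h \<Rightarrow> ('h \<times> 'h \<Rightarrow>\<^sub>0 'k)) \<Rightarrow> ('h \<Rightarrow> 'k)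
    \<Rightarrow> ('h \<Rightarrow> 'h) \<Rightarrow> ('h \<Rightarrow> 'l \<Rightarrow> 'l) \<Rightarrow> bool" where
  "strong_galois_correspondence sL sH \<Delta> \<epsilon> S act \<longleftrightarrow>
     bij_betw (fixed_subfield sL \<epsilon> act) {J. sub_hopf_algebra sH \<Delta> S J} {E. intermediate_field sL E}"

section \<open>The Greither--Pareigis correspondence and the type\<close>

definition left_transl :: "('g, 'm) monoid_scheme \<Rightarrow> 'g \<Rightarrow> 'g \<Rightarrow> 'g" where
  "left_transl \<Gamma> \<gamma> = (\<lambda>\<delta>\<in>carrier \<Gamma>. \<gamma> \<otimes>\<^bsub>\<Gamma>\<^esub> \<delta>)"

definition conj_transl :: "('g, 'm) monoid_scheme \<Rightarrow> 'g \<Rightarrow> ('g \<Rightarrow> 'g) \<Rightarrow> ('g \<Rightarrow> 'g)" where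
  "conj_transl \<Gamma> \<gamma> \<eta> =
     left_transl \<Gamma> \<gamma> \<otimes>\<^bsub>BijGroup (carrier \<Gamma>)\<^esub> \<eta> \<otimes>\<^bsub>BijGroup (carrier \<Gamma>)\<^esub>
       inv\<^bsub>BijGroup (carrier \<Gamma>)\<^esub> (left_transl \<Gamma> \<gamma>)"

definition regular_normalized :: "('g, 'm) monoid_scheme \<Rightarrow> ('g \<Rightarrow> 'g) set \<Rightarrow> bool" where
  "regular_normalized \<Gamma> N \<longleftrightarrow>
     subgroup N (BijGroup (carrier \<Gamma>)) \<and>
     (\<forall>\<delta>\<in>carrier \<Gamma>. \<forall>\<delta>'\<in>carrier \<Gamma>. \<exists>!\<eta>. \<eta> \<in> N \<and> \<eta> \<delta> = \<delta>') \<and>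
     (\<forall>\<gamma>\<in>carrier \<Gamma>. \<forall>\<eta>\<in>N. conj_transl \<Gamma> \<gamma> \<eta> \<in> N)"

text \<open>
  Elements \<open>\<Sum> s\<^sub>\<eta> \<eta>\<close> of the group algebra L[N], for N a subgroup of a group P, are the formal
  combinations with support in N.
\<close>

definition group_algebra_mult ::
  "('p, 'm) monoid_scheme \<Rightarrow> ('p \<Rightarrow>\<^sub>0 'l::field) \<Rightarrow> ('p \<Rightarrow>\<^sub>0 'l) \<Rightarrow> ('p \<Rightarrow>\<^sub>0 'l)" where
  "group_algebra_mult P s t =
     lin_ext free_scale (\<lambda>\<eta>. lin_ext free_scale (\<lambda>\<theta>. basis_vec (\<eta> \<otimes>\<^bsub>P\<^esub> \<theta>)) t) s"

definition group_algebra_counit :: "('p \<Rightarrow>\<^sub>0 'l::field) \<Rightarrow> 'l" where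
  "group_algebra_counit = lin_ext (*) (\<lambda>\<eta>. 1)"

definition group_algebra_comult ::
  "('p \<Rightarrow>\<^sub>0 'l::field) \<Rightarrow> (('p \<Rightarrow>\<^sub>0 'l) \<times> ('p \<Rightarrow>\<^sub>0 'l) \<Rightarrow>\<^sub>0 'l)" where
  "group_algebra_comult = lin_ext free_scale (\<lambda>\<eta>. basis_vec (basis_vec \<eta>, basis_vec \<eta>))"

text \<open>The action \<open>\<gamma> (\<Sum> s\<^sub>\<eta> \<eta>) = \<Sum> \<gamma>(s\<^sub>\<eta>) (\<lambda>(\<gamma>) \<eta> \<lambda>(\<gamma>)\<^sup>-\<^sup>1)\<close> and its fixed points in L[N].\<close>

definition group_algebra_gal ::
  "('k::field \<Rightarrow> 'l::field \<Rightarrow> 'l) \<Rightarrow> ('l \<Rightarrow> 'l)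
    \<Rightarrow> ((('l \<Rightarrow> 'l) \<Rightarrow> ('l \<Rightarrow> 'l)) \<Rightarrow>\<^sub>0 'l) \<Rightarrow> ((('l \<Rightarrow> 'l) \<Rightarrow> ('l \<Rightarrow> 'l)) \<Rightarrow>\<^sub>0 'l)" where
  "group_algebra_gal sL \<gamma> s =
     (\<Sum>\<eta>\<in>Poly_Mapping.keys s. Poly_Mapping.single (conj_transl (gal_group sL) \<gamma> \<eta>) (\<gamma> (Poly_Mapping.lookup s \<eta>)))"

definition descended_algebra ::
  "('k::field \<Rightarrow> 'l::field \<Rightarrow> 'l) \<Rightarrow> (('l \<Rightarrow> 'l) \<Rightarrow> ('l \<Rightarrow> 'l)) set
    \<Rightarrow> ((('l \<Rightarrow> 'l) \<Rightarrow> ('l \<Rightarrow> 'l)) \<Rightarrow>\<^sub>0 'l) set" where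
  "descended_algebra sL N =
     {s. Poly_Mapping.keys s \<subseteq> N \<and> (\<forall>\<gamma>\<in>carrier (gal_group sL). group_algebra_gal sL \<gamma> s = s)}"

text \<open>\<open>(\<Sum> s\<^sub>\<eta> \<eta>) x = \<Sum> s\<^sub>\<eta> \<eta>\<^sup>-\<^sup>1(1\<^sub>\<Gamma>)(x)\<close>\<close>

definition group_algebra_act ::
  "('k::field \<Rightarrow> 'l::field \<Rightarrow> 'l) \<Rightarrow> ((('l \<Rightarrow> 'l) \<Rightarrow> ('l \<Rightarrow> 'l)) \<Rightarrow>\<^sub>0 'l) \<Rightarrow> 'l \<Rightarrow> 'l" where
  "group_algebra_act sL s x =
     lin_ext (*) (\<lambda>\<eta>. (inv\<^bsub>BijGroup (carrier (gal_group sL))\<^esub> \<eta>) \<one>\<^bsub>gal_group sL\<^esub> x) s"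

text \<open>
  N corresponds to the Hopf Galois structure H if there is an isomorphism \<open>\<phi>\<close> of K-Hopf algebras
  from H onto \<open>L[N]\<^sup>\<Gamma>\<close> that is compatible with the actions on L.  The Hopf algebra structure of
  \<open>L[N]\<^sup>\<Gamma>\<close> is the one restricted from L[N]; comultiplications are therefore compared in
  \<open>L[N] \<otimes>\<^sub>L L[N]\<close>, into which \<open>L[N]\<^sup>\<Gamma> \<otimes>\<^sub>K L[N]\<^sup>\<Gamma>\<close> embeds.  Antipodes need not be mentioned, since a
  bialgebra isomorphism between Hopf algebras preserves them.
\<close>

definition gp_corresponds ::
  "('k::field \<Rightarrow> 'l::field \<Rightarrow> 'l) \<Rightarrow> ('k \<Rightarrow> 'h::ring_1 \<Rightarrow> 'h) \<Rightarrow> ('h \<Rightarrow> ('h \<times> 'h \<Rightarrow>\<^sub>0 'k)) \<Rightarrow> ('h \<Rightarrow> 'k)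
    \<Rightarrow> ('h \<Rightarrow> 'l \<Rightarrow> 'l) \<Rightarrow> (('l \<Rightarrow> 'l) \<Rightarrow> ('l \<Rightarrow> 'l)) set \<Rightarrow> bool" where
  "gp_corresponds sL sH \<Delta> \<epsilon> act N \<longleftrightarrow>
     regular_normalized (gal_group sL) N \<and>
     (\<exists>\<phi> :: 'h \<Rightarrow> ((('l \<Rightarrow> 'l) \<Rightarrow> ('l \<Rightarrow> 'l)) \<Rightarrow>\<^sub>0 'l).
        bij_betw \<phi> UNIV (descended_algebra sL N) \<and>
        Vector_Spaces.linear sH (\<lambda>c. free_scale (sL c 1)) \<phi> \<and>
        \<phi> 1 = basis_vec \<one>\<^bsub>BijGroup (carrier (gal_group sL))\<^esub> \<and>
        (\<forall>g h. \<phi> (g * h) = group_algebra_mult (BijGroup (carrier (gal_group sL))) (\<phi> g) (\<phi> h)) \<and>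
        (\<forall>h. group_algebra_counit (\<phi> h) = sL (\<epsilon> h) 1) \<and>
        (\<forall>h. tensor_eq free_scale free_scale (group_algebra_comult (\<phi> h))
           (lin_ext (\<lambda>c. free_scale (sL c 1)) (\<lambda>(a, b). basis_vec (\<phi> a, \<phi> b)) (\<Delta> h))) \<and>
        (\<forall>h x. act h x = group_algebra_act sL (\<phi> h) x))"

definition has_type ::
  "('k::field \<Rightarrow> 'l::field \<Rightarrow> 'l) \<Rightarrow> ('k \<Rightarrow> 'h::ring_1 \<Rightarrow> 'h) \<Rightarrow> ('h \<Rightarrow> ('h \<times> 'h \<Rightarrow>\<^sub>0 'k)) \<Rightarrow> ('h \<Rightarrow> 'k)
    \<Rightarrow> ('h \<Rightarrow> 'l \<Rightarrow> 'l) \<Rightarrow> ('g, 'm) monoid_scheme \<Rightarrow> bool" where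
  "has_type sL sH \<Delta> \<epsilon> act G \<longleftrightarrow> group G \<and>
     (\<exists>\<alpha> \<in> hom G (BijGroup (carrier (gal_group sL))).
        inj_on \<alpha> (carrier G) \<and> gp_corresponds sL sH \<Delta> \<epsilon> act (\<alpha> ` carrier G))"

end

theory Submission
  imports Defs "HOL-Algebra.Multiplicative_Group" "HOL-Algebra.Group_Action" "HOL-Number_Theory.Cong"
begin

text \<open>
  Every element of \<open>H\<close> acts on \<open>L\<close> as an \<open>L\<close>-linear combination of Galois automorphisms, which
  identifies \<open>L \<otimes> H\<close> with \<open>End\<^sub>K(L)\<close>, that is, with the functions \<open>\<Gamma> \<rightarrow> L\<close>, as a coalgebra with group-like
  basis \<open>\<Gamma>\<close>.  The action of \<open>\<Gamma>\<close> on the factor \<open>L\<close> permutes the group-likes, and their multiplication is a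
  second group structure \<open>\<star>\<close> on the set \<open>\<Gamma>\<close>; together they form a skew brace.  The right translations of
  \<open>\<star>\<close> make up the Greither--Pareigis subgroup \<open>N\<close>, and Galois descent turns sub-Hopf algebras of \<open>H\<close> into
  the subgroups of \<open>(\<Gamma>, \<star>)\<close> that are stable under that permutation action, each of which is also a
  subgroup \<open>I\<close> of \<open>\<Gamma>\<close> and has fixed field \<open>L\<^sup>I\<close>.

  A regular subgroup \<open>N\<close> normalised by \<open>\<lambda>(\<Gamma>)\<close>, with \<open>\<Gamma>\<close> cyclic of odd prime power order, is cyclic: a
  generator of \<open>\<Gamma>\<close> yields an affine map of \<open>N\<close> that permutes \<open>N\<close> in a single cycle, and if \<open>N\<close> were not
  cyclic, this map would induce a single cycle on a quotient of order \<open>p\<^sup>2\<close> of exponent \<open>p\<close>, whereas affine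
  maps of \<open>p\<close>-power order there have order \<open>p\<close>.  So \<open>(\<Gamma>, \<star>)\<close> is cyclic, all its subgroups are
  characteristic, and each subgroup of \<open>\<Gamma>\<close> occurs as some \<open>I\<close>.
\<close>

section \<open>Finite groups of prime power order\<close>

text \<open>The essential use of \<open>odd p\<close> is that \<open>p\<close> dividing
  \<open>k\<close> forces \<open>p\<close> to divide \<open>k choose 2\<close>. For
  \<open>p = 2\<close> the statement fails: a cyclic extension of degree 4 also has Hopf Galois
  structures of Klein four type, because an affine map can permute the plane over the field with two
  elements in one cycle. Quotient groups are never formed; characters with integer values modulo
  \<open>p\<close> replace them, and the affine map is studied through finite differences of a
  character along its orbit.

  On the Hopf side the group-likes exist only after extending scalars to \<open>L\<close>, while the
  axioms speak of representatives over \<open>K\<close>. Each \<open>h\<close> is therefore handled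
  through its coordinates \<open>coef h \<gamma>\<close> in \<open>L\<close>. Surjectivity of the
  Galois map makes these functionals independent over \<open>L\<close>; together with injectivity it
  makes them span all K-linear maps from \<open>H\<close> to \<open>L\<close>. An element
  \<open>u\<close> of trace 1 leads back to \<open>K\<close>, since
  \<open>x \<mapsto> tr (u * x)\<close> retracts \<open>L\<close> onto \<open>K\<close>. Identities
  are proved by comparing coordinates, in place of dimension counts.\<close>

lemma (in group) finite_submonoid_is_subgroup:
  assumes "finite (carrier G)" "H \<subseteq> carrier G" "\<one> \<in> H"
    and "\<And>x y. x \<in> H \<Longrightarrow> y \<in> H \<Longrightarrow> x \<otimes> y \<in> H"
  shows "subgroup H G"
proof (rule subgroupI)
  fix a assume a: "a \<in> H"
  have pow: "a [^] (k::nat) \<in> H" for k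
    by (induction k) (use assms a in auto)
  have ac: "a \<in> carrier G" using a assms by auto
  have "ord a > 0" using ac assms(1) ord_ge_1[of a] by simp
  then have "a [^] (ord a - 1) \<otimes> a = \<one>"
    by (metis Suc_diff_1 ac nat_pow_Suc pow_ord_eq_1)
  then have "inv a = a [^] (ord a - 1)"
    using ac by (intro inv_equality) auto
  then show "inv a \<in> H" using pow by simp
qed (use assms in auto)

text \<open>An orbit of a \<open>p\<close>-group has \<open>p\<close>-power size by the
  orbit-stabiliser theorem, so modulo \<open>p\<close> only the one-point orbits count. The
  operation is a plain function that need only behave on \<open>E\<close>; restricted to
  \<open>E\<close> it supplies the bijections that \<open>group_action\<close> demands.\<close>

lemma (in group) card_fixed_points_cong:
  assumes "prime p" "order G = p ^ m" "finite E"
    and closed: "\<And>g x. g \<in> carrier G \<Longrightarrow> x \<in> E \<Longrightarrow> act g x \<in> E"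
    and one: "\<And>x. x \<in> E \<Longrightarrow> act \<one> x = x"
    and mult: "\<And>g h x. g \<in> carrier G \<Longrightarrow> h \<in> carrier G \<Longrightarrow> x \<in> E \<Longrightarrow> act (g \<otimes> h) x = act g (act h x)"
  shows "[card E = card {x \<in> E. \<forall>g\<in>carrier G. act g x = x}] (mod p)"
proof -
  let ?\<phi> = "\<lambda>g. \<lambda>x\<in>E. act g x"
  have bij: "?\<phi> g \<in> Bij E" if g: "g \<in> carrier G" for g
  proof -
    have "bij_betw (act g) E E"
      by (rule bij_betw_byWitness[where f' = "act (inv g)"])
        (use g one mult closed in \<open>auto simp flip: mult\<close>)
    then show ?thesis by (simp add: Bij_def bij_betw_restrict_eq)
  qed
  interpret act: group_action G E ?\<phi>
  proof (unfold group_action_def group_hom_def group_hom_axioms_def, intro conjI)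
    show "?\<phi> \<in> hom G (BijGroup E)"
      by (rule homI) (use bij mult closed in \<open>auto simp: BijGroup_def compose_def fun_eq_iff\<close>)
  qed (auto simp: group_BijGroup)
  let ?O = "orbits G E ?\<phi>" and ?F = "{x \<in> E. \<forall>g\<in>carrier G. act g x = x}"
  have orb_sub: "R \<subseteq> E" "R \<noteq> {}" if "R \<in> ?O" for R
    using that act.orbit_refl closed by (auto simp: orbits_def orbit_def)
  have disj: "R \<inter> R' = {}" if "R \<in> ?O" "R' \<in> ?O" "R \<noteq> R'" for R R'
    using act.disjoint_union that by blast
  have UO: "\<Union>?O = E" by (rule act.orbits_coverture)
  have "finite ?O" using assms(3) orb_sub by (meson Pow_iff finite_Pow_iff finite_subset subsetI)
  then have "card E = (\<Sum>R\<in>?O. card R)"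
    using card_Union_disjoint[of ?O] UO disj finite_subset[OF orb_sub(1) assms(3)]
    by (simp add: pairwise_def disjnt_def)
  moreover have "card ?F = (\<Sum>R\<in>?O. card (R \<inter> ?F))"
  proof -
    have "?F = (\<Union>R\<in>?O. R \<inter> ?F)" using UO by blast
    then have "card ?F = card (\<Union>R\<in>?O. R \<inter> ?F)" by simp
    also have "\<dots> = (\<Sum>R\<in>?O. card (R \<inter> ?F))"
      by (rule card_UN_disjoint) (use \<open>finite ?O\<close> assms(3) disj in auto)
    finally show ?thesis .
  qed
  moreover have "[card R = card (R \<inter> ?F)] (mod p)" if R: "R \<in> ?O" for R
  proof -
    obtain x where x: "x \<in> E" "R = orbit G ?\<phi> x" using R by (auto simp: orbits_def)
    have "card R * card (stabilizer G ?\<phi> x) = p ^ m"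
      using act.orbit_stabilizer_theorem[OF x(1)] x assms(2) by simp
    then have "card R dvd p ^ m" by (metis dvd_triv_left)
    then obtain k where k: "card R = p ^ k" using assms(1) divides_primepow_nat by blast
    have xR: "x \<in> R" using x act.orbit_refl by simp
    show ?thesis
    proof (cases "k = 0")
      case True
      then have "R = {x}" using k xR by (metis One_nat_def card_1_singletonE power_0 singletonD)
      moreover have "act g x \<in> R" if "g \<in> carrier G" for g
        using that x by (auto simp: orbit_def)
      ultimately have "R \<inter> ?F = R" using x by auto
      then show ?thesis by simp
    next
      case False
      have "R \<inter> ?F = {}"
      proof (rule ccontr)
        assume "R \<inter> ?F \<noteq> {}"
        then obtain y where y: "y \<in> R" "y \<in> ?F" by auto
        then have "x \<in> orbit G ?\<phi> y" using x orb_sub[OF R] act.orbit_sym by blast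
        then have "x = y" using y by (auto simp: orbit_def)
        then have "R = {x}" using x y xR by (auto simp: orbit_def)
        then have "p ^ k = 1" using k by simp
        moreover have "1 < p ^ k" using False one_less_power[OF prime_gt_1_nat[OF assms(1)], of k] by simp
        ultimately show False by linarith
      qed
      then show ?thesis using k False by (simp add: cong_0_iff)
    qed
  qed
  ultimately show ?thesis by (simp add: cong_sum)
qed

lemma (in group) maximal_subgroup_exists:
  assumes "finite (carrier G)" "subgroup H G" "H \<noteq> carrier G"
  obtains M where "subgroup M G" "H \<subseteq> M" "M \<noteq> carrier G"
    and "\<And>K. subgroup K G \<Longrightarrow> M \<subset> K \<Longrightarrow> K = carrier G"
proof -
  let ?S = "{M. subgroup M G \<and> H \<subseteq> M \<and> M \<noteq> carrier G}"
  have "finite ?S"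
    by (rule finite_subset[of _ "Pow (carrier G)"]) (use assms subgroup.subset in auto)
  moreover have "?S \<noteq> {}" using assms by auto
  ultimately obtain M where M: "M \<in> ?S" "\<forall>K\<in>?S. M \<subseteq> K \<longrightarrow> M = K"
    using finite_has_maximal[of ?S] by auto
  show ?thesis
  proof (rule that[of M])
    fix K assume "subgroup K G" "M \<subset> K"
    then show "K = carrier G" using M by blast
  qed (use M in auto)
qed

text \<open>Let \<open>M\<close> act on its right cosets: \<open>M #> y\<close> is fixed exactly
  when \<open>y\<close> conjugates \<open>M\<close> into itself. The index of \<open>M\<close> is
  divisible by \<open>p\<close>, so the fixed coset \<open>M\<close> is not the only one; the
  normaliser is then strictly larger than \<open>M\<close>, hence everything.\<close>

lemma (in group) maximal_subgroup_normalized: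
  assumes p: "prime p" "order G = p ^ n" and M: "subgroup M G" "M \<noteq> carrier G"
    and max: "\<And>K. subgroup K G \<Longrightarrow> M \<subset> K \<Longrightarrow> K = carrier G"
    and x: "x \<in> carrier G" "m \<in> M"
  shows "x \<otimes> m \<otimes> inv x \<in> M"
proof -
  have fin: "finite (carrier G)"
    using order_gt_0_iff_finite p prime_gt_0_nat[of p] by simp
  have Msub: "M \<subseteq> carrier G" using M subgroup.subset by auto
  then have Mc: "y \<in> carrier G" if "y \<in> M" for y using that by auto
  let ?K = "{y \<in> carrier G. \<forall>m\<in>M. y \<otimes> m \<otimes> inv y \<in> M}"
  have K: "subgroup ?K G"
  proof (rule finite_submonoid_is_subgroup[OF fin])
    fix y z assume yz: "y \<in> ?K" "z \<in> ?K"
    have "y \<otimes> z \<otimes> m \<otimes> inv (y \<otimes> z) \<in> M" if "m \<in> M" for m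
    proof -
      have "y \<otimes> (z \<otimes> m \<otimes> inv z) \<otimes> inv y \<in> M" using yz that by auto
      moreover have "m \<in> carrier G" using that Msub by auto
      ultimately show ?thesis using yz by (simp add: inv_mult_group m_assoc)
    qed
    then show "y \<otimes> z \<in> ?K" using yz by auto
  qed (use Msub M(1) Mc in \<open>auto simp: subgroup.one_closed\<close>)
  have MK: "M \<subseteq> ?K"
    using M(1) Msub by (auto intro!: subgroup.m_closed subgroup.m_inv_closed)
  interpret GM: group "G\<lparr>carrier := M\<rparr>" by (rule subgroup_imp_group[OF M(1)])
  let ?E = "rcosets M"
  have cardE: "card ?E * card M = p ^ n" using lagrange M p by simp
  have "card M dvd p ^ n" using cardE by (metis dvd_triv_right)
  then obtain m' where m': "card M = p ^ m'" using p divides_primepow_nat by blast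
  have "card ?E dvd p ^ n" using cardE by (metis dvd_triv_left)
  then obtain k where k: "card ?E = p ^ k" using p divides_primepow_nat by blast
  have "k \<noteq> 0"
  proof
    assume "k = 0"
    then have "card M = card (carrier G)" using cardE k p by (simp add: order_def)
    then show False using M Msub card_subset_eq[OF fin Msub] by simp
  qed
  then have "p dvd card ?E" using k by simp
  have finE: "finite ?E" by (rule card_ge_0_finite) (simp add: k prime_gt_0_nat[OF p(1)])
  \<comment> \<open>The inverse turns right multiplication into a left action.\<close>
  let ?F = "{C \<in> ?E. \<forall>g\<in>carrier (G\<lparr>carrier := M\<rparr>). C #> inv g = C}"
  have "[card ?E = card ?F] (mod p)"
  proof (rule GM.card_fixed_points_cong[where act = "\<lambda>g C. C #> inv g" and m = m'])
    fix g C assume gC: "g \<in> carrier (G\<lparr>carrier := M\<rparr>)" "C \<in> ?E"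
    then obtain y where y: "y \<in> carrier G" "C = M #> y" by (auto simp: RCOSETS_def)
    then have "C #> inv g = M #> (y \<otimes> inv g)" using gC Msub Mc by (simp add: coset_mult_assoc)
    then show "C #> inv g \<in> ?E" using y gC Mc by (auto simp: RCOSETS_def)
  next
    fix C assume "C \<in> ?E"
    then show "C #> inv \<one>\<^bsub>G\<lparr>carrier := M\<rparr>\<^esub> = C" using Msub by (auto simp: RCOSETS_def coset_mult_assoc)
  next
    fix g h C assume gh: "g \<in> carrier (G\<lparr>carrier := M\<rparr>)" "h \<in> carrier (G\<lparr>carrier := M\<rparr>)" and "C \<in> ?E"
    then obtain y where y: "y \<in> carrier G" "C = M #> y" by (auto simp: RCOSETS_def)
    show "C #> inv (g \<otimes>\<^bsub>G\<lparr>carrier := M\<rparr>\<^esub> h) = C #> inv h #> inv g"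
      using Msub Mc gh y by (simp add: coset_mult_assoc inv_mult_group m_assoc)
  qed (use p m' finE in \<open>auto simp: order_def\<close>)
  then have "p dvd card ?F" using \<open>p dvd card ?E\<close> cong_dvd_iff by blast
  have M_in: "M \<in> ?F"
  proof -
    have "M = M #> \<one>" using Msub by simp
    moreover have "M #> inv g = M" if "g \<in> M" for g
      using that M(1) Mc by (intro coset_join2) (auto intro: subgroup.m_inv_closed)
    ultimately show ?thesis by (auto simp: RCOSETS_def)
  qed
  have "?F \<noteq> {M}"
  proof
    assume "?F = {M}"
    then have "p dvd 1" using \<open>p dvd card ?F\<close> by simp
    then show False using p by simp
  qed
  then obtain C where C: "C \<in> ?F" "C \<noteq> M" using M_in by blast
  then obtain y where y: "y \<in> carrier G" "C = M #> y" by (auto simp: RCOSETS_def)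
  have "y \<notin> M" using C y M by (metis coset_join2)
  have "y \<in> ?K"
  proof -
    have "y \<otimes> m \<otimes> inv y \<in> M" if m: "m \<in> M" for m
    proof -
      have im: "inv m \<in> M" by (rule subgroup.m_inv_closed[OF M(1) m])
      then have "M #> y #> inv (inv m) = M #> y" using C y by auto
      then have "M #> (y \<otimes> m) = M #> y" using m y Msub Mc by (simp add: coset_mult_assoc)
      then have "M #> (y \<otimes> m \<otimes> inv y) = M #> y #> inv y"
        using y m Msub Mc by (subst coset_mult_assoc[symmetric]) auto
      also have "\<dots> = M" using y Msub by (simp add: coset_mult_assoc)
      finally have "M #> (y \<otimes> m \<otimes> inv y) = M" .
      then show ?thesis using y m Mc by (intro coset_join1[OF _ _ M(1)]) auto
    qed
    then show ?thesis using y by auto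
  qed
  then have "M \<subset> ?K" using MK \<open>y \<notin> M\<close> by auto
  then have "?K = carrier G" by (rule max[OF K])
  then show ?thesis using x by blast
qed

text \<open>A maximal subgroup \<open>M\<close> above \<open>H\<close> is normal with quotient of
  order \<open>p\<close>, and \<open>\<chi>\<close> is the discrete logarithm to the base
  \<open>z\<close> in that quotient. It is chosen as an integer and meaningful only modulo
  \<open>p\<close>.\<close>

lemma (in group) p_group_character:
  assumes p: "prime p" "order G = p ^ n" and H: "subgroup H G" "H \<noteq> carrier G"
  obtains \<chi> :: "'a \<Rightarrow> int" where
    "\<And>x y. x \<in> carrier G \<Longrightarrow> y \<in> carrier G \<Longrightarrow> [\<chi> (x \<otimes> y) = \<chi> x + \<chi> y] (mod int p)"
    and "\<And>x. x \<in> H \<Longrightarrow> [\<chi> x = 0] (mod int p)"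
    and "\<exists>x\<in>carrier G. \<not> [\<chi> x = 0] (mod int p)"
proof -
  have fin: "finite (carrier G)"
    using order_gt_0_iff_finite p prime_gt_0_nat[of p] by simp
  obtain M where M: "subgroup M G" "H \<subseteq> M" "M \<noteq> carrier G"
    and max: "\<And>K. subgroup K G \<Longrightarrow> M \<subset> K \<Longrightarrow> K = carrier G"
    using maximal_subgroup_exists[OF fin H] by blast
  have norm: "x \<otimes> m \<otimes> inv x \<in> M" if "x \<in> carrier G" "m \<in> M" for x m
    using maximal_subgroup_normalized[OF p M(1,3)] max that by blast
  have Mc: "m \<in> carrier G" if "m \<in> M" for m by (rule subgroup.mem_carrier[OF M(1) that])
  note Mcl = subgroup.m_closed[OF M(1)] subgroup.m_inv_closed[OF M(1)] subgroup.one_closed[OF M(1)]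
  obtain x where x: "x \<in> carrier G" "x \<notin> M" using M Mc by blast
  let ?P = "\<lambda>k. x [^] (p ^ k) \<in> M"
  have "?P n" using pow_order_eq_1[OF x(1)] p(2) Mcl by simp
  \<comment> \<open>The last of the powers \<open>x [^] (p ^ i)\<close> to lie outside
    \<open>M\<close> has order exactly \<open>p\<close> modulo \<open>M\<close>; it becomes the base
    \<open>z\<close>.\<close>
  define k where "k = (LEAST k. ?P k)"
  have Pk: "?P k" using \<open>?P n\<close> unfolding k_def by (rule LeastI)
  have "k \<noteq> 0" using Pk x by (metis nat_pow_eone nat_pow_0 nat_pow_Suc l_one One_nat_def power_0)
  then obtain k' where k': "k = Suc k'" using not0_implies_Suc by blast
  define z where "z = x [^] (p ^ k')"
  have zc: "z \<in> carrier G" using x z_def by simp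
  have zM: "z \<notin> M" using not_less_Least[of k' ?P] k' by (simp add: z_def k_def)
  have zp: "z [^] p \<in> M" using Pk x by (simp add: z_def nat_pow_pow k' mult.commute)
  have zdvd: "int p dvd j" if "z [^] j \<in> M" for j :: int
  proof (rule ccontr)
    assume "\<not> int p dvd j"
    then have "coprime (int p) j" using p(1) by (simp add: prime_imp_coprime)
    then obtain u v where uv: "u * int p + v * j = 1"
      by (metis bezout_int coprime_iff_gcd_eq_1)
    have "(z [^] int p) [^] u \<otimes> (z [^] j) [^] v \<in> M"
      using zp that by (intro Mcl(1) subgroup_int_pow_closed[OF M(1), of "z [^] int p"]
        subgroup_int_pow_closed[OF M(1), of "z [^] j"]) (auto simp: int_pow_int)
    also have "(z [^] int p) [^] u \<otimes> (z [^] j) [^] v = z [^] (1::int)"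
      using zc uv by (simp add: int_pow_pow int_pow_mult[symmetric] mult.commute)
    finally show False using zc zM by simp
  qed
  \<comment> \<open>\<open>?K\<close> is the product of \<open>M\<close> with the powers of
    \<open>z\<close>. Maximality of \<open>M\<close> makes it everything, so logarithms to the base
    \<open>z\<close> exist.\<close>
  let ?K = "{y \<in> carrier G. \<exists>j::int. y \<otimes> inv (z [^] j) \<in> M}"
  have add: "(y \<otimes> y') \<otimes> inv (z [^] (i + j)) \<in> M"
    if "y \<in> carrier G" "y' \<in> carrier G" "y \<otimes> inv (z [^] i) \<in> M" "y' \<otimes> inv (z [^] j) \<in> M"
    for y y' and i j :: int
  proof -
    have "(y \<otimes> inv (z [^] i)) \<otimes> (z [^] i \<otimes> (y' \<otimes> inv (z [^] j)) \<otimes> inv (z [^] i)) \<in> M"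
      by (rule Mcl(1)[OF that(3) norm[OF int_pow_closed[OF zc] that(4)]])
    also have "(y \<otimes> inv (z [^] i)) \<otimes> (z [^] i \<otimes> (y' \<otimes> inv (z [^] j)) \<otimes> inv (z [^] i))
        = (y \<otimes> y') \<otimes> inv (z [^] i \<otimes> z [^] j)"
      using that zc by (simp add: m_assoc inv_mult_group) (simp add: m_assoc[symmetric])
    finally show ?thesis using zc by (simp add: int_pow_mult)
  qed
  have MK: "M \<subseteq> ?K"
  proof
    fix m assume "m \<in> M"
    then have "m \<otimes> inv (z [^] (0::int)) \<in> M" using Mc by simp
    then show "m \<in> ?K" using Mc \<open>m \<in> M\<close> by blast
  qed
  have "subgroup ?K G"
  proof (rule finite_submonoid_is_subgroup[OF fin])
    show "\<one> \<in> ?K" using MK Mcl by blast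
  next
    fix y y' assume "y \<in> ?K" "y' \<in> ?K"
    then show "y \<otimes> y' \<in> ?K" using add by blast
  qed auto
  moreover have "z \<otimes> inv (z [^] (1::int)) \<in> M" using zc Mcl by simp
  then have "z \<in> ?K" using zc by blast
  ultimately have K: "?K = carrier G" using max MK zM by blast
  define \<chi> where "\<chi> y = (SOME j::int. y \<otimes> inv (z [^] j) \<in> M)" for y
  have \<chi>: "y \<otimes> inv (z [^] \<chi> y) \<in> M" if "y \<in> carrier G" for y
    unfolding \<chi>_def by (rule someI_ex) (use that K in blast)
  have uniq: "[\<chi> y = j] (mod int p)" if "y \<in> carrier G" "y \<otimes> inv (z [^] j) \<in> M" for y and j :: int
  proof -
    have "inv (y \<otimes> inv (z [^] \<chi> y)) \<otimes> (y \<otimes> inv (z [^] j)) \<in> M"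
      by (rule Mcl(1)[OF Mcl(2)[OF \<chi>[OF that(1)]] that(2)])
    also have "inv (y \<otimes> inv (z [^] \<chi> y)) \<otimes> (y \<otimes> inv (z [^] j)) = z [^] (\<chi> y - j)"
      using that zc by (simp add: inv_mult_group int_pow_diff m_assoc) (simp add: m_assoc[symmetric])
    finally show ?thesis using zdvd by (simp add: cong_iff_dvd_diff)
  qed
  show ?thesis
  proof (rule that[of \<chi>])
    show "[\<chi> (x \<otimes> y) = \<chi> x + \<chi> y] (mod int p)" if "x \<in> carrier G" "y \<in> carrier G" for x y
      by (rule uniq) (use that add \<chi> in auto)
    show "[\<chi> x = 0] (mod int p)" if "x \<in> H" for x
      by (rule uniq) (use that M Mc in auto)
    have "\<not> [\<chi> z = 0] (mod int p)"
    proof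
      assume "[\<chi> z = 0] (mod int p)"
      moreover have "[\<chi> z = 1] (mod int p)"
        by (rule uniq) (use zc Mcl in auto)
      ultimately have "[1 = 0] (mod int p)" by (meson cong_sym cong_trans)
      then show False using p(1) by (simp add: cong_0_iff)
    qed
    then show "\<exists>x\<in>carrier G. \<not> [\<chi> x = 0] (mod int p)" using zc by blast
  qed
qed

section \<open>Finite differences modulo a prime\<close>

definition forward_diff :: "nat \<Rightarrow> (nat \<Rightarrow> int) \<Rightarrow> nat \<Rightarrow> int" where
  "forward_diff s f k = f (k + s) - f k"

text \<open>With \<open>E\<close> the shift by one, \<open>forward_diff s\<close> is the operator
  \<open>E^s - 1\<close>, and this is its binomial expansion. Pascal's rule needs one sum shifted by
  an index; the \<open>if\<close> keeps both sums over the same range.\<close>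

lemma forward_diff_funpow:
  "(forward_diff s ^^ m) f k = (\<Sum>j\<le>m. (-1) ^ (m - j) * int (m choose j) * f (k + s * j))"
proof (induction m arbitrary: k)
  case (Suc m)
  let ?c = "\<lambda>m j. (-1) ^ (m - j) * int (m choose j)"
  have "(forward_diff s ^^ Suc m) f k = (forward_diff s ^^ m) f (k + s) - (forward_diff s ^^ m) f k"
    by (simp add: forward_diff_def)
  also have "\<dots> = (\<Sum>j\<le>m. ?c m j * f (k + s * Suc j)) - (\<Sum>j\<le>m. ?c m j * f (k + s * j))"
    by (simp add: Suc.IH algebra_simps)
  also have "(\<Sum>j\<le>m. ?c m j * f (k + s * j))
      = ?c m 0 * f k + (\<Sum>j\<le>m. (if j < m then ?c m (Suc j) * f (k + s * Suc j) else 0))"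
  proof (cases m)
    case (Suc m')
    have "(\<Sum>j\<le>m. ?c m j * f (k + s * j)) = ?c m 0 * f k + (\<Sum>j\<le>m'. ?c m (Suc j) * f (k + s * Suc j))"
      unfolding Suc by (subst sum.atMost_Suc_shift) simp
    also have "(\<Sum>j\<le>m'. ?c m (Suc j) * f (k + s * Suc j))
        = (\<Sum>j\<le>m. (if j < m then ?c m (Suc j) * f (k + s * Suc j) else 0))"
      unfolding Suc by simp
    finally show ?thesis .
  qed simp
  also have "(\<Sum>j\<le>m. ?c m j * f (k + s * Suc j))
      - (?c m 0 * f k + (\<Sum>j\<le>m. (if j < m then ?c m (Suc j) * f (k + s * Suc j) else 0)))
      = ?c (Suc m) 0 * f k + (\<Sum>j\<le>m. ?c (Suc m) (Suc j) * f (k + s * Suc j))"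
  proof -
    have "?c m j * x - (if j < m then ?c m (Suc j) * x else 0) = ?c (Suc m) (Suc j) * x"
      if "j \<le> m" for j x
    proof (cases "j < m")
      case True
      then have "m - j = Suc (m - Suc j)" by simp
      then show ?thesis using True by (simp add: algebra_simps)
    qed (use that in auto)
    then have "(\<Sum>j\<le>m. ?c m j * f (k + s * Suc j))
        - (\<Sum>j\<le>m. (if j < m then ?c m (Suc j) * f (k + s * Suc j) else 0))
        = (\<Sum>j\<le>m. ?c (Suc m) (Suc j) * f (k + s * Suc j))"
      unfolding sum_subtractf[symmetric] by (intro sum.cong[OF refl]) (simp only: atMost_iff)
    then show ?thesis by simp
  qed
  also have "\<dots> = (\<Sum>j\<le>Suc m. ?c (Suc m) j * f (k + s * j))"
    by (subst sum.atMost_Suc_shift) simp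
  finally show ?case .
qed simp

lemma forward_diff_funpow_cong:
  assumes "\<And>k. [f k = g k] (mod c)"
  shows "[(forward_diff s ^^ m) f k = (forward_diff s ^^ m) g k] (mod c)"
  unfolding forward_diff_funpow by (intro cong_sum cong_mult cong_refl assms)

text \<open>Frobenius for \<open>E^s - 1\<close>: the inner binomial coefficients are divisible by
  \<open>p\<close>, and \<open>odd p\<close> gives the term at \<open>j = 0\<close> its
  sign.\<close>

lemma forward_diff_funpow_prime:
  assumes "prime p" "odd p"
  shows "[(forward_diff s ^^ p) f k = forward_diff (s * p) f k] (mod int p)"
proof -
  have "(forward_diff s ^^ p) f k
      = (\<Sum>j\<le>p. (-1) ^ (p - j) * int (p choose j) * f (k + s * j))"
    by (rule forward_diff_funpow)
  also have "[\<dots> = (\<Sum>j\<le>p. (if j = p then f (k + s * j) else 0) - (if j = 0 then f k else 0))] (mod int p)"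
  proof (rule cong_sum)
    fix j assume j: "j \<in> {..p}"
    show "[(-1) ^ (p - j) * int (p choose j) * f (k + s * j)
        = (if j = p then f (k + s * j) else 0) - (if j = 0 then f k else 0)] (mod int p)"
    proof (cases "j = 0 \<or> j = p")
      case True
      then show ?thesis using assms by (auto simp: prime_gt_0_nat)
    next
      case False
      then have "p dvd (p choose j)" using assms(1) j by (intro dvd_choose_prime) auto
      then have "int p dvd int (p choose j)" by simp
      then show ?thesis using False by (simp add: cong_0_iff)
    qed
  qed
  also have "(\<Sum>j\<le>p. (if j = p then f (k + s * j) else 0) - (if j = 0 then f k else 0))
      = forward_diff (s * p) f k"
    by (simp add: sum_subtractf forward_diff_def)
  finally show ?thesis .
qed

text \<open>Frobenius repeated \<open>n\<close> times. Its use: for a sequence with period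
  \<open>p ^ n\<close> the \<open>p ^ n\<close>-fold difference vanishes modulo
  \<open>p\<close>.\<close>

lemma forward_diff_funpow_prime_power:
  assumes "prime p" "odd p"
  shows "[(forward_diff 1 ^^ (p ^ n)) f k = forward_diff (p ^ n) f k] (mod int p)"
proof (induction n arbitrary: f k)
  case (Suc n)
  \<comment> \<open>The induction hypothesis, general in \<open>f\<close>, replaces one factor at a
    time inside the iterated operator.\<close>
  have "[(((forward_diff 1 ^^ (p ^ n)) ^^ m) f) k = ((forward_diff (p ^ n) ^^ m) f) k] (mod int p)" for m k
  proof (induction m arbitrary: k)
    case (Suc m)
    have "[((forward_diff 1 ^^ (p ^ n)) ^^ Suc m) f k
        = (forward_diff 1 ^^ (p ^ n)) ((forward_diff (p ^ n) ^^ m) f) k] (mod int p)"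
      using forward_diff_funpow_cong[OF Suc.IH] by simp
    also have "[(forward_diff 1 ^^ (p ^ n)) ((forward_diff (p ^ n) ^^ m) f) k
        = (forward_diff (p ^ n) ^^ Suc m) f k] (mod int p)"
      using \<open>\<And>f k. [(forward_diff 1 ^^ (p ^ n)) f k = forward_diff (p ^ n) f k] (mod int p)\<close> by simp
    finally show ?case .
  qed simp
  from this[of p k] have "[(forward_diff 1 ^^ (p ^ n * p)) f k = (forward_diff (p ^ n) ^^ p) f k] (mod int p)"
    by (simp add: funpow_mult mult.commute)
  also have "[(forward_diff (p ^ n) ^^ p) f k = forward_diff (p ^ n * p) f k] (mod int p)"
    by (rule forward_diff_funpow_prime[OF assms])
  finally show ?case by (simp add: mult.commute)
qed (simp add: forward_diff_def)

section \<open>Finite cyclic groups\<close>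

lemma (in group) generate_singleton_pow:
  assumes "finite (carrier G)" "a \<in> carrier G" "y \<in> generate G {a}"
  obtains k :: nat where "y = a [^] k"
proof -
  have "ord a \<noteq> 0" using ord_ge_1[OF assms(1,2)] by simp
  then show ?thesis using generate_pow_nat[OF assms(2)] assms(3) that by auto
qed

lemma (in group) card_roots_cyclic:
  assumes "cyclic_group G" "finite (carrier G)" "d dvd order G"
  shows "card {x \<in> carrier G. x [^] d = \<one>} = d"
proof -
  obtain a where a: "a \<in> carrier G" "subgroup_generated G {a} = G"
    using assms(1) by (auto simp: cyclic_group_def)
  then have gen: "carrier G = generate G {a}"
    by (metis carrier_subgroup_generated Int_insert_right Int_empty_right)
  then have ord: "ord a = order G" using generate_pow_card[OF a(1)] by (simp add: order_def)
  obtain e where e: "order G = d * e" using assms(3) by auto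
  have pos: "d > 0" "e > 0" using e assms(2) order_gt_0_iff_finite by (auto intro: gr0I)
  have "{x \<in> carrier G. x [^] d = \<one>} = (\<lambda>i. a [^] (e * i)) ` {..<d}"
  proof (intro equalityI subsetI)
    fix x assume x: "x \<in> {x \<in> carrier G. x [^] d = \<one>}"
    then have "x \<in> {a [^] k |k. k \<in> {0..ord a - 1}}"
      using gen generate_pow_nat[OF a(1)] ord ord_elems[OF assms(2) a(1)] e pos by auto
    then obtain k where k: "x = a [^] k" "k \<le> ord a - 1" by auto
    then have "a [^] (k * d) = \<one>" using x a by (simp add: nat_pow_pow)
    then have "d * e dvd k * d" using pow_eq_id[OF a(1)] ord e by simp
    then obtain i where i: "k = e * i" using pos by (auto simp: mult.commute elim: dvdE)
    have "0 < d * e" using pos by simp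
    then have "k < d * e" using k(2) ord e by linarith
    then have "i < d" using i pos by (simp add: mult.commute)
    then show "x \<in> (\<lambda>i. a [^] (e * i)) ` {..<d}" using k i by auto
  next
    fix x assume "x \<in> (\<lambda>i. a [^] (e * i)) ` {..<d}"
    then obtain i where "x = a [^] (e * i)" by auto
    then show "x \<in> {x \<in> carrier G. x [^] d = \<one>}"
      using a pow_eq_id[OF a(1)] ord e by (auto simp: nat_pow_pow)
  qed
  moreover have "inj_on (\<lambda>i. a [^] (e * i)) {..<d}"
  proof (rule inj_onI)
    fix i j assume ij: "i \<in> {..<d}" "j \<in> {..<d}" "a [^] (e * i) = a [^] (e * j)"
    have "e * k \<in> {0..ord a - 1}" if "k < d" for k
    proof -
      have "e * k < d * e" using that pos by (simp add: mult.commute)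
      then have "e * k \<le> ord a - 1" using ord e by linarith
      then show ?thesis by simp
    qed
    then have "e * i = e * j" using inj_onD[OF ord_inj[OF a(1)] ij(3)] ij by simp
    then show "i = j" using pos by simp
  qed
  ultimately show ?thesis by (simp add: card_image)
qed

text \<open>By Lagrange all elements of \<open>H\<close> are roots of exponent
  \<open>card H\<close>, and a cyclic group has just that many. In this form the subgroup is visibly
  stable under every endomorphism.\<close>

lemma (in group) cyclic_subgroup_eq_roots:
  assumes "cyclic_group G" "finite (carrier G)" "subgroup H G"
  shows "H = {x \<in> carrier G. x [^] card H = \<one>}"
proof (rule card_subset_eq)
  have "card H dvd order G" using lagrange[OF assms(3)] by (metis dvd_triv_right)
  then show "card H = card {x \<in> carrier G. x [^] card H = \<one>}"
    using card_roots_cyclic[OF assms(1,2)] by simp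
  show "H \<subseteq> {x \<in> carrier G. x [^] card H = \<one>}"
  proof
    fix x assume x: "x \<in> H"
    interpret H: group "G\<lparr>carrier := H\<rparr>" by (rule subgroup_imp_group[OF assms(3)])
    have "x [^]\<^bsub>G\<lparr>carrier := H\<rparr>\<^esub> card H = \<one>"
      using H.pow_order_eq_1[of x] x by (simp add: order_def)
    then show "x \<in> {x \<in> carrier G. x [^] card H = \<one>}"
      using x subgroup.mem_carrier[OF assms(3)] by (simp add: nat_pow_consistent[symmetric])
  qed
qed (use assms in auto)

text \<open>A power of one generator goes to the same power of the other. Equality of powers depends
  on the exponent modulo the common order only, so any choice of \<open>e\<close> will do.\<close>

lemma cyclic_group_iso:
  assumes "group G" "cyclic_group G" "group H" "cyclic_group H"
    and "finite (carrier G)" "order G = order H"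
  shows "G \<cong> H"
proof -
  interpret G: group G by fact
  interpret H: group H by fact
  have finH: "finite (carrier H)"
    using assms(5,6) G.order_gt_0_iff_finite H.order_gt_0_iff_finite by simp
  obtain a where a: "a \<in> carrier G" "carrier G = generate G {a}"
    using assms(2) by (metis cyclic_group_def carrier_subgroup_generated Int_insert_right Int_empty_right)
  obtain b where b: "b \<in> carrier H" "carrier H = generate H {b}"
    using assms(4) by (metis cyclic_group_def carrier_subgroup_generated Int_insert_right Int_empty_right)
  have ord: "G.ord a = order G" "H.ord b = order G"
    using G.generate_pow_card[OF a(1)] H.generate_pow_card[OF b(1)] a b assms(6) by (simp_all add: order_def)
  define e where "e x = (SOME k::nat. x = a [^]\<^bsub>G\<^esub> k)" for x
  have e: "a [^]\<^bsub>G\<^esub> e x = x" if "x \<in> carrier G" for x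
  proof -
    have "x \<in> generate G {a}" using that a(2) by simp
    then obtain k :: nat where "x = a [^]\<^bsub>G\<^esub> k"
      by (rule G.generate_singleton_pow[OF assms(5) a(1)])
    then have "x = a [^]\<^bsub>G\<^esub> e x" unfolding e_def by (rule someI)
    then show ?thesis by simp
  qed
  have pow_eq: "a [^]\<^bsub>G\<^esub> i = a [^]\<^bsub>G\<^esub> j \<longleftrightarrow> b [^]\<^bsub>H\<^esub> i = b [^]\<^bsub>H\<^esub> j" for i j :: nat
    using G.int_pow_eq[OF a(1), of "int i" "int j"] H.int_pow_eq[OF b(1), of "int i" "int j"] ord
    by (simp add: int_pow_int)
  have "(\<lambda>x. b [^]\<^bsub>H\<^esub> e x) \<in> iso G H"
    unfolding iso_def
  proof (intro CollectI conjI)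
    show "(\<lambda>x. b [^]\<^bsub>H\<^esub> e x) \<in> hom G H"
    proof (rule homI)
      fix x y assume "x \<in> carrier G" "y \<in> carrier G"
      then have "a [^]\<^bsub>G\<^esub> e (x \<otimes>\<^bsub>G\<^esub> y) = a [^]\<^bsub>G\<^esub> (e x + e y)"
        using a(1) e by (simp add: G.nat_pow_mult[symmetric])
      then show "b [^]\<^bsub>H\<^esub> e (x \<otimes>\<^bsub>G\<^esub> y) = b [^]\<^bsub>H\<^esub> e x \<otimes>\<^bsub>H\<^esub> b [^]\<^bsub>H\<^esub> e y"
        using pow_eq b by (simp add: H.nat_pow_mult)
    qed (use b in auto)
    have inj: "inj_on (\<lambda>x. b [^]\<^bsub>H\<^esub> e x) (carrier G)"
      
    proof (rule inj_onI)
      fix x y assume "x \<in> carrier G" "y \<in> carrier G" "b [^]\<^bsub>H\<^esub> e x = b [^]\<^bsub>H\<^esub> e y"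
      then show "x = y" using e[of x] e[of y] pow_eq[of "e x" "e y"] by simp
    qed
    have "(\<lambda>x. b [^]\<^bsub>H\<^esub> e x) ` carrier G = carrier H"
      by (rule card_subset_eq[OF finH]) (use b(1) assms(6) card_image[OF inj] in \<open>auto simp: order_def\<close>)
    with inj show "bij_betw (\<lambda>x. b [^]\<^bsub>H\<^esub> e x) (carrier G) (carrier H)"
      by (simp add: bij_betw_def)
  qed
  then show ?thesis unfolding is_iso_def by blast
qed

text \<open>A transitive cyclic group of affine maps \<open>y \<mapsto> \<pi> y \<otimes> a\<close> of a noncyclic group would give two
  independent characters modulo \<open>p\<close>, on which the orbit of \<open>\<one>\<close> has period \<open>p\<close> because \<open>p\<close> divides
  \<open>p choose 2\<close>; this is impossible, since the image has \<open>p\<^sup>2\<close> elements.\<close>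

lemma (in group) affine_orbit_generates:
  assumes p: "prime p" "odd p" "order G = p ^ n"
    and \<pi>: "\<pi> \<in> hom G G" and a: "a \<in> carrier G"
    and x0: "x 0 = \<one>" and xS: "\<And>k. x (Suc k) = \<pi> (x k) \<otimes> a"
    and xp: "x (p ^ n) = \<one>" and surj: "carrier G \<subseteq> range x"
  shows "carrier G = generate G {a}"
proof (rule ccontr)
  assume "carrier G \<noteq> generate G {a}"
  then obtain \<chi> :: "'a \<Rightarrow> int" where
    \<chi>_mult: "\<And>x y. x \<in> carrier G \<Longrightarrow> y \<in> carrier G \<Longrightarrow> [\<chi> (x \<otimes> y) = \<chi> x + \<chi> y] (mod int p)"
    and \<chi>_gen: "\<And>x. x \<in> generate G {a} \<Longrightarrow> [\<chi> x = 0] (mod int p)"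
    and \<chi>_nz: "\<exists>x\<in>carrier G. \<not> [\<chi> x = 0] (mod int p)"
    using p_group_character[OF p(1,3) generate_is_subgroup[of "{a}"]] a by auto
  have xc: "x k \<in> carrier G" for k
    by (induction k) (use x0 xS a \<pi> in \<open>auto simp: hom_def\<close>)
  have \<pi>c: "\<pi> y \<in> carrier G" if "y \<in> carrier G" for y using that \<pi> by (auto simp: hom_def)
  have xper: "x (k + p ^ n) = x k" for k
    by (induction k) (use x0 xS xp in auto)
  \<comment> \<open>On characters \<open>\<delta>\<close> is precomposition with
    \<open>\<pi>\<close> minus the identity. Along the orbit \<open>f (x (Suc k)) - f (x k)\<close>
    is \<open>f a + \<delta> f (x k)\<close> modulo \<open>p\<close>, so differences in
    \<open>k\<close> turn into powers of \<open>\<delta>\<close>.\<close>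
  define \<delta> :: "('a \<Rightarrow> int) \<Rightarrow> 'a \<Rightarrow> int" where "\<delta> f y = f (\<pi> y) - f y" for f y
  define add where "add f \<longleftrightarrow> (\<forall>y\<in>carrier G. \<forall>z\<in>carrier G. [f (y \<otimes> z) = f y + f z] (mod int p))"
    for f :: "'a \<Rightarrow> int"
  define nul where "nul f \<longleftrightarrow> (\<forall>y\<in>carrier G. [f y = 0] (mod int p))" for f :: "'a \<Rightarrow> int"
  have addD: "[f (y \<otimes> z) = f y + f z] (mod int p)"
    if "add f" "y \<in> carrier G" "z \<in> carrier G" for f y z
    using that by (auto simp: add_def)
  have add_\<delta>: "add (\<delta> f)" if "add f" for f
    unfolding add_def
  proof (intro ballI)
    fix y z assume yz: "y \<in> carrier G" "z \<in> carrier G"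
    have "\<pi> (y \<otimes> z) = \<pi> y \<otimes> \<pi> z" using \<pi> yz by (auto simp: hom_def)
    then have "[\<delta> f (y \<otimes> z) = (f (\<pi> y) + f (\<pi> z)) - (f y + f z)] (mod int p)"
      unfolding \<delta>_def using addD[OF that] yz \<pi>c by (auto intro: cong_diff)
    then show "[\<delta> f (y \<otimes> z) = \<delta> f y + \<delta> f z] (mod int p)" by (simp add: \<delta>_def algebra_simps)
  qed
  have add_iter: "add ((\<delta> ^^ j) \<chi>)" for j
    by (induction j) (use \<chi>_mult add_\<delta> in \<open>auto simp: add_def\<close>)
  have add_one: "[f \<one> = 0] (mod int p)" if "add f" for f
  proof -
    have "[f \<one> + 0 = f \<one> + f \<one>] (mod int p)" using addD[OF that, of \<one> \<one>] by simp
    then show ?thesis using cong_add_lcancel cong_sym by blast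
  qed
  have step: "[f (x (Suc k)) = f (x k) + f a + \<delta> f (x k)] (mod int p)" if "add f" for f k
    using addD[OF that \<pi>c[OF xc] a, of k] by (simp add: xS \<delta>_def algebra_simps)
  have diff: "[(forward_diff 1 ^^ Suc j) (\<lambda>k. \<chi> (x k)) k
      = (\<delta> ^^ j) \<chi> a + (\<delta> ^^ Suc j) \<chi> (x k)] (mod int p)" for j k
  proof (induction j arbitrary: k)
    case 0
    show ?case using step[OF add_iter[of 0], of k] by (simp add: forward_diff_def cong_iff_dvd_diff algebra_simps)
  next
    case (Suc j)
    have "[(forward_diff 1 ^^ Suc (Suc j)) (\<lambda>k. \<chi> (x k)) k
      = ((\<delta> ^^ j) \<chi> a + (\<delta> ^^ Suc j) \<chi> (x (Suc k))) - ((\<delta> ^^ j) \<chi> a + (\<delta> ^^ Suc j) \<chi> (x k))] (mod int p)"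
      using cong_diff[OF Suc.IH[of "Suc k"] Suc.IH[of k]]
      unfolding funpow.simps(2)[of "Suc j"] o_apply
        forward_diff_def[of 1 "(forward_diff 1 ^^ Suc j) (\<lambda>k. \<chi> (x k))"] Suc_eq_plus1[of k] .
    also have "[((\<delta> ^^ j) \<chi> a + (\<delta> ^^ Suc j) \<chi> (x (Suc k))) - ((\<delta> ^^ j) \<chi> a + (\<delta> ^^ Suc j) \<chi> (x k))
        = (\<delta> ^^ Suc j) \<chi> a + (\<delta> ^^ Suc (Suc j)) \<chi> (x k)] (mod int p)"
      using step[OF add_iter[of "Suc j"], of k] by (simp add: cong_iff_dvd_diff algebra_simps)
    finally show ?case .
  qed
  \<comment> \<open>The orbit repeats after \<open>p ^ n\<close> steps, so the
    \<open>p ^ n\<close>-fold difference vanishes modulo \<open>p\<close>. At \<open>k = 0\<close>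
    this kills the constant term, and some power of \<open>\<delta>\<close> annihilates
    \<open>\<chi>\<close>.\<close>
  have "nul ((\<delta> ^^ (p ^ n)) \<chi>)"
  proof -
    obtain N where N: "p ^ n = Suc N" using p(1) by (metis not0_implies_Suc not_prime_0 power_not_zero)
    have "[(\<delta> ^^ N) \<chi> a + (\<delta> ^^ Suc N) \<chi> (x k) = 0] (mod int p)" for k
    proof -
      have "[(\<delta> ^^ N) \<chi> a + (\<delta> ^^ Suc N) \<chi> (x k)
          = (forward_diff 1 ^^ (p ^ n)) (\<lambda>k. \<chi> (x k)) k] (mod int p)"
        using diff[of N k] N by (simp add: cong_sym)
      also have "[(forward_diff 1 ^^ (p ^ n)) (\<lambda>k. \<chi> (x k)) k
          = forward_diff (p ^ n) (\<lambda>k. \<chi> (x k)) k] (mod int p)"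
        by (rule forward_diff_funpow_prime_power[OF p(1,2)])
      also have "forward_diff (p ^ n) (\<lambda>k. \<chi> (x k)) k = 0" by (simp add: forward_diff_def xper)
      finally show ?thesis .
    qed
    note c = this
    have "[(\<delta> ^^ N) \<chi> a = 0] (mod int p)"
      using cong_diff[OF c[of 0] add_one[OF add_iter[of "Suc N"]]] x0 by simp
    then have "[(\<delta> ^^ Suc N) \<chi> (x k) = 0] (mod int p)" for k
      using cong_diff[OF c[of k]] by fastforce
    then show ?thesis unfolding nul_def N using surj by blast
  qed
  \<comment> \<open>The last nonzero iterate \<open>f\<close> is a character invariant under
    \<open>\<pi>\<close>, hence linear in \<open>k\<close> along the orbit. The iterate
    \<open>h\<close> before it, if there is one, is quadratic with leading term
    \<open>k choose 2\<close>.\<close>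
  define J where "J = (LEAST j. nul ((\<delta> ^^ j) \<chi>))"
  have nulJ: "nul ((\<delta> ^^ J) \<chi>)" using \<open>nul ((\<delta> ^^ (p ^ n)) \<chi>)\<close> unfolding J_def by (rule LeastI)
  have "J \<noteq> 0"
  proof
    assume "J = 0"
    then show False using nulJ \<chi>_nz by (simp add: nul_def)
  qed
  then obtain j where j: "J = Suc j" using not0_implies_Suc by blast
  define f where "f = (\<delta> ^^ j) \<chi>"
  have f: "add f" "nul (\<delta> f)" "\<not> nul f"
    using add_iter nulJ not_less_Least[of j "\<lambda>j. nul ((\<delta> ^^ j) \<chi>)"] j
    by (auto simp: f_def J_def[symmetric])
  have fx: "[f (x k) = int k * f a] (mod int p)" for k
  proof (induction k)
    case (Suc k)
    have "[f (x k) + f a + \<delta> f (x k) = int k * f a + f a + 0] (mod int p)"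
      using Suc.IH f(2) xc by (intro cong_add cong_refl) (auto simp: nul_def)
    then have "[f (x (Suc k)) = int k * f a + f a + 0] (mod int p)" using step[OF f(1)] cong_trans by blast
    then show ?case by (simp add: algebra_simps)
  qed (use add_one f x0 in simp)
  have fa: "\<not> [f a = 0] (mod int p)"
  proof
    assume "[f a = 0] (mod int p)"
    then have "[f (x k) = 0] (mod int p)" for k
      using fx[of k] by (meson cong_0_iff cong_dvd_iff dvd_mult)
    then show False using f(3) surj unfolding nul_def by blast
  qed
  show False
  proof (cases j)
    case 0
    then show False using fa \<chi>_gen[OF generate.incl] by (simp add: f_def)
  next
    case (Suc i)
    define h where "h = (\<delta> ^^ i) \<chi>"
    have h: "add h" "\<delta> h = f" using add_iter Suc by (auto simp: h_def f_def)
    have hx: "[h (x k) = int k * h a + int (k choose 2) * f a] (mod int p)" for k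
    proof (induction k)
      case (Suc k)
      have "[h (x k) + h a + \<delta> h (x k)
          = (int k * h a + int (k choose 2) * f a) + h a + int k * f a] (mod int p)"
        using Suc.IH h(2) fx by (intro cong_add cong_refl) auto
      then have "[h (x (Suc k)) = (int k * h a + int (k choose 2) * f a) + h a + int k * f a] (mod int p)"
        using step[OF h(1)] cong_trans by blast
      moreover have "Suc k choose 2 = k + (k choose 2)" by (simp add: numeral_2_eq_2)
      ultimately show ?case by (simp add: algebra_simps)
    qed (use add_one h x0 in \<open>simp add: numeral_2_eq_2\<close>)
    have quot: "[g (x 2 \<otimes> inv (a \<otimes> a)) = g (x 2) - 2 * g a] (mod int p)" if "add g" for g
    proof -
      have "x 2 \<otimes> inv (a \<otimes> a) \<otimes> (a \<otimes> a) = x 2" using xc a by (simp add: m_assoc)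
      then have "[g (x 2) = g (x 2 \<otimes> inv (a \<otimes> a)) + g (a \<otimes> a)] (mod int p)"
        using addD[OF that, of "x 2 \<otimes> inv (a \<otimes> a)" "a \<otimes> a"] xc a by simp
      moreover have "[g (x 2 \<otimes> inv (a \<otimes> a)) + g (a \<otimes> a)
          = g (x 2 \<otimes> inv (a \<otimes> a)) + (g a + g a)] (mod int p)"
        using addD[OF that a a] by (intro cong_add cong_refl)
      ultimately have "[g (x 2) = g (x 2 \<otimes> inv (a \<otimes> a)) + (g a + g a)] (mod int p)"
        by (rule cong_trans)
      then show ?thesis by (simp add: cong_iff_dvd_diff algebra_simps dvd_diff_commute)
    qed
    \<comment> \<open>Modulo \<open>p\<close> this element has \<open>f\<close>-value 0 and
      \<open>h\<close>-value \<open>f a\<close>, which is not 0. But an orbit point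
      \<open>x k\<close> with \<open>f\<close>-value 0 has \<open>p\<close> dividing
      \<open>k\<close>, hence also \<open>k choose 2\<close>, and so \<open>h\<close>-value
      0.\<close>
    have "x 2 \<otimes> inv (a \<otimes> a) \<in> range x" by (rule subsetD[OF surj]) (simp add: xc a)
    then obtain k where k: "x 2 \<otimes> inv (a \<otimes> a) = x k" by auto
    have "[f (x k) = 0] (mod int p)"
    proof -
      have "[f (x k) = f (x 2) - 2 * f a] (mod int p)" using quot[OF f(1)] k by simp
      also have "[f (x 2) - 2 * f a = int 2 * f a - 2 * f a] (mod int p)"
        by (intro cong_diff fx cong_refl)
      finally show ?thesis by simp
    qed
    then have "int p dvd int k * f a" using fx[of k] by (meson cong_0_iff cong_dvd_iff)
    then have "p dvd k" using fa p(1) by (auto simp: cong_0_iff prime_dvd_mult_iff)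
    moreover have "even (k * (k - 1))" by (cases k) auto
    ultimately have "p dvd (k choose 2) * 2"
      by (simp add: choose_two)
    moreover have "\<not> p dvd 2"
      using p(1,2) primes_dvd_imp_eq[of p 2] by (auto simp: two_is_prime_nat)
    ultimately have "p dvd (k choose 2)" using prime_dvd_mult_iff[OF p(1)] by blast
    then have "[h (x k) = 0] (mod int p)"
      using hx[of k] \<open>p dvd k\<close> by (meson cong_0_iff cong_dvd_iff dvd_add dvd_mult2 int_dvd_int_iff)
    moreover have "[h (x k) = f a] (mod int p)"
    proof -
      have "[h (x k) = h (x 2) - 2 * h a] (mod int p)" using quot[OF h(1)] k by simp
      also have "[h (x 2) - 2 * h a = (int 2 * h a + int (2 choose 2) * f a) - 2 * h a] (mod int p)"
        by (intro cong_diff hx cong_refl)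
      finally show ?thesis by simp
    qed
    ultimately show False using fa cong_sym cong_trans by blast
  qed
qed

section \<open>Regular permutation groups normalised by translations\<close>

lemma BijGroup_carrier: "carrier (BijGroup S) = Bij S"
  by (simp add: BijGroup_def)

lemma BijGroup_one: "\<one>\<^bsub>BijGroup S\<^esub> = (\<lambda>x\<in>S. x)"
  by (simp add: BijGroup_def)

lemma BijGroup_mult: "f \<in> Bij S \<Longrightarrow> g \<in> Bij S \<Longrightarrow> f \<otimes>\<^bsub>BijGroup S\<^esub> g = compose S f g"
  by (simp add: BijGroup_def)

lemma Bij_apply_closed: "f \<in> Bij S \<Longrightarrow> x \<in> S \<Longrightarrow> f x \<in> S"
  using Bij_imp_funcset by blast

lemma (in group) left_transl_Bij:
  assumes "\<gamma> \<in> carrier G" shows "left_transl G \<gamma> \<in> Bij (carrier G)"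
proof -
  have "bij_betw (\<lambda>\<delta>. \<gamma> \<otimes> \<delta>) (carrier G) (carrier G)"
    by (rule bij_betw_byWitness[where f' = "\<lambda>\<delta>. inv \<gamma> \<otimes> \<delta>"])
      (use assms in \<open>auto simp: m_assoc[symmetric]\<close>)
  then show ?thesis by (simp add: Bij_def left_transl_def bij_betw_restrict_eq)
qed

lemma (in group) conj_transl_Bij:
  assumes "\<gamma> \<in> carrier G" "\<eta> \<in> Bij (carrier G)"
  shows "conj_transl G \<gamma> \<eta> \<in> Bij (carrier G)"
proof -
  interpret B: group "BijGroup (carrier G)" by (rule group_BijGroup)
  show ?thesis
    using assms left_transl_Bij[OF assms(1)] unfolding conj_transl_def
    by (simp flip: BijGroup_carrier)
qed

text \<open>Cancelling \<open>left_transl G \<gamma>\<close> on the right first spares a pointwise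
  description of the inverse in \<open>BijGroup\<close>.\<close>

lemma (in group) conj_transl_apply:
  assumes "\<gamma> \<in> carrier G" "\<eta> \<in> Bij (carrier G)" "\<delta> \<in> carrier G"
  shows "conj_transl G \<gamma> \<eta> (\<gamma> \<otimes> \<delta>) = \<gamma> \<otimes> \<eta> \<delta>"
proof -
  interpret B: group "BijGroup (carrier G)" by (rule group_BijGroup)
  let ?B = "BijGroup (carrier G)" and ?L = "left_transl G \<gamma>"
  have L: "?L \<in> carrier ?B" and \<eta>: "\<eta> \<in> carrier ?B"
    using left_transl_Bij[OF assms(1)] assms(2) by (simp_all add: BijGroup_carrier)
  have "conj_transl G \<gamma> \<eta> \<otimes>\<^bsub>?B\<^esub> ?L = ?L \<otimes>\<^bsub>?B\<^esub> \<eta>"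
    unfolding conj_transl_def using L \<eta> by (simp add: B.m_assoc)
  then have "compose (carrier G) (conj_transl G \<gamma> \<eta>) ?L \<delta> = compose (carrier G) ?L \<eta> \<delta>"
    using conj_transl_Bij[OF assms(1,2)] L \<eta> by (simp add: BijGroup_mult BijGroup_carrier)
  then show ?thesis
    using assms Bij_apply_closed[OF assms(2,3)] by (simp add: compose_def left_transl_def)
qed

lemma (in group) regular_normalized_Bij:
  assumes "regular_normalized G N" "\<eta> \<in> N"
  shows "\<eta> \<in> Bij (carrier G)"
proof -
  have "subgroup N (BijGroup (carrier G))" using assms(1) by (simp add: regular_normalized_def)
  from subgroup.mem_carrier[OF this assms(2)] show ?thesis by (simp add: BijGroup_carrier)
qed

lemma (in group) regular_normalized_eqI:
  assumes N: "regular_normalized G N" and "\<eta> \<in> N" "\<theta> \<in> N" "\<eta> \<one> = \<theta> \<one>"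
  shows "\<eta> = \<theta>"
proof -
  have "\<theta> \<one> \<in> carrier G"
    by (rule Bij_apply_closed[OF regular_normalized_Bij[OF N assms(3)] one_closed])
  then have "\<exists>!\<eta>'. \<eta>' \<in> N \<and> \<eta>' \<one> = \<theta> \<one>" using N by (auto simp: regular_normalized_def)
  then show ?thesis using assms by blast
qed

lemma (in group) regular_normalized_card:
  assumes "regular_normalized G N"
  shows "card N = order G"
proof -
  have "bij_betw (\<lambda>\<eta>. \<eta> \<one>) N (carrier G)"
  proof (rule bij_betwI')
    fix \<eta> \<theta> assume "\<eta> \<in> N" "\<theta> \<in> N"
    then show "(\<eta> \<one> = \<theta> \<one>) = (\<eta> = \<theta>)" using regular_normalized_eqI[OF assms] by auto
  next
    fix \<eta> assume "\<eta> \<in> N"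
    then show "\<eta> \<one> \<in> carrier G"
      by (intro Bij_apply_closed[OF regular_normalized_Bij[OF assms] one_closed])
  next
    fix \<delta> assume "\<delta> \<in> carrier G"
    then have "\<exists>!\<eta>. \<eta> \<in> N \<and> \<eta> \<one> = \<delta>" using assms by (simp add: regular_normalized_def)
    then show "\<exists>\<eta>\<in>N. \<delta> = \<eta> \<one>" by auto
  qed
  then show ?thesis by (simp add: order_def bij_betw_same_card)
qed

text \<open>Regularity carries the powers of a generator \<open>\<gamma>\<close> over to
  \<open>N\<close>: \<open>x k\<close> is the element taking \<open>\<one>\<close> to
  \<open>\<gamma> [^] k\<close>. Evaluation at \<open>\<one>\<close> shows that
  \<open>x (Suc k)\<close> is the conjugate of \<open>x k\<close> by the left translation of
  \<open>\<gamma>\<close>, multiplied by \<open>x 1\<close>. So \<open>N\<close> is a single orbit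
  of an affine map, and \<open>x 1\<close> generates it.\<close>

lemma (in group) regular_normalized_cyclic:
  assumes p: "prime p" "odd p" "order G = p ^ n" and cyc: "cyclic_group G"
    and N: "regular_normalized G N"
  shows "cyclic_group (BijGroup (carrier G)\<lparr>carrier := N\<rparr>)"
proof -
  let ?B = "BijGroup (carrier G)"
  interpret B: group ?B by (rule group_BijGroup)
  have sub: "subgroup N ?B" using N by (simp add: regular_normalized_def)
  interpret A: group "?B\<lparr>carrier := N\<rparr>" by (rule B.subgroup_imp_group[OF sub])
  have fin: "finite (carrier G)"
    using order_gt_0_iff_finite p prime_gt_0_nat[of p] by simp
  note NB = regular_normalized_Bij[OF N]
  note unique = regular_normalized_eqI[OF N]
  obtain \<gamma> where \<gamma>: "\<gamma> \<in> carrier G" "carrier G = generate G {\<gamma>}"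
    using cyc by (metis cyclic_group_def carrier_subgroup_generated Int_insert_right Int_empty_right)
  have "\<exists>!\<eta>. \<eta> \<in> N \<and> \<eta> \<one> = \<gamma> [^] k" for k :: nat
    using N nat_pow_closed[OF \<gamma>(1), of k] by (simp add: regular_normalized_def)
  then have "\<exists>\<eta>. \<eta> \<in> N \<and> \<eta> \<one> = \<gamma> [^] k" for k :: nat by blast
  then obtain x :: "nat \<Rightarrow> 'a \<Rightarrow> 'a" where x: "\<And>k. x k \<in> N" "\<And>k. x k \<one> = \<gamma> [^] k"
    by metis
  let ?\<pi> = "conj_transl G \<gamma>"
  have \<pi>N: "?\<pi> \<eta> \<in> N" if "\<eta> \<in> N" for \<eta>
    using N \<gamma>(1) that by (auto simp: regular_normalized_def)
  have "card N = p ^ n" using regular_normalized_card[OF N] p by simp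
  have "carrier (?B\<lparr>carrier := N\<rparr>) = generate (?B\<lparr>carrier := N\<rparr>) {x 1}"
  proof (rule A.affine_orbit_generates[OF p(1,2), where \<pi> = ?\<pi> and x = x and n = n])
    show "order (?B\<lparr>carrier := N\<rparr>) = p ^ n" using \<open>card N = p ^ n\<close> by (simp add: order_def)
    show "?\<pi> \<in> hom (?B\<lparr>carrier := N\<rparr>) (?B\<lparr>carrier := N\<rparr>)"
    proof (rule homI)
      fix \<eta> \<theta> assume "\<eta> \<in> carrier (?B\<lparr>carrier := N\<rparr>)" "\<theta> \<in> carrier (?B\<lparr>carrier := N\<rparr>)"
      then have "\<eta> \<in> carrier ?B" "\<theta> \<in> carrier ?B" "left_transl G \<gamma> \<in> carrier ?B"
        using NB left_transl_Bij[OF \<gamma>(1)] by (simp_all add: BijGroup_carrier)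
      then show "?\<pi> (\<eta> \<otimes>\<^bsub>?B\<lparr>carrier := N\<rparr>\<^esub> \<theta>) = ?\<pi> \<eta> \<otimes>\<^bsub>?B\<lparr>carrier := N\<rparr>\<^esub> ?\<pi> \<theta>"
        unfolding conj_transl_def by (simp add: B.m_assoc) (simp add: B.m_assoc[symmetric])
    qed (use \<pi>N in auto)
    show "x 1 \<in> carrier (?B\<lparr>carrier := N\<rparr>)" using x by simp
    have one: "\<one>\<^bsub>?B\<^esub> \<in> N" by (rule subgroup.one_closed[OF sub])
    show "x 0 = \<one>\<^bsub>?B\<lparr>carrier := N\<rparr>\<^esub>"
      using unique[OF x(1)[of 0] one] x(2)[of 0] by (simp add: BijGroup_one)
    show "x (p ^ n) = \<one>\<^bsub>?B\<lparr>carrier := N\<rparr>\<^esub>"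
      using unique[OF x(1)[of "p ^ n"] one] x(2)[of "p ^ n"] pow_order_eq_1[OF \<gamma>(1)] p(3)
      by (simp add: BijGroup_one)
    show "x (Suc k) = ?\<pi> (x k) \<otimes>\<^bsub>?B\<lparr>carrier := N\<rparr>\<^esub> x 1" for k
    proof (rule unique[OF x(1)])
      show "?\<pi> (x k) \<otimes>\<^bsub>?B\<lparr>carrier := N\<rparr>\<^esub> x 1 \<in> N"
        using subgroup.m_closed[OF sub \<pi>N[OF x(1)] x(1)] by simp
      have "(?\<pi> (x k) \<otimes>\<^bsub>?B\<lparr>carrier := N\<rparr>\<^esub> x 1) \<one> = ?\<pi> (x k) (x 1 \<one>)"
        using BijGroup_mult[OF NB[OF \<pi>N[OF x(1)[of k]]] NB[OF x(1)[of 1]]] by (simp add: compose_def)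
      also have "\<dots> = ?\<pi> (x k) (\<gamma> \<otimes> \<one>)" using x(2)[of 1] \<gamma>(1) by simp
      also have "\<dots> = \<gamma> \<otimes> \<gamma> [^] k"
        using conj_transl_apply[OF \<gamma>(1) NB[OF x(1)] one_closed] x(2) by simp
      also have "\<dots> = \<gamma> [^] Suc k" using \<gamma>(1) nat_pow_Suc2 by simp
      finally show "x (Suc k) \<one> = (?\<pi> (x k) \<otimes>\<^bsub>?B\<lparr>carrier := N\<rparr>\<^esub> x 1) \<one>" using x(2) by simp
    qed
    show "carrier (?B\<lparr>carrier := N\<rparr>) \<subseteq> range x"
    proof
      fix \<eta> assume "\<eta> \<in> carrier (?B\<lparr>carrier := N\<rparr>)"
      then have \<eta>: "\<eta> \<in> N" by simp
      have "\<eta> \<one> \<in> generate G {\<gamma>}" using Bij_apply_closed[OF NB[OF \<eta>] one_closed] \<gamma>(2) by simp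
      then obtain k :: nat where "\<eta> \<one> = \<gamma> [^] k" by (rule generate_singleton_pow[OF fin \<gamma>(1)])
      then have "\<eta> = x k" by (intro unique[OF \<eta> x(1)]) (simp add: x(2))
      then show "\<eta> \<in> range x" by simp
    qed
  qed
  then show ?thesis
    unfolding A.cyclic_group_alt
    by (intro exI[of _ "x 1"]) (simp add: subgroup_generated_def x(1))
qed

section \<open>Finite Galois extensions\<close>

locale finite_galois_extension = galois_extension sL
  for sL :: "'k::field \<Rightarrow> 'l::field \<Rightarrow> 'l" +
  assumes finite_gal: "finite (carrier (gal_group sL))"
begin

abbreviation Gal :: "('l \<Rightarrow> 'l) set" where
  "Gal \<equiv> carrier (gal_group sL)"

lemma scale_eq_mult: "sL c x = sL c 1 * x"
  using scale_mult_left[of c 1 x] by simp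

lemma gal_linear: "\<sigma> \<in> Gal \<Longrightarrow> Vector_Spaces.linear sL sL \<sigma>"
  by (simp add: gal_group_def)

lemma gal_bij: "\<sigma> \<in> Gal \<Longrightarrow> bij \<sigma>"
  by (simp add: gal_group_def)

lemma gal_one: "\<sigma> \<in> Gal \<Longrightarrow> \<sigma> 1 = 1"
  by (simp add: gal_group_def)

lemma gal_mult: "\<sigma> \<in> Gal \<Longrightarrow> \<sigma> (x * y) = \<sigma> x * \<sigma> y"
  by (simp add: gal_group_def)

lemma gal_add: "\<sigma> \<in> Gal \<Longrightarrow> \<sigma> (x + y) = \<sigma> x + \<sigma> y"
  using gal_linear[of \<sigma>] by (simp add: Vector_Spaces.linear_iff)

lemma gal_scale: "\<sigma> \<in> Gal \<Longrightarrow> \<sigma> (sL c x) = sL c (\<sigma> x)"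
  using gal_linear[of \<sigma>] by (simp add: Vector_Spaces.linear_iff)

lemma gal_scale_one: "\<sigma> \<in> Gal \<Longrightarrow> \<sigma> (sL c 1) = sL c 1"
  by (simp add: gal_scale gal_one)

lemma gal_zero: "\<sigma> \<in> Gal \<Longrightarrow> \<sigma> 0 = 0"
  using gal_scale[of \<sigma> 0 0] by simp

lemma gal_diff: "\<sigma> \<in> Gal \<Longrightarrow> \<sigma> (x - y) = \<sigma> x - \<sigma> y"
  using gal_add[of \<sigma> "x - y" y] by (simp add: algebra_simps)

lemma gal_sum: "\<sigma> \<in> Gal \<Longrightarrow> \<sigma> (sum f A) = (\<Sum>i\<in>A. \<sigma> (f i))"
  by (induction A rule: infinite_finite_induct) (simp_all add: gal_zero gal_add)

lemma gal_sum_list: "\<sigma> \<in> Gal \<Longrightarrow> \<sigma> (sum_list (map f xs)) = (\<Sum>x\<leftarrow>xs. \<sigma> (f x))"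
  by (induction xs) (simp_all add: gal_zero gal_add)

lemma gal_eq_zero_iff: "\<sigma> \<in> Gal \<Longrightarrow> \<sigma> x = 0 \<longleftrightarrow> x = 0"
  using inj_eq[OF bij_is_inj[OF gal_bij], of \<sigma> x 0] gal_zero[of \<sigma>] by simp

lemma gal_inverse:
  assumes "\<sigma> \<in> Gal" shows "\<sigma> (inverse x) = inverse (\<sigma> x)"
proof (cases "x = 0")
  case False
  then have "\<sigma> x * \<sigma> (inverse x) = 1"
    using gal_mult[OF assms, of x "inverse x"] gal_one[OF assms] by simp
  then show ?thesis using inverse_unique[of "\<sigma> x"] by simp
qed (use gal_zero[OF assms] in simp)

lemma gal_mult_eq: "\<sigma> \<otimes>\<^bsub>gal_group sL\<^esub> \<tau> = \<sigma> \<circ> \<tau>"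
  by (simp add: gal_group_def)

lemma gal_one_eq: "\<one>\<^bsub>gal_group sL\<^esub> = id"
  by (simp add: gal_group_def)

lemma id_gal: "id \<in> Gal"
  by (auto simp: gal_group_def Vector_Spaces.linear_iff vector_space_axioms)

lemma gal_comp: "\<sigma> \<in> Gal \<Longrightarrow> \<tau> \<in> Gal \<Longrightarrow> \<sigma> \<circ> \<tau> \<in> Gal"
  by (auto simp: gal_group_def Vector_Spaces.linear_iff bij_comp)

lemma gal_inv:
  assumes "\<sigma> \<in> Gal" shows "inv_into UNIV \<sigma> \<in> Gal"
proof -
  let ?\<tau> = "inv_into UNIV \<sigma>"
  have s: "\<sigma> (?\<tau> x) = x" for x using gal_bij[OF assms] by (simp add: bij_is_surj surj_f_inv_f)
  have eqI: "?\<tau> x = y" if "\<sigma> y = x" for x y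
    using gal_bij[OF assms] that by (metis bij_inv_eq_iff)
  have "?\<tau> (x + y) = ?\<tau> x + ?\<tau> y" "?\<tau> (sL c x) = sL c (?\<tau> x)" "?\<tau> (x * y) = ?\<tau> x * ?\<tau> y"
    "?\<tau> 1 = 1" for x y c
    by (rule eqI; simp add: assms gal_add gal_scale gal_mult gal_one s)+
  then show ?thesis
    using gal_bij[OF assms] by (simp add: gal_group_def Vector_Spaces.linear_iff vector_space_axioms bij_imp_bij_inv)
qed

lemma gal_inv_apply: "\<sigma> \<in> Gal \<Longrightarrow> \<sigma> \<circ> inv_into UNIV \<sigma> = id"
  "\<sigma> \<in> Gal \<Longrightarrow> inv_into UNIV \<sigma> \<circ> \<sigma> = id"
  using gal_bij by (auto simp: fun_eq_iff bij_is_surj surj_f_inv_f bij_is_inj)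

lemma group_gal: "group (gal_group sL)"
proof (rule groupI)
  fix \<sigma> assume "\<sigma> \<in> Gal"
  then show "\<exists>\<tau>\<in>Gal. \<tau> \<otimes>\<^bsub>gal_group sL\<^esub> \<sigma> = \<one>\<^bsub>gal_group sL\<^esub>"
    using gal_inv gal_inv_apply by (metis gal_mult_eq gal_one_eq)
qed (auto simp: gal_mult_eq gal_one_eq id_gal gal_comp)

text \<open>On \<open>L \<otimes> L\<close> the elements \<open>\<gamma> v \<otimes> 1 - 1 \<otimes> v\<close> vanish under \<open>u \<otimes> w \<mapsto> u * \<gamma> w\<close>; a product of
  such elements, normalised, separates the identity from all other automorphisms.\<close>

lemma separating_tensor:
  assumes "finite D" "D \<subseteq> Gal" and E: "1 \<in> E" "\<And>v w. v \<in> E \<Longrightarrow> w \<in> E \<Longrightarrow> v * w \<in> E"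
    and "\<And>\<gamma>. \<gamma> \<in> D \<Longrightarrow> \<exists>v\<in>E. \<gamma> v \<noteq> v"
  shows "\<exists>xs. set xs \<subseteq> UNIV \<times> E \<and> (\<Sum>(u, v)\<leftarrow>xs. u * v) = 1 \<and>
    (\<forall>\<gamma>\<in>D. (\<Sum>(u, v)\<leftarrow>xs. u * \<gamma> v) = 0)"
  using assms(1,2,5)
proof (induction D)
  case empty
  have "set [(1, 1)] \<subseteq> UNIV \<times> E" using E by simp
  then show ?case by (intro exI[of _ "[(1, 1)]"]) simp
next
  case (insert \<gamma> D)
  then obtain xs where xs: "set xs \<subseteq> UNIV \<times> E" "(\<Sum>(u, v)\<leftarrow>xs. u * v) = 1"
    "\<forall>\<delta>\<in>D. (\<Sum>(u, v)\<leftarrow>xs. u * \<delta> v) = 0" by auto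
  obtain v where v: "v \<in> E" "\<gamma> v \<noteq> v" using insert.prems by auto
  define c where "c = inverse (\<gamma> v - v)"
  have c: "(\<gamma> v - v) * c = 1" using v(2) by (simp add: c_def)
  \<comment> \<open>This is \<open>xs\<close> times
    \<open>(\<gamma> v \<otimes> 1 - 1 \<otimes> v) * (c \<otimes> 1)\<close>. The new factor
    evaluates to 1 at the identity and to 0 at \<open>\<gamma>\<close>, and zeros already obtained
    persist.\<close>
  define ys where "ys = concat (map (\<lambda>(u, w). [(u * \<gamma> v * c, w), (- (u * c), w * v)]) xs)"
  have eval: "(\<Sum>(u, w)\<leftarrow>ys. u * f w) = (\<Sum>(u, w)\<leftarrow>xs. u * f w) * ((\<gamma> v - f v) * c)"
    if "\<And>w. f (w * v) = f w * f v" for f :: "'l \<Rightarrow> 'l"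
    unfolding ys_def
    by (induction xs) (use that in \<open>auto simp: algebra_simps split: prod.splits\<close>)
  have "set ys \<subseteq> UNIV \<times> E" using xs(1) v(1) E unfolding ys_def by fastforce
  moreover have "(\<Sum>(u, w)\<leftarrow>ys. u * w) = 1" using eval[of "\<lambda>w. w"] xs(2) c by simp
  moreover have "(\<Sum>(u, w)\<leftarrow>ys. u * \<delta> w) = 0" if "\<delta> \<in> insert \<gamma> D" for \<delta>
  proof -
    have "\<delta> \<in> Gal" using that insert.prems by auto
    then have "(\<Sum>(u, w)\<leftarrow>ys. u * \<delta> w) = (\<Sum>(u, w)\<leftarrow>xs. u * \<delta> w) * ((\<gamma> v - \<delta> v) * c)"
      by (intro eval gal_mult)
    then show ?thesis using that xs(3) by auto
  qed
  ultimately show ?case by blast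
qed

text \<open>Under \<open>u \<otimes> v \<mapsto> (\<lambda>\<gamma>. u * \<gamma> v)\<close>
  elements of \<open>L \<otimes> L\<close> become functions on \<open>Gal\<close>, and this tensor
  is the idempotent of \<open>\<delta>\<close>. For the identity it is a separating tensor; applying
  \<open>\<delta>\<close> to the first factors moves it.\<close>

lemma galois_coordinates:
  assumes "\<delta> \<in> Gal"
  obtains xs where "\<And>\<gamma>. \<gamma> \<in> Gal \<Longrightarrow> (\<Sum>(u, v)\<leftarrow>xs. u * \<gamma> v) = (if \<gamma> = \<delta> then 1 else 0)"
proof -
  have "\<exists>v\<in>UNIV. \<gamma> v \<noteq> v" if "\<gamma> \<in> Gal - {id}" for \<gamma> using that by (auto simp: fun_eq_iff)
  then have "\<exists>xs. set xs \<subseteq> UNIV \<times> UNIV \<and> (\<Sum>(u, v)\<leftarrow>xs. u * v) = 1 \<and>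
    (\<forall>\<gamma>\<in>Gal - {id}. (\<Sum>(u, v)\<leftarrow>xs. u * \<gamma> v) = 0)"
    by (intro separating_tensor) (use finite_gal in auto)
  then obtain xs where xs: "(\<Sum>(u, v)\<leftarrow>xs. u * v) = 1" "\<And>\<gamma>. \<gamma> \<in> Gal - {id} \<Longrightarrow> (\<Sum>(u, v)\<leftarrow>xs. u * \<gamma> v) = 0"
    by blast
  let ?ys = "map (\<lambda>(u, v). (\<delta> u, v)) xs"
  have "(\<Sum>(u, v)\<leftarrow>?ys. u * \<gamma> v) = (if \<gamma> = \<delta> then 1 else 0)" if \<gamma>: "\<gamma> \<in> Gal" for \<gamma>
  proof -
    define \<tau> where "\<tau> = inv_into UNIV \<delta> \<circ> \<gamma>"
    have \<tau>: "\<tau> \<in> Gal" unfolding \<tau>_def by (intro gal_comp gal_inv assms \<gamma>)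
    have d: "\<gamma> v = \<delta> (\<tau> v)" for v
      using gal_inv_apply(1)[OF assms] by (simp add: fun_eq_iff \<tau>_def)
    have "(\<Sum>(u, v)\<leftarrow>?ys. u * \<gamma> v) = \<delta> (\<Sum>(u, v)\<leftarrow>xs. u * \<tau> v)"
      unfolding gal_sum_list[OF assms] by (simp add: o_def case_prod_unfold gal_mult[OF assms] d)
    also have "\<dots> = (if \<tau> = id then 1 else 0)"
      using xs \<tau> assms gal_one gal_zero by (cases "\<tau> = id") auto
    also have "\<tau> = id \<longleftrightarrow> \<gamma> = \<delta>"
    proof
      assume "\<tau> = id"
      then show "\<gamma> = \<delta>" using d by (auto simp: fun_eq_iff)
    qed (use gal_inv_apply(2)[OF assms] \<tau>_def in simp)
    finally show ?thesis .
  qed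
  then show ?thesis by (rule that)
qed

text \<open>Dedekind independence: weight the relation at \<open>v\<close> with \<open>u\<close> and
  sum over a tensor that isolates \<open>\<delta>\<close>.\<close>

lemma gal_independent:
  assumes "\<And>x. (\<Sum>\<gamma>\<in>Gal. c \<gamma> * \<gamma> x) = 0" "\<delta> \<in> Gal"
  shows "c \<delta> = 0"
proof -
  obtain xs where xs: "\<And>\<gamma>. \<gamma> \<in> Gal \<Longrightarrow> (\<Sum>(u, v)\<leftarrow>xs. u * \<gamma> v) = (if \<gamma> = \<delta> then 1 else 0)"
    using galois_coordinates[OF assms(2)] by blast
  have "c \<delta> = (\<Sum>\<gamma>\<in>Gal. c \<gamma> * (if \<gamma> = \<delta> then 1 else 0))"
    using assms(2) finite_gal by (simp add: if_distrib cong: if_cong)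
  also have "\<dots> = (\<Sum>\<gamma>\<in>Gal. c \<gamma> * (\<Sum>(u, v)\<leftarrow>xs. u * \<gamma> v))"
    by (intro sum.cong refl) (simp only: xs)
  also have "\<dots> = (\<Sum>(u, v)\<leftarrow>xs. u * (\<Sum>\<gamma>\<in>Gal. c \<gamma> * \<gamma> v))"
    by (induction xs) (auto simp: sum.distrib distrib_left sum_distrib_left mult.left_commute)
  also have "\<dots> = 0" unfolding assms(1) by (induction xs) auto
  finally show ?thesis .
qed

lemma gal_independent2:
  assumes "\<And>x y. (\<Sum>\<gamma>\<in>Gal. \<Sum>\<delta>\<in>Gal. c \<gamma> \<delta> * (\<gamma> x * \<delta> y)) = 0" "\<gamma> \<in> Gal" "\<delta> \<in> Gal"
  shows "c \<gamma> \<delta> = 0"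
proof -
  have "(\<Sum>\<delta>\<in>Gal. c \<gamma> \<delta> * \<delta> y) = 0" for y
  proof (rule gal_independent[OF _ assms(2), of "\<lambda>\<gamma>. \<Sum>\<delta>\<in>Gal. c \<gamma> \<delta> * \<delta> y"])
    show "(\<Sum>\<gamma>\<in>Gal. (\<Sum>\<delta>\<in>Gal. c \<gamma> \<delta> * \<delta> y) * \<gamma> x) = 0" for x
      using assms(1)[of x y] by (simp add: sum_distrib_right sum_distrib_left mult_ac)
  qed
  then show ?thesis using gal_independent[OF _ assms(3), of "c \<gamma>"] by blast
qed

section \<open>Traces and the expansion of linear maps in automorphisms\<close>

lemma trace_in_base: "\<exists>k. (\<Sum>\<gamma>\<in>Gal. \<gamma> x) = sL k 1"
proof -
  interpret group "gal_group sL" by (rule group_gal)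
  have "\<sigma> (\<Sum>\<gamma>\<in>Gal. \<gamma> x) = (\<Sum>\<gamma>\<in>Gal. \<gamma> x)" if \<sigma>: "\<sigma> \<in> Gal" for \<sigma>
  proof -
    have "\<sigma> (\<Sum>\<gamma>\<in>Gal. \<gamma> x) = (\<Sum>\<gamma>\<in>Gal. (\<sigma> \<circ> \<gamma>) x)" by (simp add: gal_sum[OF \<sigma>])
    also have "\<dots> = (\<Sum>\<gamma>\<in>Gal. \<gamma> x)"
      by (rule sum.reindex_bij_witness[of _ "\<lambda>\<gamma>. inv_into UNIV \<sigma> \<circ> \<gamma>" "\<lambda>\<gamma>. \<sigma> \<circ> \<gamma>"])
        (use gal_inv_apply[OF \<sigma>] gal_comp gal_inv \<sigma> in \<open>auto simp: o_assoc\<close>)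
    finally show ?thesis .
  qed
  then show ?thesis using fixed_field by blast
qed

definition tr :: "'l \<Rightarrow> 'k" where
  "tr x = (SOME k. (\<Sum>\<gamma>\<in>Gal. \<gamma> x) = sL k 1)"

lemma tr: "sL (tr x) 1 = (\<Sum>\<gamma>\<in>Gal. \<gamma> x)"
  unfolding tr_def using someI_ex[OF trace_in_base] by simp

text \<open>Independence makes the trace nonzero, and K-linearity normalises it. Then
  \<open>x \<mapsto> tr (u * x)\<close> is a K-linear retraction of \<open>L\<close> onto
  \<open>K\<close>, used below to descend from \<open>L\<close> to \<open>K\<close>.\<close>

lemma trace_one_exists: obtains u where "(\<Sum>\<gamma>\<in>Gal. \<gamma> u) = 1"
proof -
  obtain x where x: "(\<Sum>\<gamma>\<in>Gal. \<gamma> x) \<noteq> 0"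
    using gal_independent[of "\<lambda>_. 1" id] id_gal by auto
  have "(\<Sum>\<gamma>\<in>Gal. \<gamma> (sL (inverse (tr x)) x)) = sL (inverse (tr x)) (sL (tr x) 1)"
    unfolding tr by (simp add: gal_scale scale_sum_right)
  also have "\<dots> = 1"
  proof -
    have "tr x \<noteq> 0" using x tr[of x] by auto
    then show ?thesis by simp
  qed
  finally show ?thesis by (rule that)
qed

text \<open>The tensor isolating the identity acts as a dual basis for the trace form:
  \<open>x\<close> is the sum of the \<open>u\<close> with weights \<open>tr (v * x)\<close>.
  Applying \<open>f\<close> and writing the traces out as sums over \<open>Gal\<close> exhibits the
  coefficients.\<close>

lemma linear_expansion:
  assumes "Vector_Spaces.linear sL sL f"
  obtains c where "\<And>x. f x = (\<Sum>\<gamma>\<in>Gal. c \<gamma> * \<gamma> x)"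
proof -
  interpret f: Vector_Spaces.linear sL sL f by fact
  obtain xs where xs: "\<And>\<gamma>. \<gamma> \<in> Gal \<Longrightarrow> (\<Sum>(u, v)\<leftarrow>xs. u * \<gamma> v) = (if \<gamma> = id then 1 else 0)"
    using galois_coordinates[OF id_gal] by blast
  define c where "c \<gamma> = (\<Sum>(u, v)\<leftarrow>xs. f u * \<gamma> v)" for \<gamma>
  have "f x = (\<Sum>\<gamma>\<in>Gal. c \<gamma> * \<gamma> x)" for x
  proof -
    have swap: "(\<Sum>\<gamma>\<in>Gal. (\<Sum>(u, v)\<leftarrow>xs. g u * \<gamma> v) * \<gamma> x) = (\<Sum>(u, v)\<leftarrow>xs. sL (tr (v * x)) (g u))" for g
    proof (induction xs)
      case (Cons a xs)
      have "sL (tr (snd a * x)) (g (fst a)) = (\<Sum>\<gamma>\<in>Gal. g (fst a) * \<gamma> (snd a) * \<gamma> x)"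
        by (subst scale_eq_mult) (simp add: tr gal_mult sum_distrib_left sum_distrib_right mult_ac)
      then show ?case using Cons
        by (simp add: case_prod_unfold distrib_right sum.distrib)
    qed simp
    have "x = (\<Sum>\<gamma>\<in>Gal. (if \<gamma> = id then 1 else 0) * \<gamma> x)"
      using finite_gal id_gal by (simp add: if_distrib[of "\<lambda>z. z * _"] cong: if_cong)
    also have "\<dots> = (\<Sum>\<gamma>\<in>Gal. (\<Sum>(u, v)\<leftarrow>xs. u * \<gamma> v) * \<gamma> x)"
      by (intro sum.cong refl) (simp only: xs)
    also have "\<dots> = (\<Sum>(u, v)\<leftarrow>xs. sL (tr (v * x)) u)" by (rule swap)
    finally have "f x = f (\<Sum>(u, v)\<leftarrow>xs. sL (tr (v * x)) u)" by simp
    also have "\<dots> = (\<Sum>(u, v)\<leftarrow>xs. sL (tr (v * x)) (f u))"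
      by (induction xs) (auto simp: f.add f.scale)
    also have "\<dots> = (\<Sum>\<gamma>\<in>Gal. c \<gamma> * \<gamma> x)" unfolding c_def by (rule swap[symmetric])
    finally show ?thesis .
  qed
  then show ?thesis by (rule that)
qed

section \<open>Fixed fields and stabilisers\<close>

lemma intermediate_fixed:
  assumes "I \<subseteq> Gal"
  shows "intermediate_field sL {x. \<forall>\<gamma>\<in>I. \<gamma> x = x}"
  using assms by (auto simp: intermediate_field_def subset_iff gal_scale_one gal_diff gal_mult gal_inverse)

text \<open>An automorphism \<open>\<gamma>\<close> fixing the field of \<open>I\<close>-invariants
  fixes all sums over \<open>I\<close>, so summing over \<open>I\<close> and over the coset of
  \<open>\<gamma>\<close> gives the same map. The difference \<open>c\<close> of the two indicator
  functions is then zero by Dedekind independence.\<close>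

lemma fixes_fixed_imp_mem:
  assumes I: "subgroup I (gal_group sL)" and "\<gamma> \<in> Gal"
    and fixing: "\<And>x. (\<And>\<delta>. \<delta> \<in> I \<Longrightarrow> \<delta> x = x) \<Longrightarrow> \<gamma> x = x"
  shows "\<gamma> \<in> I"
proof (rule ccontr)
  assume "\<gamma> \<notin> I"
  interpret I: subgroup I "gal_group sL" by fact
  have IG: "I \<subseteq> Gal" by (rule I.subset)
  have finI: "finite I" using finite_subset[OF IG finite_gal] .
  have inv: "inv_into UNIV \<sigma> \<in> I" if "\<sigma> \<in> I" for \<sigma>
  proof -
    interpret group "gal_group sL" by (rule group_gal)
    have "inv\<^bsub>gal_group sL\<^esub> \<sigma> = inv_into UNIV \<sigma>"
      by (rule inv_equality) (use that IG gal_inv gal_inv_apply in \<open>auto simp: gal_mult_eq gal_one_eq\<close>)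
    then show ?thesis using I.m_inv_closed[OF that] by simp
  qed
  have mul: "\<sigma> \<circ> \<tau> \<in> I" if "\<sigma> \<in> I" "\<tau> \<in> I" for \<sigma> \<tau>
    using I.m_closed[OF that] by (simp add: gal_mult_eq)
  have tr: "\<delta> (\<Sum>\<iota>\<in>I. \<iota> x) = (\<Sum>\<iota>\<in>I. \<iota> x)" if "\<delta> \<in> I" for \<delta> x
  proof -
    have \<delta>: "\<delta> \<in> Gal" using that IG by auto
    have "\<delta> (\<Sum>\<iota>\<in>I. \<iota> x) = (\<Sum>\<iota>\<in>I. (\<delta> \<circ> \<iota>) x)" by (simp add: gal_sum[OF \<delta>])
    also have "\<dots> = (\<Sum>\<iota>\<in>I. \<iota> x)"
      by (rule sum.reindex_bij_witness[of _ "\<lambda>\<gamma>. inv_into UNIV \<delta> \<circ> \<gamma>" "\<lambda>\<gamma>. \<delta> \<circ> \<gamma>"])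
        (use gal_inv_apply[OF \<delta>] mul inv that in \<open>auto simp: o_assoc\<close>)
    finally show ?thesis .
  qed
  define c where "c \<sigma> = (if \<sigma> \<in> I then 1 else 0) - (if \<sigma> \<in> (\<circ>) \<gamma> ` I then 1 else (0::'l))" for \<sigma>
  have "(\<Sum>\<sigma>\<in>Gal. c \<sigma> * \<sigma> x) = 0" for x
  proof -
    have img: "(\<circ>) \<gamma> ` I \<subseteq> Gal" using gal_comp assms(2) IG by auto
    have inj: "inj_on ((\<circ>) \<gamma>) I"
      using bij_is_inj[OF gal_bij[OF assms(2)]] by (auto simp: inj_on_def fun_eq_iff)
    have "(\<Sum>\<sigma>\<in>Gal. c \<sigma> * \<sigma> x) = (\<Sum>\<sigma>\<in>Gal. if \<sigma> \<in> I then \<sigma> x else 0) - (\<Sum>\<sigma>\<in>Gal. if \<sigma> \<in> (\<circ>) \<gamma> ` I then \<sigma> x else 0)"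
      unfolding sum_subtractf[symmetric] c_def by (intro sum.cong) auto
    also have "\<dots> = (\<Sum>\<sigma>\<in>I. \<sigma> x) - (\<Sum>\<sigma>\<in>(\<circ>) \<gamma> ` I. \<sigma> x)"
      using finite_gal IG img by (simp add: sum.inter_restrict[symmetric] Int_absorb1)
    also have "(\<Sum>\<sigma>\<in>(\<circ>) \<gamma> ` I. \<sigma> x) = \<gamma> (\<Sum>\<sigma>\<in>I. \<sigma> x)"
      by (simp add: sum.reindex[OF inj] gal_sum[OF assms(2)])
    also have "\<dots> = (\<Sum>\<sigma>\<in>I. \<sigma> x)" by (rule fixing) (rule tr)
    finally show ?thesis by simp
  qed
  then have "c \<gamma> = 0" using gal_independent assms(2) by blast
  moreover have "id \<in> I" using I.one_closed by (simp add: gal_one_eq)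
  then have "\<gamma> \<in> (\<circ>) \<gamma> ` I" by (intro image_eqI[of _ _ id]) auto
  ultimately show False using \<open>\<gamma> \<notin> I\<close> by (simp add: c_def)
qed

text \<open>Take a tensor with second factors in \<open>E\<close> that separates the identity from
  the automorphisms moving \<open>E\<close>. The sum of the \<open>v\<close> with weights
  \<open>tr (u * y)\<close> lies in \<open>E\<close> and equals the trace of \<open>y\<close> over
  the pointwise stabiliser of \<open>E\<close>. This trace is linear over elements fixed by the
  stabiliser, so each of these is a quotient of two of its values.\<close>

lemma intermediate_field_eq_fixed:
  assumes "intermediate_field sL E"
  shows "E = {x. \<forall>\<gamma>\<in>Gal. (\<forall>y\<in>E. \<gamma> y = y) \<longrightarrow> \<gamma> x = x}" (is "_ = ?F")
proof (rule subset_antisym)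
  show "?F \<subseteq> E"
  proof
    fix x assume x: "x \<in> ?F"
    have base: "sL k 1 \<in> E" for k using assms by (auto simp: intermediate_field_def)
    have diff: "y - z \<in> E" and mult: "y * z \<in> E" if "y \<in> E" "z \<in> E" for y z
      using assms that by (auto simp: intermediate_field_def)
    have zero: "0 \<in> E" and one: "1 \<in> E" using base[of 0] base[of 1] by auto
    have add: "y + z \<in> E" if "y \<in> E" "z \<in> E" for y z
      using diff[OF that(1) diff[OF zero that(2)]] by simp
    let ?D = "{\<gamma> \<in> Gal. \<exists>y\<in>E. \<gamma> y \<noteq> y}"
    have "\<exists>xs. set xs \<subseteq> UNIV \<times> E \<and> (\<Sum>(u, v)\<leftarrow>xs. u * v) = 1 \<and>
      (\<forall>\<gamma>\<in>?D. (\<Sum>(u, v)\<leftarrow>xs. u * \<gamma> v) = 0)"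
      by (rule separating_tensor) (use finite_gal one mult in auto)
    then obtain xs where xs: "set xs \<subseteq> UNIV \<times> E" "(\<Sum>(u, v)\<leftarrow>xs. u * v) = 1"
      "\<And>\<gamma>. \<gamma> \<in> ?D \<Longrightarrow> (\<Sum>(u, v)\<leftarrow>xs. u * \<gamma> v) = 0" by blast
    have mem: "(\<Sum>(u, v)\<leftarrow>xs. sL (tr (u * y)) v) \<in> E" for y
      using xs(1)
    proof (induction xs)
      case (Cons a xs)
      then show ?case
        using add[OF mult[OF base[of "tr (fst a * y)"], of "snd a"]]
        by (auto simp: case_prod_unfold scale_eq_mult[of _ "snd a"])
    qed (simp add: zero)
    let ?H = "{\<gamma> \<in> Gal. \<forall>y\<in>E. \<gamma> y = y}"
    have eq: "(\<Sum>(u, v)\<leftarrow>xs. sL (tr (u * y)) v) = (\<Sum>\<gamma>\<in>?H. \<gamma> y)" for y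
    proof -
      have "(\<Sum>(u, v)\<leftarrow>xs. sL (tr (u * y)) v) = (\<Sum>\<gamma>\<in>Gal. \<gamma> (\<Sum>(u, v)\<leftarrow>xs. u * inv_into UNIV \<gamma> v) * \<gamma> y)"
      proof (induction xs)
        case (Cons a xs)
        have "sL (tr (fst a * y)) (snd a) = (\<Sum>\<gamma>\<in>Gal. \<gamma> (fst a * inv_into UNIV \<gamma> (snd a)) * \<gamma> y)"
        proof -
          have "snd a * \<gamma> (fst a * y) = \<gamma> (fst a * inv_into UNIV \<gamma> (snd a)) * \<gamma> y" if "\<gamma> \<in> Gal" for \<gamma>
            using gal_inv_apply(1)[OF that] by (simp add: fun_eq_iff gal_mult[OF that])
          then show ?thesis
            by (subst scale_eq_mult) (simp add: tr sum_distrib_right mult.commute[of _ "snd a"] sum_distrib_left)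
        qed
        then show ?case using Cons
          by (simp add: case_prod_unfold distrib_right sum.distrib gal_add)
      qed (simp add: gal_zero)
      also have "\<dots> = (\<Sum>\<gamma>\<in>Gal. if \<gamma> \<in> ?H then \<gamma> y else 0)"
      proof (rule sum.cong[OF refl])
        fix \<gamma> assume \<gamma>: "\<gamma> \<in> Gal"
        \<comment> \<open>The tensor is evaluated at the inverse, which fixes the same elements as
          \<open>\<gamma>\<close>.\<close>
        let ?i = "inv_into UNIV \<gamma>"
        have fixeq: "?i z = z \<longleftrightarrow> \<gamma> z = z" for z
          using gal_bij[OF \<gamma>] by (metis bij_inv_eq_iff)
        show "\<gamma> (\<Sum>(u, v)\<leftarrow>xs. u * ?i v) * \<gamma> y = (if \<gamma> \<in> ?H then \<gamma> y else 0)"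
        proof (cases "\<gamma> \<in> ?H")
          case True
          then have "(\<Sum>(u, v)\<leftarrow>xs. u * ?i v) = (\<Sum>(u, v)\<leftarrow>xs. u * v)"
            using xs(1) fixeq by (intro arg_cong[where f = sum_list] map_cong) auto
          then show ?thesis using True xs(2) \<gamma> by (simp add: gal_one)
        next
          case False
          then have "?i \<in> ?D" using \<gamma> gal_inv fixeq by auto
          then have "(\<Sum>(u, v)\<leftarrow>xs. u * ?i v) = 0" by (rule xs(3))
          then show ?thesis using False by (simp only: gal_zero[OF \<gamma>] mult_zero_left if_False)
        qed
      qed
      also have "\<dots> = (\<Sum>\<gamma>\<in>?H. \<gamma> y)"
        by (subst sum.inter_restrict[symmetric]) (auto simp: finite_gal Int_def intro!: sum.cong)
      finally show ?thesis .
    qed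
    have "\<exists>y. (\<Sum>\<gamma>\<in>?H. \<gamma> y) \<noteq> 0"
    proof (rule ccontr)
      assume "\<not> (\<exists>y. (\<Sum>\<gamma>\<in>?H. \<gamma> y) \<noteq> 0)"
      then have "(\<Sum>\<gamma>\<in>Gal. (if \<gamma> \<in> ?H then 1 else 0) * \<gamma> y) = 0" for y
        using finite_gal by (simp add: if_distrib[of "\<lambda>z. z * _"] sum.inter_filter cong: if_cong)
      from gal_independent[OF this id_gal] show False using id_gal by simp
    qed
    then obtain y where y: "(\<Sum>\<gamma>\<in>?H. \<gamma> y) \<noteq> 0" by blast
    let ?t = "\<Sum>\<gamma>\<in>?H. \<gamma> y"
    have t: "?t \<in> E" using mem[of y] eq[of y] by simp
    have "(\<Sum>\<gamma>\<in>?H. \<gamma> (x * y)) = x * ?t"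
      unfolding sum_distrib_left by (rule sum.cong) (use x in \<open>auto simp: gal_mult\<close>)
    then have xt: "x * ?t \<in> E" using mem[of "x * y"] eq[of "x * y"] by simp
    have it: "inverse ?t \<in> E" using t assms by (simp add: intermediate_field_def)
    have "x * ?t * inverse ?t \<in> E" by (rule mult[OF xt it])
    also have "x * ?t * inverse ?t = x" using right_inverse[OF y] by (simp only: mult.assoc mult_1_right)
    finally show "x \<in> E" .
  qed
qed auto

end

section \<open>Tensor products\<close>

context vector_space
begin

lemma lin_ext_superset:
  assumes "finite A" "Poly_Mapping.keys x \<subseteq> A"
  shows "lin_ext scale f x = (\<Sum>i\<in>A. scale (Poly_Mapping.lookup x i) (f i))"
  unfolding lin_ext_def
  by (rule sum.mono_neutral_left) (use assms in \<open>auto simp: in_keys_iff\<close>)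

lemma lin_ext_add: "lin_ext scale f (x + y) = lin_ext scale f x + lin_ext scale f y"
proof -
  let ?A = "Poly_Mapping.keys x \<union> Poly_Mapping.keys y"
  have "Poly_Mapping.keys (x + y) \<subseteq> ?A" by (rule keys_add)
  then show ?thesis
    using lin_ext_superset[of ?A "x + y" f] lin_ext_superset[of ?A x f] lin_ext_superset[of ?A y f]
    by (simp add: lookup_add scale_left_distrib sum.distrib)
qed

lemma lin_ext_scale: "lin_ext scale f (free_scale c x) = scale c (lin_ext scale f x)"
proof -
  have "Poly_Mapping.keys (free_scale c x) \<subseteq> Poly_Mapping.keys x"
    by (auto simp: in_keys_iff lookup_free_scale)
  then show ?thesis
    using lin_ext_superset[of "Poly_Mapping.keys x" "free_scale c x" f]
    by (simp add: lin_ext_def lookup_free_scale scale_sum_right)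
qed

lemma linear_lin_ext: "Vector_Spaces.linear free_scale scale (lin_ext scale f)"
  by (simp add: Vector_Spaces.linear_iff vector_space_free_scale vector_space_axioms lin_ext_add lin_ext_scale)

lemma lin_ext_single: "lin_ext scale f (Poly_Mapping.single i c) = scale c (f i)"
  using lin_ext_superset[of "{i}" "Poly_Mapping.single i c" f] by simp

lemma lin_ext_zero: "lin_ext scale f 0 = 0"
  by (simp add: lin_ext_def)

lemma lin_ext_diff: "lin_ext scale f (x - y) = lin_ext scale f x - lin_ext scale f y"
  using lin_ext_add[of f "x - y" y] by (simp add: algebra_simps)

lemma lin_ext_sum: "lin_ext scale f (sum g A) = (\<Sum>i\<in>A. lin_ext scale f (g i))"
  by (induction A rule: infinite_finite_induct) (simp_all add: lin_ext_zero lin_ext_add)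

lemma lin_ext_sum_fun: "lin_ext scale (\<lambda>i. \<Sum>j\<in>A. f j i) x = (\<Sum>j\<in>A. lin_ext scale (f j) x)"
  by (simp add: lin_ext_def scale_sum_right) (rule sum.swap)

text \<open>The universal property in working form: a bilinear \<open>B\<close> kills the spanning
  relations, so its value on a formal combination depends on the tensor class alone.\<close>

lemma lin_ext_tensor_null:
  fixes B :: "'c::ab_group_add \<Rightarrow> 'd::ab_group_add \<Rightarrow> 'b"
    and sA :: "'a \<Rightarrow> 'c \<Rightarrow> 'c" and sB :: "'a \<Rightarrow> 'd \<Rightarrow> 'd"
  assumes "\<And>a a' b. B (a + a') b = B a b + B a' b" "\<And>a b b'. B a (b + b') = B a b + B a b'"
    and "\<And>c a b. B (sA c a) b = scale c (B a b)" "\<And>c a b. B a (sB c b) = scale c (B a b)"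
    and "x \<in> tensor_null sA sB"
  shows "lin_ext scale (\<lambda>(a, b). B a b) x = 0"
proof -
  interpret F: vector_space "free_scale :: 'a \<Rightarrow> ('c \<times> 'd \<Rightarrow>\<^sub>0 'a) \<Rightarrow> _" by (rule vector_space_free_scale)
  have "F.subspace {x. lin_ext scale (\<lambda>(a, b). B a b) x = 0}"
    by (rule F.subspaceI) (auto simp: lin_ext_zero lin_ext_add lin_ext_scale)
  with assms(5)[unfolded tensor_null_def] show ?thesis
    by (rule F.span_induct)
      (auto simp: lin_ext_diff lin_ext_scale lin_ext_single assms(1-4))
qed

lemma lin_ext_tensor_eq:
  fixes B :: "'c::ab_group_add \<Rightarrow> 'd::ab_group_add \<Rightarrow> 'b"
    and sA :: "'a \<Rightarrow> 'c \<Rightarrow> 'c" and sB :: "'a \<Rightarrow> 'd \<Rightarrow> 'd"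
  assumes "\<And>a a' b. B (a + a') b = B a b + B a' b" "\<And>a b b'. B a (b + b') = B a b + B a b'"
    and "\<And>c a b. B (sA c a) b = scale c (B a b)" "\<And>c a b. B a (sB c b) = scale c (B a b)"
    and "tensor_eq sA sB x y"
  shows "lin_ext scale (\<lambda>(a, b). B a b) x = lin_ext scale (\<lambda>(a, b). B a b) y"
  using lin_ext_tensor_null[of B, OF assms(1-4) assms(5)[unfolded tensor_eq_def]]
  by (simp add: lin_ext_diff)

end

lemma linear_apply_lin_ext:
  assumes "Vector_Spaces.linear s s' T"
  shows "T (lin_ext s f x) = lin_ext s' (\<lambda>i. T (f i)) x"
proof -
  interpret Vector_Spaces.linear s s' T by fact
  show ?thesis by (simp add: lin_ext_def sum scale)
qed

lemma tensor_null_subspace: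
  fixes sA :: "'k::field \<Rightarrow> 'a::ab_group_add \<Rightarrow> 'a" and sB :: "'k \<Rightarrow> 'b::ab_group_add \<Rightarrow> 'b"
  shows "module.subspace free_scale (tensor_null sA sB)"
proof -
  interpret F: vector_space "free_scale :: 'k \<Rightarrow> ('a \<times> 'b \<Rightarrow>\<^sub>0 'k) \<Rightarrow> _" by (rule vector_space_free_scale)
  show ?thesis unfolding tensor_null_def by (rule F.subspace_span)
qed

lemma
  fixes sA :: "'k::field \<Rightarrow> 'a::ab_group_add \<Rightarrow> 'a" and sB :: "'k \<Rightarrow> 'b::ab_group_add \<Rightarrow> 'b"
  shows tensor_null_zero: "0 \<in> tensor_null sA sB"
  and tensor_null_add: "x \<in> tensor_null sA sB \<Longrightarrow> y \<in> tensor_null sA sB \<Longrightarrow> x + y \<in> tensor_null sA sB"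
  and tensor_null_neg: "x \<in> tensor_null sA sB \<Longrightarrow> - x \<in> tensor_null sA sB"
  and tensor_null_scale: "x \<in> tensor_null sA sB \<Longrightarrow> free_scale c x \<in> tensor_null sA sB"
proof -
  interpret F: vector_space "free_scale :: 'k \<Rightarrow> ('a \<times> 'b \<Rightarrow>\<^sub>0 'k) \<Rightarrow> _" by (rule vector_space_free_scale)
  note s = tensor_null_subspace[of sA sB]
  show "0 \<in> tensor_null sA sB" by (rule F.subspace_0[OF s])
  show "x + y \<in> tensor_null sA sB" if "x \<in> tensor_null sA sB" "y \<in> tensor_null sA sB"
    by (rule F.subspace_add[OF s that])
  show "- x \<in> tensor_null sA sB" if "x \<in> tensor_null sA sB" by (rule F.subspace_neg[OF s that])
  show "free_scale c x \<in> tensor_null sA sB" if "x \<in> tensor_null sA sB" by (rule F.subspace_scale[OF s that])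
qed

lemma tensor_eq_refl: "tensor_eq sA sB x x"
  unfolding tensor_eq_def using tensor_null_zero by simp

lemma tensor_eq_sym: "tensor_eq sA sB x y \<Longrightarrow> tensor_eq sA sB y x"
  unfolding tensor_eq_def using tensor_null_neg[of "x - y"] by simp

lemma tensor_eq_trans: "tensor_eq sA sB x y \<Longrightarrow> tensor_eq sA sB y z \<Longrightarrow> tensor_eq sA sB x z"
  unfolding tensor_eq_def using tensor_null_add[of "x - y" _ _ "y - z"] by simp

lemma tensor_eq_add:
  "tensor_eq sA sB x x' \<Longrightarrow> tensor_eq sA sB y y' \<Longrightarrow> tensor_eq sA sB (x + y) (x' + y')"
  unfolding tensor_eq_def using tensor_null_add[of "x - x'" _ _ "y - y'"] by (simp add: algebra_simps)

lemma tensor_eq_scale: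
  fixes sA :: "'k::field \<Rightarrow> 'a::ab_group_add \<Rightarrow> 'a" and sB :: "'k \<Rightarrow> 'b::ab_group_add \<Rightarrow> 'b"
  assumes "tensor_eq sA sB x y"
  shows "tensor_eq sA sB (free_scale c x) (free_scale c y)"
proof -
  interpret F: vector_space "free_scale :: 'k \<Rightarrow> ('a \<times> 'b \<Rightarrow>\<^sub>0 'k) \<Rightarrow> _" by (rule vector_space_free_scale)
  show ?thesis
    using assms tensor_null_scale[of "x - y" sA sB c] by (simp add: tensor_eq_def F.scale_right_diff_distrib)
qed

lemma tensor_eq_sum:
  assumes "\<And>i. i \<in> A \<Longrightarrow> tensor_eq sA sB (f i) (g i)"
  shows "tensor_eq sA sB (sum f A) (sum g A)"
  using assms by (induction A rule: infinite_finite_induct) (auto simp: tensor_eq_refl intro: tensor_eq_add)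

lemma tensor_eq_lin_ext:
  assumes "\<And>i. tensor_eq sA sB (f i) (g i)"
  shows "tensor_eq sA sB (lin_ext free_scale f x) (lin_ext free_scale g x)"
  unfolding lin_ext_def by (intro tensor_eq_sum tensor_eq_scale assms)

lemma lin_ext_basis_vec: "lin_ext free_scale basis_vec x = x"
proof -
  interpret F: vector_space "free_scale :: 'b \<Rightarrow> ('a \<Rightarrow>\<^sub>0 'b) \<Rightarrow> _" by (rule vector_space_free_scale)
  show ?thesis
    by (rule poly_mapping_eqI)
      (simp add: lin_ext_def lookup_sum lookup_free_scale lookup_single when_def in_keys_iff if_distrib cong: if_cong)
qed

lemma free_scale_single: "free_scale c (Poly_Mapping.single i d) = Poly_Mapping.single i (c * d)"
  by (rule poly_mapping_eqI) (simp add: lookup_free_scale lookup_single when_def)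

lemma keys_sum_subset:
  assumes "\<And>i. i \<in> A \<Longrightarrow> Poly_Mapping.keys (f i) \<subseteq> N"
  shows "Poly_Mapping.keys (sum f A) \<subseteq> N"
proof
  fix k assume "k \<in> Poly_Mapping.keys (sum f A)"
  then have "(\<Sum>i\<in>A. Poly_Mapping.lookup (f i) k) \<noteq> 0" by (simp add: in_keys_iff lookup_sum)
  then obtain i where "i \<in> A" "Poly_Mapping.lookup (f i) k \<noteq> 0"
    by (rule sum.not_neutral_contains_not_neutral)
  then show "k \<in> N" using subsetD[OF assms, of i k] by (simp add: in_keys_iff)
qed

lemma sum_lookup_single:
  assumes "Poly_Mapping.keys s \<subseteq> A" "finite A"
  shows "(\<Sum>i\<in>A. Poly_Mapping.single i (Poly_Mapping.lookup s i)) = s"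
  by (rule poly_mapping_eqI)
    (use assms in \<open>auto simp: lookup_sum lookup_single when_def in_keys_iff if_distrib cong: if_cong\<close>)

lemma
  fixes sA :: "'k::field \<Rightarrow> 'a::ab_group_add \<Rightarrow> 'a" and sB :: "'k \<Rightarrow> 'b::ab_group_add \<Rightarrow> 'b"
  shows tensor_eq_add_left: "tensor_eq sA sB (basis_vec (a + a', b)) (basis_vec (a, b) + basis_vec (a', b))"
    and tensor_eq_add_right: "tensor_eq sA sB (basis_vec (a, b + b')) (basis_vec (a, b) + basis_vec (a, b'))"
    and tensor_eq_scale_left: "tensor_eq sA sB (basis_vec (sA c a, b)) (free_scale c (basis_vec (a, b)))"
    and tensor_eq_scale_right: "tensor_eq sA sB (basis_vec (a, sB c b)) (free_scale c (basis_vec (a, b)))"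
proof -
  interpret F: vector_space "free_scale :: 'k \<Rightarrow> ('a \<times> 'b \<Rightarrow>\<^sub>0 'k) \<Rightarrow> _" by (rule vector_space_free_scale)
  show "tensor_eq sA sB (basis_vec (a + a', b)) (basis_vec (a, b) + basis_vec (a', b))"
    unfolding tensor_eq_def tensor_null_def diff_diff_eq[symmetric] by (rule F.span_base) blast
  show "tensor_eq sA sB (basis_vec (a, b + b')) (basis_vec (a, b) + basis_vec (a, b'))"
    unfolding tensor_eq_def tensor_null_def diff_diff_eq[symmetric] by (rule F.span_base) blast
  show "tensor_eq sA sB (basis_vec (sA c a, b)) (free_scale c (basis_vec (a, b)))"
    unfolding tensor_eq_def tensor_null_def by (rule F.span_base) blast
  show "tensor_eq sA sB (basis_vec (a, sB c b)) (free_scale c (basis_vec (a, b)))"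
    unfolding tensor_eq_def tensor_null_def by (rule F.span_base) blast
qed

lemma
  fixes sA :: "'k::field \<Rightarrow> 'a::ab_group_add \<Rightarrow> 'a" and sB :: "'k \<Rightarrow> 'b::ab_group_add \<Rightarrow> 'b"
  shows tensor_eq_zero_left: "tensor_eq sA sB (basis_vec (0, b)) 0"
    and tensor_eq_zero_right: "tensor_eq sA sB (basis_vec (a, 0)) 0"
  using tensor_eq_add_left[of sA sB 0 0 b, THEN tensor_eq_sym] tensor_eq_add_right[of sA sB a 0 0, THEN tensor_eq_sym]
  by (simp_all add: tensor_eq_def)

lemma
  fixes sA :: "'k::field \<Rightarrow> 'a::ab_group_add \<Rightarrow> 'a" and sB :: "'k \<Rightarrow> 'b::ab_group_add \<Rightarrow> 'b"
  shows tensor_eq_sum_left: "tensor_eq sA sB (basis_vec (sum f A, b)) (\<Sum>i\<in>A. basis_vec (f i, b))"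
    and tensor_eq_sum_right: "tensor_eq sA sB (basis_vec (a, sum g A)) (\<Sum>i\<in>A. basis_vec (a, g i))"
proof -
  show "tensor_eq sA sB (basis_vec (sum f A, b)) (\<Sum>i\<in>A. basis_vec (f i, b))"
  proof (induction A rule: infinite_finite_induct)
    case (insert i A)
    show ?case
      using tensor_eq_trans[OF tensor_eq_add_left tensor_eq_add[OF tensor_eq_refl insert.IH]] insert.hyps by simp
  qed (simp_all add: tensor_eq_zero_left)
  show "tensor_eq sA sB (basis_vec (a, sum g A)) (\<Sum>i\<in>A. basis_vec (a, g i))"
  proof (induction A rule: infinite_finite_induct)
    case (insert i A)
    show ?case
      using tensor_eq_trans[OF tensor_eq_add_right tensor_eq_add[OF tensor_eq_refl insert.IH]] insert.hyps by simp
  qed (simp_all add: tensor_eq_zero_right)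
qed

lemma tensor_eq_bilinear_expansion:
  fixes sA :: "'k::field \<Rightarrow> 'a::ab_group_add \<Rightarrow> 'a" and sB :: "'k \<Rightarrow> 'b::ab_group_add \<Rightarrow> 'b"
  shows "tensor_eq sA sB (basis_vec (\<Sum>i\<in>A. sA (c i) (f i), \<Sum>j\<in>B. sB (d j) (g j)))
    (\<Sum>i\<in>A. \<Sum>j\<in>B. free_scale (c i * d j) (basis_vec (f i, g j)))"
proof (rule tensor_eq_trans[OF tensor_eq_sum_left tensor_eq_sum])
  fix i
  show "tensor_eq sA sB (basis_vec (sA (c i) (f i), \<Sum>j\<in>B. sB (d j) (g j)))
      (\<Sum>j\<in>B. free_scale (c i * d j) (basis_vec (f i, g j)))"
  proof (rule tensor_eq_trans[OF tensor_eq_sum_right tensor_eq_sum])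
    fix j
    have "tensor_eq sA sB (basis_vec (sA (c i) (f i), sB (d j) (g j)))
        (free_scale (c i) (free_scale (d j) (basis_vec (f i, g j))))"
      by (rule tensor_eq_trans[OF tensor_eq_scale_left tensor_eq_scale[OF tensor_eq_scale_right]])
    then show "tensor_eq sA sB (basis_vec (sA (c i) (f i), sB (d j) (g j)))
        (free_scale (c i * d j) (basis_vec (f i, g j)))"
      by (simp add: free_scale_single)
  qed
qed

lemma vector_space_mult: "vector_space ((*) :: 'a::field \<Rightarrow> 'a \<Rightarrow> 'a)"
  by unfold_locales (simp_all add: algebra_simps)

section \<open>The skew brace of a Hopf Galois structure\<close>

locale hopf_galois_on_galois = G: finite_galois_extension sL + hopf_galois_structure sL sH \<Delta> \<epsilon> S act
  for sL :: "'k::field \<Rightarrow> 'l::field \<Rightarrow> 'l"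
    and sH :: "'k \<Rightarrow> 'h::ring_1 \<Rightarrow> 'h"
    and \<Delta> :: "'h \<Rightarrow> ('h \<times> 'h \<Rightarrow>\<^sub>0 'k)" and \<epsilon> :: "'h \<Rightarrow> 'k" and S :: "'h \<Rightarrow> 'h"
    and act :: "'h \<Rightarrow> 'l \<Rightarrow> 'l"
begin

abbreviation Gal :: "('l \<Rightarrow> 'l) set" where
  "Gal \<equiv> carrier (gal_group sL)"

text \<open>The coefficients of \<open>act h\<close> with respect to the \<open>L\<close>-basis \<open>Gal\<close> of \<open>End\<^sub>K(L)\<close>.\<close>

definition coef :: "'h \<Rightarrow> ('l \<Rightarrow> 'l) \<Rightarrow> 'l" where
  "coef h = (SOME c. \<forall>x. act h x = (\<Sum>\<gamma>\<in>Gal. c \<gamma> * \<gamma> x))"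

lemma act_eq: "act h x = (\<Sum>\<gamma>\<in>Gal. coef h \<gamma> * \<gamma> x)"
proof -
  have "\<exists>c. \<forall>x. act h x = (\<Sum>\<gamma>\<in>Gal. c \<gamma> * \<gamma> x)"
    using G.linear_expansion[OF act_linear_right] by metis
  then show ?thesis unfolding coef_def by (rule someI2_ex) simp
qed

lemma coef_unique:
  assumes "\<And>x. act h x = (\<Sum>\<gamma>\<in>Gal. c \<gamma> * \<gamma> x)" "\<gamma> \<in> Gal"
  shows "coef h \<gamma> = c \<gamma>"
proof -
  have "(\<Sum>\<gamma>\<in>Gal. (coef h \<gamma> - c \<gamma>) * \<gamma> x) = 0" for x
    using assms(1)[of x] act_eq[of h x] by (simp add: left_diff_distrib sum_subtractf)
  from G.gal_independent[OF this assms(2)] show ?thesis by simp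
qed

lemma act_add_left: "act (g + h) x = act g x + act h x"
  using act_linear_left[of x] by (simp add: Vector_Spaces.linear_iff)

lemma act_scale_left: "act (sH k h) x = sL k (act h x)"
  using act_linear_left[of x] by (simp add: Vector_Spaces.linear_iff)

lemma coef_add: "\<gamma> \<in> Gal \<Longrightarrow> coef (g + h) \<gamma> = coef g \<gamma> + coef h \<gamma>"
  by (rule coef_unique) (simp_all add: act_add_left act_eq[of g] act_eq[of h] distrib_right sum.distrib)

lemma coef_scale: "\<gamma> \<in> Gal \<Longrightarrow> coef (sH k h) \<gamma> = sL k (coef h \<gamma>)"
  by (rule coef_unique)
    (simp_all add: act_scale_left act_eq[of h] G.scale_sum_right G.scale_mult_left)

lemma coef_linear: "\<gamma> \<in> Gal \<Longrightarrow> Vector_Spaces.linear sH sL (\<lambda>h. coef h \<gamma>)"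
  by (simp add: Vector_Spaces.linear_iff coef_add coef_scale vector_space_axioms G.vector_space_axioms)

lemma coef_one: "\<gamma> \<in> Gal \<Longrightarrow> coef 1 \<gamma> = (if \<gamma> = id then 1 else 0)"
proof (rule coef_unique)
  show "act 1 x = (\<Sum>\<gamma>\<in>Gal. (if \<gamma> = id then 1 else 0) * \<gamma> x)" for x
    using G.finite_gal G.id_gal by (simp add: act_one_left if_distrib[of "\<lambda>z. z * _"] cong: if_cong)
qed

lemma counit_eq: "sL (\<epsilon> h) 1 = (\<Sum>\<gamma>\<in>Gal. coef h \<gamma>)"
  using act_one_right[of h] act_eq[of h 1] by (simp add: G.gal_one)

lemma lin_ext_coef_mult:
  "lin_ext sL (\<lambda>(a, b). coef a \<gamma> * coef b \<delta>) y * z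
    = lin_ext sL (\<lambda>p. coef (fst p) \<gamma> * coef (snd p) \<delta> * z) y"
  unfolding lin_ext_def by (simp add: sum_distrib_right case_prod_unfold G.scale_mult_left)

text \<open>Expand both sides of the product rule for \<open>act h (x * y)\<close> in automorphisms
  and compare by independence in two variables. Each \<open>\<gamma>\<close> is multiplicative, so
  only the diagonal survives: the basis \<open>Gal\<close> is group-like.\<close>

lemma comult_coef:
  assumes "\<gamma> \<in> Gal" "\<delta> \<in> Gal"
  shows "lin_ext sL (\<lambda>(a, b). coef a \<gamma> * coef b \<delta>) (\<Delta> h) = (if \<gamma> = \<delta> then coef h \<gamma> else 0)"
proof -
  define c where "c \<gamma> \<delta> = lin_ext sL (\<lambda>(a, b). coef a \<gamma> * coef b \<delta>) (\<Delta> h)" for \<gamma> \<delta>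
  have scale_mult: "c \<gamma> \<delta> * z = lin_ext sL (\<lambda>p. coef (fst p) \<gamma> * coef (snd p) \<delta> * z) (\<Delta> h)" for \<gamma> \<delta> z
    unfolding c_def by (rule lin_ext_coef_mult)
  have "(\<Sum>\<gamma>\<in>Gal. \<Sum>\<delta>\<in>Gal. (c \<gamma> \<delta> - (if \<gamma> = \<delta> then coef h \<gamma> else 0)) * (\<gamma> x * \<delta> y)) = 0" for x y
  proof -
    have "(\<Sum>\<gamma>\<in>Gal. \<Sum>\<delta>\<in>Gal. c \<gamma> \<delta> * (\<gamma> x * \<delta> y))
        = lin_ext sL (\<lambda>p. \<Sum>\<gamma>\<in>Gal. \<Sum>\<delta>\<in>Gal. coef (fst p) \<gamma> * coef (snd p) \<delta> * (\<gamma> x * \<delta> y)) (\<Delta> h)"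
      by (simp add: scale_mult case_prod_unfold G.lin_ext_sum_fun)
    also have "\<dots> = lin_ext sL (\<lambda>(a, b). act a x * act b y) (\<Delta> h)"
      by (simp add: act_eq[of "fst p" for p] act_eq[of "snd p" for p] case_prod_unfold sum_product mult_ac)
    also have "\<dots> = (\<Sum>\<gamma>\<in>Gal. coef h \<gamma> * (\<gamma> x * \<gamma> y))"
      by (simp add: act_mult_right[symmetric] act_eq[of h] G.gal_mult)
    also have "\<dots> = (\<Sum>\<gamma>\<in>Gal. \<Sum>\<delta>\<in>Gal. (if \<gamma> = \<delta> then coef h \<gamma> else 0) * (\<gamma> x * \<delta> y))"
      using G.finite_gal by (simp add: if_distrib[of "\<lambda>z. z * _"] cong: if_cong)
    finally show ?thesis by (simp add: left_diff_distrib sum_subtractf)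
  qed
  from G.gal_independent2[OF this assms] show ?thesis by (simp add: c_def)
qed

section \<open>Coordinates on the tensor product of \<open>L\<close> and \<open>H\<close>\<close>

lemma galois_map_eq:
  "galois_map sL act t y = (\<Sum>\<gamma>\<in>Gal. lin_ext sL (\<lambda>(x, h). x * coef h \<gamma>) t * \<gamma> y)"
proof -
  have "lin_ext sL (\<lambda>(x, h). x * coef h \<gamma>) t * \<gamma> y = lin_ext sL (\<lambda>p. fst p * coef (snd p) \<gamma> * \<gamma> y) t" for \<gamma>
    unfolding lin_ext_def by (simp add: sum_distrib_right case_prod_unfold G.scale_mult_left)
  then show ?thesis
    unfolding galois_map_def
    by (simp add: G.lin_ext_sum_fun[symmetric] act_eq[of "snd p" for p] case_prod_unfold sum_distrib_left mult.assoc)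
qed

lemma galois_map_class:
  assumes "tensor_eq sL sH t t'"
  shows "galois_map sL act t = galois_map sL act t'"
proof -
  have "(a + a') * act b y = a * act b y + a' * act b y"
    and "a * act (b + b') y = a * act b y + a * act b' y"
    and "sL c a * act b y = sL c (a * act b y)"
    and "a * act (sH c b) y = sL c (a * act b y)" for a a' b b' c y
    unfolding act_add_left act_scale_left
    by (rule distrib_left distrib_right G.scale_mult_left[symmetric] G.scale_mult_right[symmetric])+
  from G.lin_ext_tensor_eq[where B = "\<lambda>x h. x * act h y" for y, OF this assms]
  show ?thesis unfolding galois_map_def by (intro ext)
qed

lemma class_value: "the_elem (galois_map sL act ` {y. tensor_eq sL sH t y}) = galois_map sL act t"
proof -
  have "galois_map sL act ` {y. tensor_eq sL sH t y} = {galois_map sL act t}"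
    (is "_ ` ?X = _")
  proof -
    have "galois_map sL act ` ?X = (\<lambda>_. galois_map sL act t) ` ?X"
      by (rule image_cong[OF refl], drule CollectD, drule galois_map_class, erule sym)
    moreover have "t \<in> ?X" using tensor_eq_refl[of sL sH t] by simp
    ultimately show ?thesis by (metis image_constant)
  qed
  then show ?thesis by simp
qed

lemma tensor_class: "{y. tensor_eq sL sH t y} \<in> tensor_space sL sH"
  unfolding tensor_space_def by (auto simp: quotient_def)

text \<open>Any family of coefficients defines a K-linear endomorphism of \<open>L\<close>, which
  surjectivity of the Galois map lifts to \<open>L \<otimes> H\<close>.\<close>

lemma coef_surj:
  obtains t where "\<And>\<gamma>. \<gamma> \<in> Gal \<Longrightarrow> lin_ext sL (\<lambda>(x, h). x * coef h \<gamma>) t = c \<gamma>"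
proof -
  have "Vector_Spaces.linear sL sL (\<lambda>x. \<Sum>\<gamma>\<in>Gal. c \<gamma> * \<gamma> x)"
    by (simp add: Vector_Spaces.linear_iff G.vector_space_axioms G.gal_add G.gal_scale distrib_left
        sum.distrib G.scale_sum_right G.scale_mult_right)
  then have "(\<lambda>x. \<Sum>\<gamma>\<in>Gal. c \<gamma> * \<gamma> x) \<in> (\<lambda>X. the_elem (galois_map sL act ` X)) ` tensor_space sL sH"
    using galois_bij by (simp add: bij_betw_def)
  then obtain X where X: "X \<in> tensor_space sL sH" "the_elem (galois_map sL act ` X) = (\<lambda>x. \<Sum>\<gamma>\<in>Gal. c \<gamma> * \<gamma> x)"
    by auto
  then obtain t where "X = {y. tensor_eq sL sH t y}" unfolding tensor_space_def by (auto simp: quotient_def)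
  then have t: "galois_map sL act t = (\<lambda>x. \<Sum>\<gamma>\<in>Gal. c \<gamma> * \<gamma> x)" using X(2) class_value[of t] by simp
  have "lin_ext sL (\<lambda>(x, h). x * coef h \<gamma>) t = c \<gamma>" if "\<gamma> \<in> Gal" for \<gamma>
  proof -
    have "(\<Sum>\<gamma>\<in>Gal. (lin_ext sL (\<lambda>(x, h). x * coef h \<gamma>) t - c \<gamma>) * \<gamma> y) = 0" for y
      using fun_cong[OF t, of y] by (simp add: galois_map_eq left_diff_distrib sum_subtractf)
    from G.gal_independent[OF this that] show ?thesis by simp
  qed
  then show ?thesis by (rule that)
qed

lemma coef_tensor_inj:
  assumes "\<And>\<gamma>. \<gamma> \<in> Gal \<Longrightarrow> lin_ext sL (\<lambda>(x, h). x * coef h \<gamma>) t = 0"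
  shows "t \<in> tensor_null sL sH"
proof -
  have "galois_map sL act t = galois_map sL act 0"
    by (rule ext) (simp add: galois_map_eq assms G.lin_ext_zero)
  then have "the_elem (galois_map sL act ` {y. tensor_eq sL sH t y}) = the_elem (galois_map sL act ` {y. tensor_eq sL sH 0 y})"
    by (simp add: class_value)
  moreover have "inj_on (\<lambda>X. the_elem (galois_map sL act ` X)) (tensor_space sL sH)"
    using galois_bij by (simp add: bij_betw_def)
  ultimately have "{y. tensor_eq sL sH t y} = {y. tensor_eq sL sH 0 y}"
    by (auto dest!: inj_onD simp: tensor_class)
  then have "tensor_eq sL sH t 0" using tensor_eq_refl[of sL sH 0] by blast
  then show ?thesis by (simp add: tensor_eq_def)
qed

text \<open>Independence over \<open>L\<close> of the functionals
  \<open>\<lambda>h. coef h \<gamma>\<close>: evaluate the relation on an element of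
  \<open>L \<otimes> H\<close> whose only nonzero coordinate is at \<open>\<delta>\<close>.\<close>

lemma coef_separating:
  assumes "\<And>h. (\<Sum>\<gamma>\<in>Gal. coef h \<gamma> * w \<gamma>) = 0" "\<delta> \<in> Gal"
  shows "w \<delta> = 0"
proof -
  obtain t where t: "\<And>\<gamma>. \<gamma> \<in> Gal \<Longrightarrow> lin_ext sL (\<lambda>(x, h). x * coef h \<gamma>) t = (if \<gamma> = \<delta> then 1 else 0)"
    using coef_surj[of "\<lambda>\<gamma>. if \<gamma> = \<delta> then 1 else 0"] by blast
  have "w \<delta> = (\<Sum>\<gamma>\<in>Gal. (if \<gamma> = \<delta> then 1 else 0) * w \<gamma>)"
    using assms(2) G.finite_gal by (simp add: if_distrib[of "\<lambda>z. z * _"] cong: if_cong)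
  also have "\<dots> = (\<Sum>\<gamma>\<in>Gal. lin_ext sL (\<lambda>(x, h). x * coef h \<gamma>) t * w \<gamma>)"
    by (intro sum.cong refl) (simp only: t)
  also have "\<dots> = lin_ext sL (\<lambda>p. fst p * (\<Sum>\<gamma>\<in>Gal. coef (snd p) \<gamma> * w \<gamma>)) t"
    unfolding lin_ext_def
    by (simp add: sum_distrib_right sum_distrib_left case_prod_unfold G.scale_mult_left G.scale_sum_right mult.assoc)
      (rule sum.swap)
  also have "\<dots> = 0" unfolding assms(1) by (simp add: lin_ext_def)
  finally show ?thesis .
qed

lemma coef_separating_eq:
  assumes "\<And>h. (\<Sum>\<gamma>\<in>Gal. coef h \<gamma> * v \<gamma>) = (\<Sum>\<gamma>\<in>Gal. coef h \<gamma> * w \<gamma>)" "\<delta> \<in> Gal"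
  shows "v \<delta> = w \<delta>"
  using coef_separating[of "\<lambda>\<gamma>. v \<gamma> - w \<gamma>", OF _ assms(2)] assms(1)
  by (simp add: right_diff_distrib sum_subtractf)

lemma coef_separating_eq2:
  assumes "\<And>g h. (\<Sum>\<gamma>\<in>Gal. \<Sum>\<delta>\<in>Gal. coef g \<gamma> * (coef h \<delta> * v \<gamma> \<delta>))
      = (\<Sum>\<gamma>\<in>Gal. \<Sum>\<delta>\<in>Gal. coef g \<gamma> * (coef h \<delta> * w \<gamma> \<delta>))"
    and "\<sigma> \<in> Gal" "\<tau> \<in> Gal"
  shows "v \<sigma> \<tau> = w \<sigma> \<tau>"
proof (rule coef_separating_eq[OF _ assms(3)])
  show "(\<Sum>\<delta>\<in>Gal. coef h \<delta> * v \<sigma> \<delta>) = (\<Sum>\<delta>\<in>Gal. coef h \<delta> * w \<sigma> \<delta>)" for h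
    by (rule coef_separating_eq[OF _ assms(2)]) (use assms(1) in \<open>simp add: sum_distrib_left\<close>)
qed

text \<open>Let the \<open>t \<gamma>\<close> be dual to the functionals
  \<open>\<lambda>h. coef h \<gamma>\<close>. Injectivity of the Galois map gives \<open>1 \<otimes>
  h = (\<Sum>\<gamma>\<in>Gal. coef h \<gamma> * t \<gamma>)\<close> in
  \<open>L \<otimes> H\<close>; hence \<open>w \<gamma>\<close> is the value at
  \<open>t \<gamma>\<close> of the L-linear extension of \<open>\<beta>\<close>.\<close>

lemma functional_representation:
  assumes "Vector_Spaces.linear sH sL \<beta>"
  obtains w where "\<And>h. \<beta> h = (\<Sum>\<gamma>\<in>Gal. coef h \<gamma> * w \<gamma>)"
proof -
  have \<beta>: "\<beta> (g + h) = \<beta> g + \<beta> h" "\<beta> (sH k h) = sL k (\<beta> h)" for g h k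
    using assms by (simp_all add: Vector_Spaces.linear_iff)
  have "\<exists>t. \<forall>\<gamma>\<in>Gal. lin_ext sL (\<lambda>(x, h). x * coef h \<gamma>) t = (if \<gamma> = \<delta> then 1 else 0)" for \<delta>
    by (rule coef_surj[of "\<lambda>\<gamma>. if \<gamma> = \<delta> then 1 else 0"]) blast
  then obtain t where t: "\<And>\<gamma> \<delta>. \<gamma> \<in> Gal \<Longrightarrow> lin_ext sL (\<lambda>(x, h). x * coef h \<gamma>) (t \<delta>) = (if \<gamma> = \<delta> then 1 else 0)"
    by metis
  define w where "w \<gamma> = lin_ext sL (\<lambda>(x, h). x * \<beta> h) (t \<gamma>)" for \<gamma>
  have "\<beta> h = (\<Sum>\<gamma>\<in>Gal. coef h \<gamma> * w \<gamma>)" for h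
  proof -
    let ?s = "\<lambda>\<gamma>. lin_ext free_scale (\<lambda>(x, k). basis_vec (coef h \<gamma> * x, k)) (t \<gamma>)"
    have s: "lin_ext sL (\<lambda>(x, k). x * f k) (?s \<gamma>) = coef h \<gamma> * lin_ext sL (\<lambda>(x, k). x * f k) (t \<gamma>)"
      for f :: "'h \<Rightarrow> 'l" and \<gamma>
      unfolding linear_apply_lin_ext[OF G.linear_lin_ext]
      by (simp add: lin_ext_def[of sL] case_prod_unfold G.lin_ext_single sum_distrib_left
          G.scale_mult_right mult.assoc)
    let ?r = "basis_vec (1, h) - (\<Sum>\<gamma>\<in>Gal. ?s \<gamma>)"
    have "?r \<in> tensor_null sL sH"
    proof (rule coef_tensor_inj)
      fix \<delta> assume \<delta>: "\<delta> \<in> Gal"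
      have "(\<Sum>\<gamma>\<in>Gal. coef h \<gamma> * lin_ext sL (\<lambda>(x, k). x * coef k \<delta>) (t \<gamma>)) = coef h \<delta>"
        unfolding t[OF \<delta>] using \<delta> G.finite_gal by (simp add: if_distrib cong: if_cong)
      then show "lin_ext sL (\<lambda>(x, h). x * coef h \<delta>) ?r = 0"
        by (simp add: G.lin_ext_diff G.lin_ext_sum G.lin_ext_single s)
    qed
    have "lin_ext sL (\<lambda>(x, h). x * \<beta> h) ?r = 0"
    proof (rule G.lin_ext_tensor_null[where B = "\<lambda>x h. x * \<beta> h" and sA = sL and sB = sH])
      show "sL c a * \<beta> b = sL c (a * \<beta> b)" for c a b by (rule G.scale_mult_left[symmetric])
      show "a * \<beta> (sH c b) = sL c (a * \<beta> b)" for c a b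
        unfolding \<beta> by (rule G.scale_mult_right[symmetric])
    qed (simp_all add: \<beta> distrib_left distrib_right \<open>?r \<in> tensor_null sL sH\<close>)
    then show ?thesis
      by (simp add: G.lin_ext_diff G.lin_ext_sum G.lin_ext_single s w_def)
  qed
  then show ?thesis by (rule that)
qed

text \<open>All coordinates of \<open>1 \<otimes> h\<close> vanish, so it is zero in
  \<open>L \<otimes> H\<close>. Contracting the first factor with
  \<open>x \<mapsto> tr (u * x)\<close>, where \<open>u\<close> has trace 1, recovers
  \<open>h\<close> from it.\<close>

lemma coef_eq_zero_imp:
  assumes "\<And>\<gamma>. \<gamma> \<in> Gal \<Longrightarrow> coef h \<gamma> = 0"
  shows "h = 0"
proof -
  obtain u where u: "(\<Sum>\<gamma>\<in>Gal. \<gamma> u) = 1" by (rule G.trace_one_exists)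
  have inj: "a = b" if "sL a 1 = sL b 1" for a b using that by simp
  have tr_add: "G.tr (x + y) = G.tr x + G.tr y" for x y
    by (rule inj) (simp add: G.scale_left_distrib G.tr G.gal_add sum.distrib)
  have tr_scale: "G.tr (sL c x) = c * G.tr x" for c x
    by (rule inj) (simp add: G.scale_scale[symmetric] G.tr G.gal_scale G.scale_sum_right del: G.scale_scale)
  have "G.tr u = 1" by (rule inj) (simp add: G.tr u)
  have null: "basis_vec (1, h) \<in> tensor_null sL sH"
    by (rule coef_tensor_inj) (simp add: G.lin_ext_single assms)
  have "lin_ext sH (\<lambda>(x, h). sH (G.tr (u * x)) h) (basis_vec (1, h)) = 0"
  proof (rule lin_ext_tensor_null[where B = "\<lambda>x h. sH (G.tr (u * x)) h" and sA = sL and sB = sH])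
    show "sH (G.tr (u * sL c a)) b = sH c (sH (G.tr (u * a)) b)" for c a b
      by (simp add: G.scale_mult_right[symmetric] tr_scale)
  qed (simp_all add: distrib_left tr_add scale_left_distrib scale_right_distrib mult.commute null)
  then show ?thesis using \<open>G.tr u = 1\<close> by (simp add: lin_ext_single)
qed

lemma coef_inject:
  assumes "\<And>\<gamma>. \<gamma> \<in> Gal \<Longrightarrow> coef g \<gamma> = coef h \<gamma>"
  shows "g = h"
proof -
  have "coef (g - h) \<gamma> = 0" if "\<gamma> \<in> Gal" for \<gamma>
    using coef_add[OF that, of "g - h" h] assms[OF that] by simp
  from coef_eq_zero_imp[OF this] show ?thesis by simp
qed

lemma coef_distinct:
  assumes "\<rho> \<in> Gal" "\<rho>' \<in> Gal" "\<And>h. coef h \<rho> = coef h \<rho>'"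
  shows "\<rho> = \<rho>'"
proof -
  have "(\<Sum>\<gamma>\<in>Gal. coef h \<gamma> * (if \<gamma> = \<rho> then 1 else 0)) = (\<Sum>\<gamma>\<in>Gal. coef h \<gamma> * (if \<gamma> = \<rho>' then 1 else 0))" for h
    using assms G.finite_gal by (simp add: if_distrib cong: if_cong)
  from coef_separating_eq[OF this assms(1)] show ?thesis by (simp split: if_splits)
qed

text \<open>By \<open>comult_coef\<close> and \<open>counit_eq\<close> the functionals
  \<open>\<lambda>h. coef h \<gamma>\<close> are orthogonal idempotents with sum one in the
  convolution algebra of K-linear maps from \<open>H\<close> to \<open>L\<close>, which is thereby a
  product of copies of \<open>L\<close>. Composition with \<open>\<sigma>\<close> is a ring
  automorphism and has to permute these primitive idempotents.\<close>

lemma gal_permutes_coef: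
  assumes \<sigma>: "\<sigma> \<in> Gal" and \<gamma>: "\<gamma> \<in> Gal"
  obtains \<rho> where "\<rho> \<in> Gal" "\<And>h. \<sigma> (coef h \<rho>) = coef h \<gamma>"
proof -
  have lin: "Vector_Spaces.linear sH sL (\<lambda>h. \<sigma> (coef h \<rho>))" if "\<rho> \<in> Gal" for \<rho>
    using coef_add[OF that] coef_scale[OF that] \<sigma>
    by (simp add: Vector_Spaces.linear_iff vector_space_axioms G.vector_space_axioms G.gal_add G.gal_scale)
  have "\<exists>w. \<forall>h. \<sigma> (coef h \<rho>) = (\<Sum>\<gamma>\<in>Gal. coef h \<gamma> * w \<gamma>)" if "\<rho> \<in> Gal" for \<rho>
    by (rule functional_representation[OF lin[OF that]]) blast
  then have "\<forall>\<rho>\<in>Gal. \<exists>w. \<forall>h. \<sigma> (coef h \<rho>) = (\<Sum>\<gamma>\<in>Gal. coef h \<gamma> * w \<gamma>)" by blast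
  then obtain w where "\<forall>\<rho>\<in>Gal. \<forall>h. \<sigma> (coef h \<rho>) = (\<Sum>\<gamma>\<in>Gal. coef h \<gamma> * w \<rho> \<gamma>)"
    by (rule bchoice[THEN exE])
  then have w: "\<sigma> (coef h \<rho>) = (\<Sum>\<gamma>\<in>Gal. coef h \<gamma> * w \<rho> \<gamma>)" if "\<rho> \<in> Gal" for h \<rho>
    using that by simp
  \<comment> \<open>For fixed \<open>\<gamma>\<close> the values \<open>w \<rho> \<gamma>\<close>
    are orthogonal idempotents of the field \<open>L\<close>, by comultiplication, with sum 1, by
    the counit. So exactly one of them is 1, and \<open>q \<gamma>\<close> will be its
    index.\<close>
  have orth: "w \<rho> \<gamma> * w \<tau> \<gamma> = (if \<rho> = \<tau> then w \<rho> \<gamma> else 0)"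
    if \<rho>: "\<rho> \<in> Gal" and \<tau>: "\<tau> \<in> Gal" and \<gamma>: "\<gamma> \<in> Gal" for \<rho> \<tau> \<gamma>
  proof (rule coef_separating_eq[OF _ \<gamma>, of "\<lambda>\<gamma>. w \<rho> \<gamma> * w \<tau> \<gamma>" "\<lambda>\<gamma>. if \<rho> = \<tau> then w \<rho> \<gamma> else 0"])
    fix h
    let ?D = "\<lambda>\<gamma> \<delta>. lin_ext sL (\<lambda>(a, b). coef a \<gamma> * coef b \<delta>) (\<Delta> h)"
    have "(if \<rho> = \<tau> then \<sigma> (coef h \<rho>) else 0) = \<sigma> (?D \<rho> \<tau>)"
      unfolding comult_coef[OF \<rho> \<tau>] by (simp add: G.gal_zero[OF \<sigma>])
    also have "\<dots> = lin_ext sL (\<lambda>p. \<sigma> (coef (fst p) \<rho>) * \<sigma> (coef (snd p) \<tau>)) (\<Delta> h)"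
      by (simp add: linear_apply_lin_ext[OF G.gal_linear[OF \<sigma>]] case_prod_unfold G.gal_mult[OF \<sigma>])
    also have "\<dots> = (\<Sum>\<gamma>\<in>Gal. \<Sum>\<delta>\<in>Gal.
        lin_ext sL (\<lambda>p. coef (fst p) \<gamma> * coef (snd p) \<delta> * (w \<rho> \<gamma> * w \<tau> \<delta>)) (\<Delta> h))"
      by (simp add: w[OF \<rho>] w[OF \<tau>] sum_product G.lin_ext_sum_fun mult_ac)
    also have "\<dots> = (\<Sum>\<gamma>\<in>Gal. \<Sum>\<delta>\<in>Gal. ?D \<gamma> \<delta> * (w \<rho> \<gamma> * w \<tau> \<delta>))"
      by (simp only: lin_ext_coef_mult)
    also have "\<dots> = (\<Sum>\<gamma>\<in>Gal. \<Sum>\<delta>\<in>Gal. (if \<gamma> = \<delta> then coef h \<gamma> else 0) * (w \<rho> \<gamma> * w \<tau> \<delta>))"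
      by (intro sum.cong refl) (simp only: comult_coef)
    also have "\<dots> = (\<Sum>\<gamma>\<in>Gal. coef h \<gamma> * (w \<rho> \<gamma> * w \<tau> \<gamma>))"
      using G.finite_gal by (simp add: if_distrib[of "\<lambda>z. z * _"] cong: if_cong)
    finally show "(\<Sum>\<gamma>\<in>Gal. coef h \<gamma> * (w \<rho> \<gamma> * w \<tau> \<gamma>))
        = (\<Sum>\<gamma>\<in>Gal. coef h \<gamma> * (if \<rho> = \<tau> then w \<rho> \<gamma> else 0))"
      by (cases "\<rho> = \<tau>") (simp_all add: w[OF \<tau>])
  qed
  have total: "(\<Sum>\<rho>\<in>Gal. w \<rho> \<gamma>) = 1" if \<gamma>: "\<gamma> \<in> Gal" for \<gamma>
  proof (rule coef_separating_eq[OF _ \<gamma>, of "\<lambda>\<gamma>. \<Sum>\<rho>\<in>Gal. w \<rho> \<gamma>" "\<lambda>_. 1"])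
    fix h
    have "(\<Sum>\<gamma>\<in>Gal. coef h \<gamma> * (\<Sum>\<rho>\<in>Gal. w \<rho> \<gamma>)) = (\<Sum>\<rho>\<in>Gal. \<Sum>\<gamma>\<in>Gal. coef h \<gamma> * w \<rho> \<gamma>)"
      by (simp add: sum_distrib_left) (rule sum.swap)
    also have "\<dots> = (\<Sum>\<rho>\<in>Gal. \<sigma> (coef h \<rho>))" by (intro sum.cong refl) (simp only: w)
    also have "\<dots> = \<sigma> (sL (\<epsilon> h) 1)" by (simp add: counit_eq G.gal_sum[OF \<sigma>])
    also have "\<dots> = (\<Sum>\<gamma>\<in>Gal. coef h \<gamma> * 1)" unfolding G.gal_scale_one[OF \<sigma>] by (simp add: counit_eq)
    finally show "(\<Sum>\<gamma>\<in>Gal. coef h \<gamma> * (\<Sum>\<rho>\<in>Gal. w \<rho> \<gamma>)) = (\<Sum>\<gamma>\<in>Gal. coef h \<gamma> * 1)" .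
  qed
  have "\<exists>\<rho>\<in>Gal. \<forall>\<tau>\<in>Gal. w \<tau> \<gamma> = (if \<rho> = \<tau> then 1 else 0)" if \<gamma>: "\<gamma> \<in> Gal" for \<gamma>
  proof -
    obtain \<rho> where \<rho>: "\<rho> \<in> Gal" "w \<rho> \<gamma> \<noteq> 0"
      using total[OF \<gamma>] by (metis sum.neutral zero_neq_one)
    then have w1: "w \<rho> \<gamma> = 1" using orth[OF \<rho>(1) \<rho>(1) \<gamma>] by simp
    have "w \<tau> \<gamma> = (if \<rho> = \<tau> then 1 else 0)" if "\<tau> \<in> Gal" for \<tau>
      using orth[OF \<rho>(1) that \<gamma>] unfolding w1 by (simp only: mult_1_left)
    then show ?thesis using \<rho>(1) by blast
  qed
  then have "\<forall>\<gamma>\<in>Gal. \<exists>\<rho>. \<rho> \<in> Gal \<and> (\<forall>\<tau>\<in>Gal. w \<tau> \<gamma> = (if \<rho> = \<tau> then 1 else 0))" by blast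
  then obtain q where q: "\<forall>\<gamma>\<in>Gal. q \<gamma> \<in> Gal \<and> (\<forall>\<tau>\<in>Gal. w \<tau> \<gamma> = (if q \<gamma> = \<tau> then 1 else 0))"
    by (rule bchoice[THEN exE])
  have fibre: "\<sigma> (coef h \<rho>) = (\<Sum>\<gamma>\<in>Gal. coef h \<gamma> * (if q \<gamma> = \<rho> then 1 else 0))" if "\<rho> \<in> Gal" for h \<rho>
    unfolding w[OF that] using q that by (intro sum.cong refl) simp
  \<comment> \<open>An index \<open>\<rho>\<close> missed by \<open>q\<close> would make
    \<open>coef h \<rho>\<close> vanish for all \<open>h\<close>, against independence.\<close>
  have "q ` Gal = Gal"
  proof (rule subset_antisym)
    show "Gal \<subseteq> q ` Gal"
    proof (rule subsetI, rule ccontr)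
      fix \<rho> assume \<rho>: "\<rho> \<in> Gal" "\<rho> \<notin> q ` Gal"
      have "(\<Sum>\<gamma>\<in>Gal. coef h \<gamma> * (if \<gamma> = \<rho> then 1 else 0)) = 0" for h
      proof -
        have "\<sigma> (coef h \<rho>) = 0" unfolding fibre[OF \<rho>(1)] using \<rho>(2) by (intro sum.neutral) auto
        then have "coef h \<rho> = 0" using G.gal_eq_zero_iff[OF \<sigma>] by simp
        then show ?thesis using \<rho>(1) G.finite_gal by (simp add: if_distrib cong: if_cong)
      qed
      from coef_separating[OF this \<rho>(1)] show False by simp
    qed
  qed (use q in auto)
  then have inj: "inj_on q Gal" using G.finite_gal by (simp add: eq_card_imp_inj_on)
  show ?thesis
  proof (rule that[of "q \<gamma>"])
    show q\<gamma>: "q \<gamma> \<in> Gal" using q \<gamma> by simp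
    fix h
    have "\<sigma> (coef h (q \<gamma>)) = (\<Sum>\<delta>\<in>Gal. coef h \<delta> * (if \<delta> = \<gamma> then 1 else 0))"
      unfolding fibre[OF q\<gamma>] using inj_on_eq_iff[OF inj _ \<gamma>] by (intro sum.cong refl) simp
    then show "\<sigma> (coef h (q \<gamma>)) = coef h \<gamma>" using \<gamma> G.finite_gal by (simp add: if_distrib cong: if_cong)
  qed
qed

text \<open>\<open>L \<otimes> H\<close> is a coalgebra with group-like basis \<open>Gal\<close>, which the action of \<open>Gal\<close> on the factor
  \<open>L\<close> permutes: \<open>twist \<sigma>\<close> is the inverse of the permutation given by \<open>\<sigma>\<close>.  Multiplication in
  \<open>L \<otimes> H\<close> becomes a second group operation \<open>star\<close> on \<open>Gal\<close>, which makes \<open>Gal\<close> a skew brace.\<close>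

definition twist :: "('l \<Rightarrow> 'l) \<Rightarrow> ('l \<Rightarrow> 'l) \<Rightarrow> 'l \<Rightarrow> 'l" where
  "twist \<sigma> \<gamma> = (SOME \<rho>. \<rho> \<in> Gal \<and> (\<forall>h. \<sigma> (coef h \<rho>) = coef h \<gamma>))"

definition star :: "('l \<Rightarrow> 'l) \<Rightarrow> ('l \<Rightarrow> 'l) \<Rightarrow> 'l \<Rightarrow> 'l" where
  "star \<gamma> \<delta> = \<gamma> \<circ> twist \<gamma> \<delta>"

lemma twist:
  assumes "\<sigma> \<in> Gal" "\<gamma> \<in> Gal"
  shows twist_gal: "twist \<sigma> \<gamma> \<in> Gal" and coef_twist: "\<sigma> (coef h (twist \<sigma> \<gamma>)) = coef h \<gamma>"
proof -
  have "\<exists>\<rho>. \<rho> \<in> Gal \<and> (\<forall>h. \<sigma> (coef h \<rho>) = coef h \<gamma>)"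
    by (rule gal_permutes_coef[OF assms]) blast
  from someI_ex[OF this] show "twist \<sigma> \<gamma> \<in> Gal" "\<sigma> (coef h (twist \<sigma> \<gamma>)) = coef h \<gamma>"
    by (simp_all add: twist_def)
qed

lemma twist_eqI:
  assumes "\<sigma> \<in> Gal" "\<gamma> \<in> Gal" "\<rho> \<in> Gal" "\<And>h. \<sigma> (coef h \<rho>) = coef h \<gamma>"
  shows "twist \<sigma> \<gamma> = \<rho>"
proof (rule coef_distinct[OF twist_gal[OF assms(1,2)] assms(3)])
  fix h
  have "\<sigma> (coef h (twist \<sigma> \<gamma>)) = \<sigma> (coef h \<rho>)" by (simp only: coef_twist[OF assms(1,2)] assms(4))
  then show "coef h (twist \<sigma> \<gamma>) = coef h \<rho>" using bij_is_inj[OF G.gal_bij[OF assms(1)]] by (simp add: inj_eq)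
qed

lemma twist_id: "\<gamma> \<in> Gal \<Longrightarrow> twist id \<gamma> = \<gamma>"
  by (rule twist_eqI) (simp_all add: G.id_gal)

text \<open>Contravariant, since \<open>twist \<sigma>\<close> inverts the permutation that belongs
  to \<open>\<sigma>\<close>.\<close>

lemma twist_comp:
  assumes "\<sigma> \<in> Gal" "\<tau> \<in> Gal" "\<gamma> \<in> Gal"
  shows "twist (\<sigma> \<circ> \<tau>) \<gamma> = twist \<tau> (twist \<sigma> \<gamma>)"
  by (rule twist_eqI) (simp_all add: assms G.gal_comp twist_gal coef_twist)

text \<open>The unit of \<open>H\<close> has the single nonzero coordinate 1 at \<open>id\<close>,
  and \<open>\<sigma>\<close> fixes 0 and 1.\<close>

lemma twist_fixes_id:
  assumes "\<sigma> \<in> Gal" shows "twist \<sigma> id = id"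
proof -
  note t = twist[OF assms G.id_gal]
  have "\<sigma> (coef 1 (twist \<sigma> id)) = 1" using t(2)[of 1] coef_one[OF G.id_gal] by simp
  then have "coef 1 (twist \<sigma> id) \<noteq> 0" using G.gal_zero[OF assms] by auto
  then show ?thesis using coef_one[OF t(1)] by (simp split: if_splits)
qed

lemma twist_inv:
  assumes "\<sigma> \<in> Gal" "\<gamma> \<in> Gal"
  shows "twist \<sigma> (twist (inv_into UNIV \<sigma>) \<gamma>) = \<gamma>" "twist (inv_into UNIV \<sigma>) (twist \<sigma> \<gamma>) = \<gamma>"
  using twist_comp[OF G.gal_inv[OF assms(1)] assms(1,2)] twist_comp[OF assms(1) G.gal_inv[OF assms(1)] assms(2)]
    G.gal_inv_apply[OF assms(1)] twist_id[OF assms(2)] by simp_all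

lemma twist_bij: "\<sigma> \<in> Gal \<Longrightarrow> bij_betw (twist \<sigma>) Gal Gal"
  by (rule bij_betw_byWitness[where f' = "twist (inv_into UNIV \<sigma>)"])
    (auto simp: twist_inv twist_gal G.gal_inv)

lemma sum_twist: "\<sigma> \<in> Gal \<Longrightarrow> (\<Sum>\<gamma>\<in>Gal. f (twist \<sigma> \<gamma>)) = (\<Sum>\<gamma>\<in>Gal. f \<gamma>)"
  by (rule sum.reindex_bij_betw[OF twist_bij])

lemma star_gal: "\<gamma> \<in> Gal \<Longrightarrow> \<delta> \<in> Gal \<Longrightarrow> star \<gamma> \<delta> \<in> Gal"
  by (simp add: star_def G.gal_comp twist_gal)

text \<open>To write \<open>\<gamma> (coef h \<delta> * \<delta> x)\<close> as a coefficient times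
  an automorphism, reindex \<open>\<delta>\<close> by \<open>twist \<gamma>\<close>: the coefficient
  becomes \<open>coef h \<delta>\<close> and the automorphism
  \<open>\<gamma> \<circ> twist \<gamma> \<delta>\<close>. This is the origin of the formula for
  \<open>star\<close>.\<close>

lemma coef_mult:
  assumes "\<rho> \<in> Gal"
  shows "coef (g * h) \<rho> = (\<Sum>\<gamma>\<in>Gal. \<Sum>\<delta>\<in>Gal. coef g \<gamma> * (coef h \<delta> * (if star \<gamma> \<delta> = \<rho> then 1 else 0)))"
proof (rule coef_unique[OF _ assms])
  let ?c = "\<lambda>\<gamma> \<delta> \<rho>. coef g \<gamma> * (coef h \<delta> * (if star \<gamma> \<delta> = \<rho> then 1 else 0))"
  fix x
  have "act (g * h) x = (\<Sum>\<gamma>\<in>Gal. coef g \<gamma> * \<gamma> (\<Sum>\<delta>\<in>Gal. coef h \<delta> * \<delta> x))"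
    by (simp only: act_mult_left act_eq[of g] act_eq[of h])
  also have "\<dots> = (\<Sum>\<gamma>\<in>Gal. \<Sum>\<delta>\<in>Gal. coef g \<gamma> * (coef h \<delta> * star \<gamma> \<delta> x))"
  proof (rule sum.cong[OF refl])
    fix \<gamma> assume \<gamma>: "\<gamma> \<in> Gal"
    have "\<gamma> (\<Sum>\<delta>\<in>Gal. coef h \<delta> * \<delta> x) = (\<Sum>\<delta>\<in>Gal. \<gamma> (coef h (twist \<gamma> \<delta>) * twist \<gamma> \<delta> x))"
      by (simp add: G.gal_sum[OF \<gamma>] sum_twist[OF \<gamma>, of "\<lambda>\<delta>. \<gamma> (coef h \<delta> * \<delta> x)"])
    also have "\<dots> = (\<Sum>\<delta>\<in>Gal. coef h \<delta> * star \<gamma> \<delta> x)"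
      by (intro sum.cong refl) (simp add: G.gal_mult[OF \<gamma>] coef_twist[OF \<gamma>] star_def)
    finally show "coef g \<gamma> * \<gamma> (\<Sum>\<delta>\<in>Gal. coef h \<delta> * \<delta> x) = (\<Sum>\<delta>\<in>Gal. coef g \<gamma> * (coef h \<delta> * star \<gamma> \<delta> x))"
      by (simp add: sum_distrib_left)
  qed
  also have "\<dots> = (\<Sum>\<gamma>\<in>Gal. \<Sum>\<delta>\<in>Gal. \<Sum>\<rho>\<in>Gal. ?c \<gamma> \<delta> \<rho> * \<rho> x)"
  proof (intro sum.cong refl)
    fix \<gamma> \<delta> assume "\<gamma> \<in> Gal" "\<delta> \<in> Gal"
    then have "star \<gamma> \<delta> \<in> Gal" by (rule star_gal)
    then show "coef g \<gamma> * (coef h \<delta> * star \<gamma> \<delta> x)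
        = (\<Sum>\<rho>\<in>Gal. ?c \<gamma> \<delta> \<rho> * \<rho> x)"
      using G.finite_gal by (simp add: if_distrib if_distribR cong: if_cong)
  qed
  also have "\<dots> = (\<Sum>\<gamma>\<in>Gal. \<Sum>\<rho>\<in>Gal. \<Sum>\<delta>\<in>Gal. ?c \<gamma> \<delta> \<rho> * \<rho> x)"
    by (intro sum.cong refl sum.swap)
  also have "\<dots> = (\<Sum>\<rho>\<in>Gal. \<Sum>\<gamma>\<in>Gal. \<Sum>\<delta>\<in>Gal. ?c \<gamma> \<delta> \<rho> * \<rho> x)"
    by (rule sum.swap)
  finally show "act (g * h) x
      = (\<Sum>\<rho>\<in>Gal. (\<Sum>\<gamma>\<in>Gal. \<Sum>\<delta>\<in>Gal. ?c \<gamma> \<delta> \<rho>) * \<rho> x)"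
    by (simp add: sum_distrib_right)
qed

text \<open>The Galois action on the first factor of \<open>L \<otimes> H\<close> respects
  multiplication, so it acts on the group-likes by automorphisms of \<open>star\<close>. In
  coordinates: apply \<open>\<sigma>\<close> to \<open>coef_mult\<close>, whose structure constants
  0 and 1 it fixes, and reindex both sums.\<close>

lemma twist_star:
  assumes \<sigma>: "\<sigma> \<in> Gal" and "\<alpha> \<in> Gal" "\<beta> \<in> Gal"
  shows "twist \<sigma> (star \<alpha> \<beta>) = star (twist \<sigma> \<alpha>) (twist \<sigma> \<beta>)"
proof -
  let ?\<rho> = "star \<alpha> \<beta>"
  have \<rho>: "?\<rho> \<in> Gal" by (rule star_gal[OF assms(2,3)])
  have "(if star \<alpha> \<beta> = ?\<rho> then 1 else 0::'l) = (if star (twist \<sigma> \<alpha>) (twist \<sigma> \<beta>) = twist \<sigma> ?\<rho> then 1 else 0)"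
  proof (rule coef_separating_eq2[OF _ assms(2,3), of "\<lambda>\<gamma> \<delta>. if star \<gamma> \<delta> = ?\<rho> then 1 else 0"
      "\<lambda>\<gamma> \<delta>. if star (twist \<sigma> \<gamma>) (twist \<sigma> \<delta>) = twist \<sigma> ?\<rho> then 1 else 0"])
    fix g h
    let ?F = "\<lambda>\<gamma> \<delta>. if star \<gamma> \<delta> = twist \<sigma> ?\<rho> then 1 else (0::'l)"
    have "(\<Sum>\<gamma>\<in>Gal. \<Sum>\<delta>\<in>Gal. coef g \<gamma> * (coef h \<delta> * (if star \<gamma> \<delta> = ?\<rho> then 1 else 0))) = coef (g * h) ?\<rho>"
      by (rule coef_mult[OF \<rho>, symmetric])
    also have "\<dots> = \<sigma> (coef (g * h) (twist \<sigma> ?\<rho>))" by (rule coef_twist[OF \<sigma> \<rho>, symmetric])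
    also have "\<dots> = (\<Sum>\<gamma>\<in>Gal. \<Sum>\<delta>\<in>Gal. \<sigma> (coef g \<gamma>) * (\<sigma> (coef h \<delta>) * ?F \<gamma> \<delta>))"
      unfolding coef_mult[OF twist_gal[OF \<sigma> \<rho>]] G.gal_sum[OF \<sigma>] G.gal_mult[OF \<sigma>]
      by (intro sum.cong refl arg_cong2[where f = "(*)"]) (simp add: G.gal_one[OF \<sigma>] G.gal_zero[OF \<sigma>])
    also have "\<dots> = (\<Sum>\<gamma>\<in>Gal. \<Sum>\<delta>\<in>Gal. \<sigma> (coef g (twist \<sigma> \<gamma>)) * (\<sigma> (coef h (twist \<sigma> \<delta>)) * ?F (twist \<sigma> \<gamma>) (twist \<sigma> \<delta>)))"
      by (simp only: sum_twist[OF \<sigma>, of "\<lambda>\<delta>. \<sigma> (coef g _) * (\<sigma> (coef h \<delta>) * ?F _ \<delta>)"]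
          sum_twist[OF \<sigma>, of "\<lambda>\<gamma>. \<Sum>\<delta>\<in>Gal. \<sigma> (coef g \<gamma>) * (\<sigma> (coef h \<delta>) * ?F \<gamma> \<delta>)"])
    also have "\<dots> = (\<Sum>\<gamma>\<in>Gal. \<Sum>\<delta>\<in>Gal. coef g \<gamma> * (coef h \<delta> * ?F (twist \<sigma> \<gamma>) (twist \<sigma> \<delta>)))"
      by (intro sum.cong refl) (simp only: coef_twist[OF \<sigma>])
    finally show "(\<Sum>\<gamma>\<in>Gal. \<Sum>\<delta>\<in>Gal. coef g \<gamma> * (coef h \<delta> * (if star \<gamma> \<delta> = ?\<rho> then 1 else 0)))
      = (\<Sum>\<gamma>\<in>Gal. \<Sum>\<delta>\<in>Gal. coef g \<gamma> * (coef h \<delta> * ?F (twist \<sigma> \<gamma>) (twist \<sigma> \<delta>)))" .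
  qed
  then show ?thesis by (simp split: if_splits)
qed

definition star_group :: "('l \<Rightarrow> 'l) monoid" where
  "star_group = \<lparr>carrier = Gal, mult = star, one = id\<rparr>"

lemma star_group_simps [simp]:
  "carrier star_group = Gal" "mult star_group = star" "\<one>\<^bsub>star_group\<^esub> = id"
  by (simp_all add: star_group_def)

text \<open>As \<open>twist \<alpha>\<close> respects \<open>star\<close> and \<open>twist\<close>
  is contravariant, associativity reduces to that of composition.\<close>

lemma star_assoc:
  assumes "\<alpha> \<in> Gal" "\<beta> \<in> Gal" "\<gamma> \<in> Gal"
  shows "star (star \<alpha> \<beta>) \<gamma> = star \<alpha> (star \<beta> \<gamma>)"
proof -
  have "star \<alpha> (star \<beta> \<gamma>) = \<alpha> \<circ> star (twist \<alpha> \<beta>) (twist \<alpha> \<gamma>)"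
    using twist_star[OF assms] by (simp add: star_def[of \<alpha>])
  also have "\<dots> = \<alpha> \<circ> twist \<alpha> \<beta> \<circ> twist (\<alpha> \<circ> twist \<alpha> \<beta>) \<gamma>"
    using twist_comp[of \<alpha> "twist \<alpha> \<beta>" \<gamma>] assms twist_gal by (simp add: star_def[of "twist \<alpha> \<beta>"] o_assoc)
  finally show ?thesis by (simp add: star_def)
qed

lemma star_id: "\<gamma> \<in> Gal \<Longrightarrow> star id \<gamma> = \<gamma>" "\<gamma> \<in> Gal \<Longrightarrow> star \<gamma> id = \<gamma>"
  by (simp_all add: star_def twist_id twist_fixes_id)

lemma star_solve:
  assumes "\<gamma> \<in> Gal" "\<delta> \<in> Gal"
  shows "star \<gamma> (twist (inv_into UNIV \<gamma>) (inv_into UNIV \<gamma> \<circ> \<delta>)) = \<delta>"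
proof -
  have "inv_into UNIV \<gamma> \<circ> \<delta> \<in> Gal" by (intro G.gal_comp G.gal_inv assms)
  then show ?thesis
    using G.gal_inv_apply(1)[OF assms(1)] by (simp add: star_def twist_inv[OF assms(1)] o_assoc)
qed

lemma group_star: "group star_group"
proof (rule groupI)
  have right: "\<exists>\<delta>\<in>Gal. star \<gamma> \<delta> = id" if "\<gamma> \<in> Gal" for \<gamma>
    using star_solve[OF that G.id_gal] twist_gal G.gal_comp G.gal_inv that G.id_gal by metis
  fix \<gamma> assume "\<gamma> \<in> carrier star_group"
  then have \<gamma>: "\<gamma> \<in> Gal" by simp
  obtain \<delta> where \<delta>: "\<delta> \<in> Gal" "star \<gamma> \<delta> = id" using right[OF \<gamma>] by auto
  obtain \<epsilon> where \<epsilon>: "\<epsilon> \<in> Gal" "star \<delta> \<epsilon> = id" using right[OF \<delta>(1)] by auto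
  have "\<epsilon> = star (star \<gamma> \<delta>) \<epsilon>" by (simp add: \<delta>(2) star_id \<epsilon>(1))
  also have "\<dots> = \<gamma>" by (simp add: star_assoc[OF \<gamma> \<delta>(1) \<epsilon>(1)] \<epsilon>(2) star_id \<gamma>)
  finally show "\<exists>\<delta>\<in>carrier star_group. \<delta> \<otimes>\<^bsub>star_group\<^esub> \<gamma> = \<one>\<^bsub>star_group\<^esub>" using \<delta>(1) \<epsilon>(2) by auto
qed (simp_all add: star_gal star_assoc star_id G.id_gal)

sublocale star: group star_group
  by (rule group_star)

lemma star_inv_gal: "\<gamma> \<in> Gal \<Longrightarrow> inv\<^bsub>star_group\<^esub> \<gamma> \<in> Gal"
  using star.inv_closed by simp

lemma star_inv: "\<gamma> \<in> Gal \<Longrightarrow> star \<gamma> (inv\<^bsub>star_group\<^esub> \<gamma>) = id" "\<gamma> \<in> Gal \<Longrightarrow> star (inv\<^bsub>star_group\<^esub> \<gamma>) \<gamma> = id"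
  using star.r_inv[of \<gamma>] star.l_inv[of \<gamma>] by simp_all

section \<open>The Greither--Pareigis subgroup\<close>

definition rtrans :: "('l \<Rightarrow> 'l) \<Rightarrow> ('l \<Rightarrow> 'l) \<Rightarrow> 'l \<Rightarrow> 'l" where
  "rtrans \<gamma> = (\<lambda>\<delta>\<in>Gal. star \<delta> \<gamma>)"

abbreviation Perm :: "(('l \<Rightarrow> 'l) \<Rightarrow> ('l \<Rightarrow> 'l)) monoid" where
  "Perm \<equiv> BijGroup Gal"

definition NN :: "(('l \<Rightarrow> 'l) \<Rightarrow> ('l \<Rightarrow> 'l)) set" where
  "NN = rtrans ` Gal"

lemma rtrans_apply: "\<delta> \<in> Gal \<Longrightarrow> rtrans \<gamma> \<delta> = star \<delta> \<gamma>"
  by (simp add: rtrans_def)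

lemma rtrans_Bij: "\<gamma> \<in> Gal \<Longrightarrow> rtrans \<gamma> \<in> Bij Gal"
proof -
  assume \<gamma>: "\<gamma> \<in> Gal"
  have "bij_betw (\<lambda>\<delta>. star \<delta> \<gamma>) Gal Gal"
    by (rule bij_betw_byWitness[where f' = "\<lambda>\<delta>. star \<delta> (inv\<^bsub>star_group\<^esub> \<gamma>)"])
      (use \<gamma> in \<open>auto simp: star_assoc star_inv star_inv_gal star_id star_gal\<close>)
  then show ?thesis by (simp add: Bij_def rtrans_def bij_betw_restrict_eq)
qed

lemma rtrans_mult:
  assumes "\<gamma> \<in> Gal" "\<delta> \<in> Gal"
  shows "rtrans \<gamma> \<otimes>\<^bsub>Perm\<^esub> rtrans \<delta> = rtrans (star \<delta> \<gamma>)"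
  unfolding BijGroup_mult[OF rtrans_Bij[OF assms(1)] rtrans_Bij[OF assms(2)]]
  using assms by (simp add: compose_def rtrans_def star_gal star_assoc cong: restrict_cong)

lemma rtrans_id: "rtrans id = \<one>\<^bsub>Perm\<^esub>"
  by (simp add: rtrans_def BijGroup_one star_id cong: restrict_cong)

lemma subgroup_NN: "subgroup NN Perm"
proof -
  interpret P: group Perm by (rule group_BijGroup)
  show ?thesis
  proof (rule P.subgroupI)
    show "NN \<subseteq> carrier Perm" by (auto simp: NN_def BijGroup_carrier rtrans_Bij)
    show "NN \<noteq> {}" using G.id_gal by (auto simp: NN_def)
    show "\<eta> \<otimes>\<^bsub>Perm\<^esub> \<theta> \<in> NN" if "\<eta> \<in> NN" "\<theta> \<in> NN" for \<eta> \<theta>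
      using that by (auto simp: NN_def rtrans_mult star_gal)
    show "inv\<^bsub>Perm\<^esub> \<eta> \<in> NN" if \<eta>: "\<eta> \<in> NN" for \<eta>
    proof -
      obtain \<gamma> where \<gamma>: "\<gamma> \<in> Gal" "\<eta> = rtrans \<gamma>" using \<eta> by (auto simp: NN_def)
      have "inv\<^bsub>Perm\<^esub> \<eta> = rtrans (inv\<^bsub>star_group\<^esub> \<gamma>)"
        by (rule P.inv_equality)
          (simp_all add: \<gamma> rtrans_mult star_inv_gal star_inv rtrans_id BijGroup_carrier rtrans_Bij)
      then show ?thesis using \<gamma> by (simp add: NN_def star_inv_gal)
    qed
  qed
qed

text \<open>Normalisation is what calls for right translations:
  \<open>\<sigma> \<circ> star \<delta> \<gamma>\<close> is
  \<open>star (\<sigma> \<circ> \<delta>) \<gamma>'\<close> with a \<open>\<gamma>'\<close> that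
  does not depend on \<open>\<delta>\<close>.\<close>

lemma conj_rtrans:
  assumes \<sigma>: "\<sigma> \<in> Gal" and \<gamma>: "\<gamma> \<in> Gal"
  shows "conj_transl (gal_group sL) \<sigma> (rtrans \<gamma>) = rtrans (twist (inv_into UNIV \<sigma>) \<gamma>)"
proof -
  interpret gal: group "gal_group sL" by (rule G.group_gal)
  let ?\<gamma>' = "twist (inv_into UNIV \<sigma>) \<gamma>"
  have \<gamma>': "?\<gamma>' \<in> Gal" by (intro twist_gal G.gal_inv \<sigma> \<gamma>)
  show ?thesis
  proof (rule extensionalityI[of _ Gal])
    show "conj_transl (gal_group sL) \<sigma> (rtrans \<gamma>) \<in> extensional Gal"
      by (rule Bij_imp_extensional[OF gal.conj_transl_Bij[OF \<sigma> rtrans_Bij[OF \<gamma>]]])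
    show "rtrans ?\<gamma>' \<in> extensional Gal" by (rule Bij_imp_extensional[OF rtrans_Bij[OF \<gamma>']])
    fix \<rho> assume \<rho>: "\<rho> \<in> Gal"
    define \<delta> where "\<delta> = inv_into UNIV \<sigma> \<circ> \<rho>"
    have \<delta>: "\<delta> \<in> Gal" "\<rho> = \<sigma> \<circ> \<delta>"
      using G.gal_inv_apply(1)[OF \<sigma>] by (simp_all add: \<delta>_def G.gal_comp G.gal_inv \<sigma> \<rho> o_assoc)
    have "conj_transl (gal_group sL) \<sigma> (rtrans \<gamma>) \<rho> = \<sigma> \<circ> star \<delta> \<gamma>"
      using gal.conj_transl_apply[OF \<sigma> rtrans_Bij[OF \<gamma>] \<delta>(1)] \<delta> by (simp add: G.gal_mult_eq rtrans_apply)
    also have "\<dots> = \<sigma> \<circ> \<delta> \<circ> twist \<delta> (twist \<sigma> ?\<gamma>')"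
      by (simp add: star_def twist_inv[OF \<sigma> \<gamma>] o_assoc)
    also have "\<dots> = star \<rho> ?\<gamma>'"
      using twist_comp[OF \<sigma> \<delta>(1) \<gamma>'] \<delta>(2) by (simp add: star_def)
    finally show "conj_transl (gal_group sL) \<sigma> (rtrans \<gamma>) \<rho> = rtrans ?\<gamma>' \<rho>"
      by (simp add: rtrans_apply[OF \<rho>])
  qed
qed

lemma regular_NN: "regular_normalized (gal_group sL) NN"
  unfolding regular_normalized_def
proof (intro conjI ballI subgroup_NN)
  fix \<delta> \<delta>' assume \<delta>: "\<delta> \<in> Gal" "\<delta>' \<in> Gal"
  let ?\<gamma> = "star (inv\<^bsub>star_group\<^esub> \<delta>) \<delta>'"
  have \<gamma>: "?\<gamma> \<in> Gal" by (intro star_gal star_inv_gal \<delta>)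
  show "\<exists>!\<eta>. \<eta> \<in> NN \<and> \<eta> \<delta> = \<delta>'"
  proof (rule ex1I[of _ "rtrans ?\<gamma>"])
    have "rtrans ?\<gamma> \<delta> = \<delta>'"
      using \<delta> by (simp add: rtrans_apply star_assoc[symmetric] star_inv_gal star_inv star_id)
    then show "rtrans ?\<gamma> \<in> NN \<and> rtrans ?\<gamma> \<delta> = \<delta>'" using \<gamma> by (simp add: NN_def)
  next
    fix \<eta> assume "\<eta> \<in> NN \<and> \<eta> \<delta> = \<delta>'"
    then obtain \<gamma> where g: "\<gamma> \<in> Gal" "\<eta> = rtrans \<gamma>" "star \<delta> \<gamma> = \<delta>'"
      using \<delta> by (auto simp: NN_def rtrans_apply)
    have "star (inv\<^bsub>star_group\<^esub> \<delta>) (star \<delta> \<gamma>) = \<gamma>"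
      using \<delta>(1) g(1) by (simp add: star_assoc[symmetric] star_inv_gal star_inv star_id)
    then show "\<eta> = rtrans ?\<gamma>" unfolding g(2,3) by simp
  qed
next
  fix \<sigma> \<eta> assume "\<sigma> \<in> Gal" "\<eta> \<in> NN"
  then show "conj_transl (gal_group sL) \<sigma> \<eta> \<in> NN"
    by (auto simp: NN_def conj_rtrans twist_gal G.gal_inv)
qed

text \<open>The Greither--Pareigis convention \<open>\<eta>\<^sup>-\<^sup>1(1\<^sub>\<Gamma>) = \<gamma>\<close> for the element \<open>\<eta>\<close> acting through \<open>\<gamma>\<close>.\<close>

definition eta :: "('l \<Rightarrow> 'l) \<Rightarrow> ('l \<Rightarrow> 'l) \<Rightarrow> 'l \<Rightarrow> 'l" where
  "eta \<gamma> = inv\<^bsub>Perm\<^esub> (rtrans \<gamma>)"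

lemma inv_eta: "\<gamma> \<in> Gal \<Longrightarrow> inv\<^bsub>Perm\<^esub> (eta \<gamma>) = rtrans \<gamma>"
  using group.inv_inv[OF group_BijGroup, of "rtrans \<gamma>" Gal] by (simp add: eta_def BijGroup_carrier rtrans_Bij)

lemma inv_eta_id: "\<gamma> \<in> Gal \<Longrightarrow> (inv\<^bsub>Perm\<^esub> (eta \<gamma>)) id = \<gamma>"
  by (simp add: inv_eta rtrans_apply G.id_gal star_id)

lemma eta_inj: "inj_on eta Gal"
  by (rule inj_onI) (metis inv_eta_id)

lemma eta_eq_iff: "\<gamma> \<in> Gal \<Longrightarrow> \<delta> \<in> Gal \<Longrightarrow> eta \<gamma> = eta \<delta> \<longleftrightarrow> \<gamma> = \<delta>"
  using eta_inj by (auto simp: inj_on_def)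

lemma NN_eq_eta: "NN = eta ` Gal"
proof -
  interpret P: group Perm by (rule group_BijGroup)
  have NNc: "\<eta> \<in> carrier Perm" if "\<eta> \<in> NN" for \<eta> by (rule subgroup.mem_carrier[OF subgroup_NN that])
  show ?thesis
  proof (intro subset_antisym subsetI)
    fix \<eta> assume \<eta>: "\<eta> \<in> NN"
    then have "inv\<^bsub>Perm\<^esub> \<eta> \<in> NN" by (rule subgroup.m_inv_closed[OF subgroup_NN])
    then obtain \<gamma> where "\<gamma> \<in> Gal" "inv\<^bsub>Perm\<^esub> \<eta> = rtrans \<gamma>" by (auto simp: NN_def)
    then show "\<eta> \<in> eta ` Gal" using P.inv_inv[OF NNc[OF \<eta>]] by (auto simp: eta_def intro!: image_eqI[of _ _ \<gamma>])
  next
    fix \<eta> assume "\<eta> \<in> eta ` Gal"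
    then show "\<eta> \<in> NN" using subgroup.m_inv_closed[OF subgroup_NN] by (auto simp: eta_def NN_def)
  qed
qed

text \<open>Inversion makes up for \<open>rtrans\<close> being an antihomomorphism.\<close>

lemma eta_mult:
  assumes "\<gamma> \<in> Gal" "\<delta> \<in> Gal"
  shows "eta \<gamma> \<otimes>\<^bsub>Perm\<^esub> eta \<delta> = eta (star \<gamma> \<delta>)"
  using group.inv_mult_group[OF group_BijGroup, of "rtrans \<delta>" Gal "rtrans \<gamma>"] assms
  by (simp add: eta_def BijGroup_carrier rtrans_Bij rtrans_mult)

lemma eta_id: "eta id = \<one>\<^bsub>Perm\<^esub>"
proof -
  interpret P: group Perm by (rule group_BijGroup)
  show ?thesis by (simp add: eta_def rtrans_id)
qed

lemma conj_eta:
  assumes \<sigma>: "\<sigma> \<in> Gal" and \<gamma>: "\<gamma> \<in> Gal"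
  shows "conj_transl (gal_group sL) \<sigma> (eta \<gamma>) = eta (twist (inv_into UNIV \<sigma>) \<gamma>)"
proof -
  interpret P: group Perm by (rule group_BijGroup)
  interpret gal: group "gal_group sL" by (rule G.group_gal)
  have "rtrans \<gamma> \<in> carrier Perm" "left_transl (gal_group sL) \<sigma> \<in> carrier Perm"
    using rtrans_Bij[OF \<gamma>] gal.left_transl_Bij[OF \<sigma>] by (simp_all add: BijGroup_carrier)
  then have "conj_transl (gal_group sL) \<sigma> (eta \<gamma>) = inv\<^bsub>Perm\<^esub> (conj_transl (gal_group sL) \<sigma> (rtrans \<gamma>))"
    by (simp add: conj_transl_def eta_def P.inv_mult_group P.m_assoc)
  then show ?thesis by (simp add: conj_rtrans[OF \<sigma> \<gamma>] eta_def)
qed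

section \<open>The isomorphism onto the descended algebra\<close>

definition phi :: "'h \<Rightarrow> ((('l \<Rightarrow> 'l) \<Rightarrow> ('l \<Rightarrow> 'l)) \<Rightarrow>\<^sub>0 'l)" where
  "phi h = (\<Sum>\<gamma>\<in>Gal. Poly_Mapping.single (eta \<gamma>) (coef h \<gamma>))"

lemma lookup_phi: "\<gamma> \<in> Gal \<Longrightarrow> Poly_Mapping.lookup (phi h) (eta \<gamma>) = coef h \<gamma>"
  using G.finite_gal by (simp add: phi_def lookup_sum lookup_single when_def eta_eq_iff cong: if_cong)

lemma keys_phi: "Poly_Mapping.keys (phi h) \<subseteq> NN"
  unfolding phi_def by (rule keys_sum_subset) (auto simp: NN_eq_eta)

lemma lookup_group_algebra_gal:
  assumes \<sigma>: "\<sigma> \<in> Gal" and s: "Poly_Mapping.keys s \<subseteq> NN" and \<gamma>: "\<gamma> \<in> Gal"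
  shows "Poly_Mapping.lookup (group_algebra_gal sL \<sigma> s) (eta (twist (inv_into UNIV \<sigma>) \<gamma>))
    = \<sigma> (Poly_Mapping.lookup s (eta \<gamma>))"
proof -
  let ?i = "inv_into UNIV \<sigma>"
  have finN: "finite NN" using G.finite_gal by (simp add: NN_def)
  have "group_algebra_gal sL \<sigma> s
      = (\<Sum>\<eta>\<in>NN. Poly_Mapping.single (conj_transl (gal_group sL) \<sigma> \<eta>) (\<sigma> (Poly_Mapping.lookup s \<eta>)))"
    unfolding group_algebra_gal_def
    by (rule sum.mono_neutral_left[OF finN s]) (simp add: in_keys_iff G.gal_zero[OF \<sigma>])
  also have "\<dots> = (\<Sum>\<delta>\<in>Gal. Poly_Mapping.single (eta (twist (?i) \<delta>)) (\<sigma> (Poly_Mapping.lookup s (eta \<delta>))))"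
    unfolding NN_eq_eta by (subst sum.reindex[OF eta_inj]) (simp add: conj_eta[OF \<sigma>])
  finally have eq: "group_algebra_gal sL \<sigma> s = \<dots>" .
  have tw: "eta (twist (?i) \<delta>) = eta (twist (?i) \<gamma>) \<longleftrightarrow> \<delta> = \<gamma>" if "\<delta> \<in> Gal" for \<delta>
    using eta_eq_iff twist_gal G.gal_inv[OF \<sigma>] that \<gamma> twist_bij[OF G.gal_inv[OF \<sigma>]]
    by (auto simp: bij_betw_def inj_on_def)
  show ?thesis
    unfolding eq using G.finite_gal \<gamma>
    by (simp add: lookup_sum lookup_single when_def tw cong: if_cong)
qed

text \<open>The element \<open>1 \<otimes> h\<close> is Galois-invariant; \<open>coef_twist\<close>
  for the inverse of \<open>\<sigma>\<close> says so in coordinates. Off \<open>NN\<close> both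
  sides vanish.\<close>

lemma group_algebra_gal_phi:
  assumes \<sigma>: "\<sigma> \<in> Gal"
  shows "group_algebra_gal sL \<sigma> (phi h) = phi h"
proof (rule poly_mapping_eqI)
  fix \<eta>
  let ?i = "inv_into UNIV \<sigma>"
  have i: "?i \<in> Gal" by (rule G.gal_inv[OF \<sigma>])
  show "Poly_Mapping.lookup (group_algebra_gal sL \<sigma> (phi h)) \<eta> = Poly_Mapping.lookup (phi h) \<eta>"
  proof (cases "\<eta> \<in> NN")
    case True
    then obtain \<delta> where \<delta>: "\<delta> \<in> Gal" "\<eta> = eta \<delta>" by (auto simp: NN_eq_eta)
    define \<gamma> where "\<gamma> = twist \<sigma> \<delta>"
    have \<gamma>: "\<gamma> \<in> Gal" "\<eta> = eta (twist ?i \<gamma>)" using \<delta> \<sigma> by (simp_all add: \<gamma>_def twist_gal twist_inv)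
    have "?i (coef h (twist ?i \<gamma>)) = coef h \<gamma>" by (rule coef_twist[OF i \<gamma>(1)])
    then have "\<sigma> (?i (coef h (twist ?i \<gamma>))) = \<sigma> (coef h \<gamma>)" by (rule arg_cong)
    then have "coef h (twist ?i \<gamma>) = \<sigma> (coef h \<gamma>)"
      using G.gal_inv_apply(1)[OF \<sigma>] by (simp add: fun_eq_iff)
    then show ?thesis
      using lookup_group_algebra_gal[OF \<sigma> keys_phi \<gamma>(1)] \<gamma> lookup_phi[OF twist_gal[OF i \<gamma>(1)]] lookup_phi[OF \<gamma>(1)]
      by simp
  next
    case False
    have "Poly_Mapping.keys (group_algebra_gal sL \<sigma> (phi h)) \<subseteq> NN"
      unfolding group_algebra_gal_def
    proof (rule keys_sum_subset)
      fix \<theta> assume "\<theta> \<in> Poly_Mapping.keys (phi h)"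
      then have "\<theta> \<in> NN" by (rule subsetD[OF keys_phi])
      then have "conj_transl (gal_group sL) \<sigma> \<theta> \<in> NN"
        using regular_NN \<sigma> by (simp add: regular_normalized_def)
      then show "Poly_Mapping.keys (Poly_Mapping.single (conj_transl (gal_group sL) \<sigma> \<theta>)
          (\<sigma> (Poly_Mapping.lookup (phi h) \<theta>))) \<subseteq> NN" by simp
    qed
    then have "\<eta> \<notin> Poly_Mapping.keys (group_algebra_gal sL \<sigma> (phi h))" "\<eta> \<notin> Poly_Mapping.keys (phi h)"
      using False keys_phi[of h] by auto
    then show ?thesis by (simp add: in_keys_iff)
  qed
qed

lemma phi_eq_iff: "phi g = phi h \<longleftrightarrow> g = h"
proof
  assume eq: "phi g = phi h"
  show "g = h"
  proof (rule coef_inject)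
    fix \<gamma> assume "\<gamma> \<in> Gal"
    from lookup_phi[OF this] show "coef g \<gamma> = coef h \<gamma>" using eq by metis
  qed
qed simp

text \<open>Explicit Galois descent: by the condition on \<open>c\<close>, the tensor
  \<open>t\<close> represents an invariant element of \<open>L \<otimes> H\<close>. Contracting its
  first factors with \<open>x \<mapsto> tr (u * x)\<close> gives an element of \<open>H\<close> with
  coordinate \<open>(\<Sum>\<sigma>\<in>Gal. \<sigma> u * c \<gamma>)\<close>, and \<open>u\<close>
  has trace 1.\<close>

lemma descent:
  assumes u: "(\<Sum>\<gamma>\<in>Gal. \<gamma> u) = 1"
    and t: "\<And>\<gamma>. \<gamma> \<in> Gal \<Longrightarrow> lin_ext sL (\<lambda>(x, h). x * coef h \<gamma>) t = c \<gamma>"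
    and c: "\<And>\<sigma> \<gamma>. \<sigma> \<in> Gal \<Longrightarrow> \<gamma> \<in> Gal \<Longrightarrow> \<sigma> (c (twist \<sigma> \<gamma>)) = c \<gamma>"
    and \<gamma>: "\<gamma> \<in> Gal"
  shows "coef (lin_ext sH (\<lambda>(x, h). sH (G.tr (u * x)) h) t) \<gamma> = c \<gamma>"
proof -
  have "coef (lin_ext sH (\<lambda>(x, h). sH (G.tr (u * x)) h) t) \<gamma>
      = lin_ext sL (\<lambda>p. sL (G.tr (u * fst p)) (coef (snd p) \<gamma>)) t"
    unfolding linear_apply_lin_ext[OF coef_linear[OF \<gamma>]] by (simp add: case_prod_unfold coef_scale[OF \<gamma>])
  also have "\<dots> = lin_ext sL (\<lambda>p. \<Sum>\<sigma>\<in>Gal. \<sigma> u * (\<sigma> (fst p) * coef (snd p) \<gamma>)) t"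
    by (subst G.scale_eq_mult) (simp add: G.tr G.gal_mult sum_distrib_right mult.assoc)
  also have "\<dots> = (\<Sum>\<sigma>\<in>Gal. \<sigma> u * lin_ext sL (\<lambda>p. \<sigma> (fst p) * coef (snd p) \<gamma>) t)"
    unfolding G.lin_ext_sum_fun
    by (simp add: lin_ext_def sum_distrib_left G.scale_mult_right)
  also have "\<dots> = (\<Sum>\<sigma>\<in>Gal. \<sigma> u * c \<gamma>)"
  proof (intro sum.cong refl)
    fix \<sigma> assume \<sigma>: "\<sigma> \<in> Gal"
    have "c \<gamma> = \<sigma> (c (twist \<sigma> \<gamma>))" by (rule c[OF \<sigma> \<gamma>, symmetric])
    also have "\<dots> = \<sigma> (lin_ext sL (\<lambda>(x, h). x * coef h (twist \<sigma> \<gamma>)) t)"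
      by (simp only: t[OF twist_gal[OF \<sigma> \<gamma>]])
    also have "\<dots> = lin_ext sL (\<lambda>p. \<sigma> (fst p) * coef (snd p) \<gamma>) t"
      by (simp add: linear_apply_lin_ext[OF G.gal_linear[OF \<sigma>]] case_prod_unfold G.gal_mult[OF \<sigma>] coef_twist[OF \<sigma> \<gamma>])
    finally show "\<sigma> u * lin_ext sL (\<lambda>p. \<sigma> (fst p) * coef (snd p) \<gamma>) t = \<sigma> u * c \<gamma>" by simp
  qed
  also have "\<dots> = c \<gamma>" by (simp add: sum_distrib_right[symmetric] u)
  finally show ?thesis .
qed

lemma phi_bij: "bij_betw phi UNIV (descended_algebra sL NN)"
  unfolding bij_betw_def
proof (intro conjI subset_antisym subsetI)
  show "inj phi" by (simp add: inj_def phi_eq_iff)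
next
  fix s assume "s \<in> range phi"
  then show "s \<in> descended_algebra sL NN"
    using keys_phi group_algebra_gal_phi by (auto simp: descended_algebra_def)
next
  fix s assume "s \<in> descended_algebra sL NN"
  then have s: "Poly_Mapping.keys s \<subseteq> NN" "\<And>\<sigma>. \<sigma> \<in> Gal \<Longrightarrow> group_algebra_gal sL \<sigma> s = s"
    by (auto simp: descended_algebra_def)
  define c where "c \<gamma> = Poly_Mapping.lookup s (eta \<gamma>)" for \<gamma>
  \<comment> \<open>Invariance under \<open>group_algebra_gal\<close>, reindexed by
    \<open>twist\<close>, is the hypothesis of \<open>descent\<close>.\<close>
  have c: "\<sigma> (c (twist \<sigma> \<gamma>)) = c \<gamma>" if \<sigma>: "\<sigma> \<in> Gal" and \<gamma>: "\<gamma> \<in> Gal" for \<sigma> \<gamma>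
    using lookup_group_algebra_gal[OF \<sigma> s(1) twist_gal[OF \<sigma> \<gamma>]] by (simp add: s(2)[OF \<sigma>] twist_inv[OF \<sigma> \<gamma>] c_def)
  obtain u where u: "(\<Sum>\<gamma>\<in>Gal. \<gamma> u) = 1" by (rule G.trace_one_exists)
  obtain t where t: "\<And>\<gamma>. \<gamma> \<in> Gal \<Longrightarrow> lin_ext sL (\<lambda>(x, h). x * coef h \<gamma>) t = c \<gamma>"
    by (rule coef_surj[of c]) blast
  let ?h = "lin_ext sH (\<lambda>(x, h). sH (G.tr (u * x)) h) t"
  have "phi ?h = (\<Sum>\<gamma>\<in>Gal. Poly_Mapping.single (eta \<gamma>) (Poly_Mapping.lookup s (eta \<gamma>)))"
    unfolding phi_def
  proof (intro sum.cong refl arg_cong[where f = "Poly_Mapping.single _"])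
    fix \<gamma> assume "\<gamma> \<in> Gal"
    then show "coef ?h \<gamma> = Poly_Mapping.lookup s (eta \<gamma>)"
      unfolding c_def[symmetric] by (intro descent[where c = c, OF u]) (rule t c; assumption)+
  qed
  also have "\<dots> = (\<Sum>\<eta>\<in>NN. Poly_Mapping.single \<eta> (Poly_Mapping.lookup s \<eta>))"
    unfolding NN_eq_eta by (simp add: sum.reindex[OF eta_inj])
  also have "\<dots> = s" by (rule sum_lookup_single[OF s(1)]) (simp add: NN_def G.finite_gal)
  finally show "s \<in> range phi" by (metis rangeI)
qed

lemma lin_ext_phi:
  assumes "vector_space s"
  shows "lin_ext s F (phi h) = (\<Sum>\<gamma>\<in>Gal. s (coef h \<gamma>) (F (eta \<gamma>)))"
proof -
  interpret V: vector_space s by fact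
  show ?thesis unfolding phi_def by (simp add: V.lin_ext_sum V.lin_ext_single)
qed

lemma phi_linear: "Vector_Spaces.linear sH (\<lambda>c. free_scale (sL c 1)) phi"
proof -
  have vs: "vector_space (\<lambda>c. free_scale (sL c 1) :: (('x \<Rightarrow>\<^sub>0 'l) \<Rightarrow> ('x \<Rightarrow>\<^sub>0 'l)))"
  proof -
    have "sL (a * b) 1 = sL a 1 * sL b 1" for a b using G.scale_eq_mult[of a "sL b 1"] by simp
    then show ?thesis
      by unfold_locales
        (auto intro!: poly_mapping_eqI simp: lookup_free_scale lookup_add algebra_simps G.scale_left_distrib)
  qed
  have add: "phi (g + h) = phi g + phi h" for g h
    unfolding phi_def sum.distrib[symmetric]
    by (intro sum.cong refl) (simp add: coef_add single_add)
  have scale: "phi (sH c h) = free_scale (sL c 1) (phi h)" for c h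
  proof -
    interpret F: vector_space "free_scale :: 'l \<Rightarrow> ((('l \<Rightarrow> 'l) \<Rightarrow> ('l \<Rightarrow> 'l)) \<Rightarrow>\<^sub>0 'l) \<Rightarrow> _" by (rule vector_space_free_scale)
    show ?thesis
      unfolding phi_def F.scale_sum_right
      by (intro sum.cong refl) (simp add: coef_scale free_scale_single G.scale_eq_mult[of c "coef h _"])
  qed
  show ?thesis by (simp add: Vector_Spaces.linear_iff vector_space_axioms vs add scale)
qed

lemma phi_one: "phi 1 = basis_vec \<one>\<^bsub>Perm\<^esub>"
proof -
  have "phi 1 = (\<Sum>\<gamma>\<in>Gal. if \<gamma> = id then basis_vec (eta id) else 0)"
    unfolding phi_def by (intro sum.cong refl) (simp add: coef_one)
  also have "\<dots> = basis_vec (eta id)" using G.finite_gal G.id_gal by (simp cong: if_cong)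
  finally show ?thesis by (simp add: eta_id)
qed

lemma phi_mult: "phi (g * h) = group_algebra_mult Perm (phi g) (phi h)"
proof -
  let ?c = "\<lambda>\<gamma> \<delta> \<rho>. Poly_Mapping.single (eta \<rho>) (coef g \<gamma> * (coef h \<delta> * (if star \<gamma> \<delta> = \<rho> then 1 else 0)))"
  interpret F: vector_space "free_scale :: 'l \<Rightarrow> ((('l \<Rightarrow> 'l) \<Rightarrow> ('l \<Rightarrow> 'l)) \<Rightarrow>\<^sub>0 'l) \<Rightarrow> _" by (rule vector_space_free_scale)
  have "group_algebra_mult Perm (phi g) (phi h)
      = (\<Sum>\<gamma>\<in>Gal. \<Sum>\<delta>\<in>Gal. Poly_Mapping.single (eta \<gamma> \<otimes>\<^bsub>Perm\<^esub> eta \<delta>) (coef g \<gamma> * coef h \<delta>))"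
    unfolding group_algebra_mult_def
    by (simp only: lin_ext_phi[OF vector_space_free_scale] F.scale_sum_right free_scale_single mult_1_right)
  also have "\<dots> = (\<Sum>\<gamma>\<in>Gal. \<Sum>\<delta>\<in>Gal. \<Sum>\<rho>\<in>Gal. ?c \<gamma> \<delta> \<rho>)"
  proof (intro sum.cong refl)
    fix \<gamma> \<delta> assume gd: "\<gamma> \<in> Gal" "\<delta> \<in> Gal"
    have "(\<Sum>\<rho>\<in>Gal. ?c \<gamma> \<delta> \<rho>)
        = (\<Sum>\<rho>\<in>Gal. if star \<gamma> \<delta> = \<rho> then Poly_Mapping.single (eta (star \<gamma> \<delta>)) (coef g \<gamma> * coef h \<delta>) else 0)"
      by (intro sum.cong refl) simp
    also have "\<dots> = Poly_Mapping.single (eta (star \<gamma> \<delta>)) (coef g \<gamma> * coef h \<delta>)"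
      using G.finite_gal star_gal[OF gd] by simp
    finally show "Poly_Mapping.single (eta \<gamma> \<otimes>\<^bsub>Perm\<^esub> eta \<delta>) (coef g \<gamma> * coef h \<delta>)
        = (\<Sum>\<rho>\<in>Gal. ?c \<gamma> \<delta> \<rho>)"
      by (simp only: eta_mult[OF gd])
  qed
  also have "\<dots> = (\<Sum>\<gamma>\<in>Gal. \<Sum>\<rho>\<in>Gal. \<Sum>\<delta>\<in>Gal. ?c \<gamma> \<delta> \<rho>)"
    by (intro sum.cong refl sum.swap)
  also have "\<dots> = (\<Sum>\<rho>\<in>Gal. \<Sum>\<gamma>\<in>Gal. \<Sum>\<delta>\<in>Gal. ?c \<gamma> \<delta> \<rho>)"
    by (rule sum.swap)
  also have "\<dots> = phi (g * h)"
  proof -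
    have single_sum: "(\<Sum>i\<in>A. Poly_Mapping.single k (f i)) = Poly_Mapping.single k (sum f A)"
      for k :: "('l \<Rightarrow> 'l) \<Rightarrow> ('l \<Rightarrow> 'l)" and f :: "('l \<Rightarrow> 'l) \<Rightarrow> 'l" and A
      by (induction A rule: infinite_finite_induct) (simp_all add: single_add)
    show ?thesis unfolding phi_def
      by (intro sum.cong refl) (simp only: coef_mult single_sum)
  qed
  finally show ?thesis by simp
qed

lemma phi_counit: "group_algebra_counit (phi h) = sL (\<epsilon> h) 1"
  by (simp add: group_algebra_counit_def lin_ext_phi[OF vector_space_mult] counit_eq)

lemma phi_act: "act h x = group_algebra_act sL (phi h) x"
  unfolding group_algebra_act_def lin_ext_phi[OF vector_space_mult] act_eq[of h] G.gal_one_eq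
  by (intro sum.cong refl) (simp only: inv_eta_id)

text \<open>Bilinear expansion over \<open>Gal\<close> turns the K-coefficients of
  \<open>\<Delta> h\<close> into the sums in \<open>comult_coef\<close>, which leave only the
  diagonal.\<close>

lemma phi_comult:
  "tensor_eq free_scale free_scale (group_algebra_comult (phi h))
    (lin_ext (\<lambda>c. free_scale (sL c 1)) (\<lambda>(a, b). basis_vec (phi a, phi b)) (\<Delta> h))"
proof (rule tensor_eq_sym)
  let ?b = "\<lambda>\<gamma>. basis_vec (eta \<gamma>) :: (('l \<Rightarrow> 'l) \<Rightarrow> ('l \<Rightarrow> 'l)) \<Rightarrow>\<^sub>0 'l"
  interpret F: vector_space "free_scale :: 'l \<Rightarrow> (_ \<times> _ \<Rightarrow>\<^sub>0 'l) \<Rightarrow> ((((('l \<Rightarrow> 'l) \<Rightarrow> ('l \<Rightarrow> 'l)) \<Rightarrow>\<^sub>0 'l) \<times> ((('l \<Rightarrow> 'l) \<Rightarrow> ('l \<Rightarrow> 'l)) \<Rightarrow>\<^sub>0 'l)) \<Rightarrow>\<^sub>0 'l)"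
    by (rule vector_space_free_scale)
  have phi: "phi a = (\<Sum>\<gamma>\<in>Gal. free_scale (coef a \<gamma>) (?b \<gamma>))" for a
    by (simp add: phi_def free_scale_single)
  have "lin_ext (\<lambda>c. free_scale (sL c 1)) (\<lambda>(a, b). basis_vec (phi a, phi b)) (\<Delta> h)
      = (\<Sum>p\<in>Poly_Mapping.keys (\<Delta> h). free_scale (sL (Poly_Mapping.lookup (\<Delta> h) p) 1) (basis_vec (phi (fst p), phi (snd p))))"
    by (simp add: lin_ext_def case_prod_unfold)
  moreover have "tensor_eq free_scale free_scale \<dots>
      (\<Sum>p\<in>Poly_Mapping.keys (\<Delta> h). free_scale (sL (Poly_Mapping.lookup (\<Delta> h) p) 1)
        (\<Sum>\<gamma>\<in>Gal. \<Sum>\<delta>\<in>Gal. free_scale (coef (fst p) \<gamma> * coef (snd p) \<delta>) (basis_vec (?b \<gamma>, ?b \<delta>))))"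
    unfolding phi by (intro tensor_eq_sum tensor_eq_scale tensor_eq_bilinear_expansion)
  moreover have "\<dots> = (\<Sum>\<gamma>\<in>Gal. \<Sum>\<delta>\<in>Gal. \<Sum>p\<in>Poly_Mapping.keys (\<Delta> h).
      free_scale (sL (Poly_Mapping.lookup (\<Delta> h) p) (coef (fst p) \<gamma> * coef (snd p) \<delta>)) (basis_vec (?b \<gamma>, ?b \<delta>)))"
    unfolding F.scale_sum_right F.scale_scale G.scale_eq_mult[of _ "coef _ _ * coef _ _"]
    by (subst sum.swap, intro sum.cong refl, rule sum.swap)
  moreover have "\<dots> = (\<Sum>\<gamma>\<in>Gal. \<Sum>\<delta>\<in>Gal. free_scale (lin_ext sL (\<lambda>(a, b). coef a \<gamma> * coef b \<delta>) (\<Delta> h)) (basis_vec (?b \<gamma>, ?b \<delta>)))"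
    by (simp add: lin_ext_def case_prod_unfold F.scale_sum_left)
  moreover have "\<dots> = (\<Sum>\<gamma>\<in>Gal. \<Sum>\<delta>\<in>Gal. if \<gamma> = \<delta> then free_scale (coef h \<gamma>) (basis_vec (?b \<gamma>, ?b \<gamma>)) else 0)"
    by (intro sum.cong refl) (simp add: comult_coef)
  moreover have "\<dots> = group_algebra_comult (phi h)"
    using G.finite_gal by (simp add: group_algebra_comult_def lin_ext_phi[OF vector_space_free_scale] cong: if_cong)
  ultimately show "tensor_eq free_scale free_scale
    (lin_ext (\<lambda>c. free_scale (sL c 1)) (\<lambda>(a, b). basis_vec (phi a, phi b)) (\<Delta> h)) (group_algebra_comult (phi h))"
    by simp
qed

lemma gp_corresponds_NN: "gp_corresponds sL sH \<Delta> \<epsilon> act NN"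
  unfolding gp_corresponds_def
  by (intro conjI exI[of _ phi] regular_NN phi_bij phi_linear phi_one phi_mult[THEN allI, THEN allI]
      phi_counit[THEN allI] phi_comult[THEN allI] phi_act[THEN allI, THEN allI])

section \<open>Sub-Hopf algebras and intermediate fields\<close>

text \<open>Extended to \<open>L \<otimes> H\<close>, the antipode sends the group-like
  \<open>\<delta>\<close> to the combination of all \<open>\<tau>\<close> with coefficients
  \<open>w \<tau> \<delta>\<close>. The left antipode axiom makes this a left inverse of
  \<open>\<delta>\<close> in the group ring of \<open>star_group\<close>; cancelling
  \<open>\<delta>\<close> identifies it with the group inverse.\<close>

lemma coef_antipode:
  assumes \<tau>: "\<tau> \<in> Gal"
  shows "coef (S h) \<tau> = coef h (inv\<^bsub>star_group\<^esub> \<tau>)"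
proof -
  have S: "S (g + h) = S g + S h" "S (sH k h) = sH k (S h)" for g h k
    using antipode_linear by (simp_all add: Vector_Spaces.linear_iff)
  have "\<exists>w. \<forall>h. coef (S h) \<tau> = (\<Sum>\<gamma>\<in>Gal. coef h \<gamma> * w \<gamma>)" if "\<tau> \<in> Gal" for \<tau>
  proof -
    have "Vector_Spaces.linear sH sL (\<lambda>h. coef (S h) \<tau>)"
      using that by (simp add: Vector_Spaces.linear_iff vector_space_axioms G.vector_space_axioms S coef_add coef_scale)
    then show ?thesis by (rule functional_representation) blast
  qed
  then have "\<forall>\<tau>\<in>Gal. \<exists>w. \<forall>h. coef (S h) \<tau> = (\<Sum>\<gamma>\<in>Gal. coef h \<gamma> * w \<gamma>)" by blast
  then obtain w where "\<forall>\<tau>\<in>Gal. \<forall>h. coef (S h) \<tau> = (\<Sum>\<gamma>\<in>Gal. coef h \<gamma> * w \<tau> \<gamma>)"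
    by (rule bchoice[THEN exE])
  then have w: "coef (S h) \<tau> = (\<Sum>\<gamma>\<in>Gal. coef h \<gamma> * w \<tau> \<gamma>)" if "\<tau> \<in> Gal" for h \<tau>
    using that by simp
  have conv: "(\<Sum>\<tau>\<in>Gal. w \<tau> \<delta> * (if star \<tau> \<delta> = \<rho> then 1 else 0)) = (if \<rho> = id then 1 else 0)"
    if \<rho>: "\<rho> \<in> Gal" and \<delta>: "\<delta> \<in> Gal" for \<rho> \<delta>
  proof (rule coef_separating_eq[OF _ \<delta>, of "\<lambda>\<delta>. \<Sum>\<tau>\<in>Gal. w \<tau> \<delta> * (if star \<tau> \<delta> = \<rho> then 1 else 0)"
        "\<lambda>_. if \<rho> = id then 1 else 0"])
    fix h
    let ?e = "\<lambda>\<tau> \<delta>. if star \<tau> \<delta> = \<rho> then 1 else (0::'l)"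
    let ?D = "\<lambda>\<gamma> \<delta>. lin_ext sL (\<lambda>(a, b). coef a \<gamma> * coef b \<delta>) (\<Delta> h)"
    have "(\<Sum>\<delta>\<in>Gal. coef h \<delta> * (if \<rho> = id then 1 else 0)) = coef (sH (\<epsilon> h) 1) \<rho>"
      by (simp add: coef_scale[OF \<rho>] coef_one[OF \<rho>] counit_eq)
    also have "\<dots> = coef (lin_ext sH (\<lambda>(a, b). S a * b) (\<Delta> h)) \<rho>" by (simp only: antipode_left)
    also have "\<dots> = lin_ext sL (\<lambda>p. coef (S (fst p) * snd p) \<rho>) (\<Delta> h)"
      by (simp add: linear_apply_lin_ext[OF coef_linear[OF \<rho>]] case_prod_unfold)
    also have "\<dots> = lin_ext sL (\<lambda>p. \<Sum>\<tau>\<in>Gal. \<Sum>\<delta>\<in>Gal. \<Sum>\<gamma>\<in>Gal.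
        coef (fst p) \<gamma> * coef (snd p) \<delta> * (w \<tau> \<gamma> * ?e \<tau> \<delta>)) (\<Delta> h)"
    proof (rule arg_cong[where f = "\<lambda>f. lin_ext sL f (\<Delta> h)"], rule ext)
      fix p
      show "coef (S (fst p) * snd p) \<rho> = (\<Sum>\<tau>\<in>Gal. \<Sum>\<delta>\<in>Gal. \<Sum>\<gamma>\<in>Gal.
        coef (fst p) \<gamma> * coef (snd p) \<delta> * (w \<tau> \<gamma> * ?e \<tau> \<delta>))"
        unfolding coef_mult[OF \<rho>]
      proof (intro sum.cong refl)
        fix \<tau> \<delta> assume "\<tau> \<in> Gal"
        show "coef (S (fst p)) \<tau> * (coef (snd p) \<delta> * ?e \<tau> \<delta>)
            = (\<Sum>\<gamma>\<in>Gal. coef (fst p) \<gamma> * coef (snd p) \<delta> * (w \<tau> \<gamma> * ?e \<tau> \<delta>))"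
          unfolding w[OF \<open>\<tau> \<in> Gal\<close>] sum_distrib_right by (intro sum.cong refl) (simp only: mult_ac)
      qed
    qed
    also have "\<dots> = (\<Sum>\<tau>\<in>Gal. \<Sum>\<delta>\<in>Gal. \<Sum>\<gamma>\<in>Gal. ?D \<gamma> \<delta> * (w \<tau> \<gamma> * ?e \<tau> \<delta>))"
      by (simp only: lin_ext_coef_mult G.lin_ext_sum_fun)
    also have "\<dots> = (\<Sum>\<tau>\<in>Gal. \<Sum>\<delta>\<in>Gal. coef h \<delta> * (w \<tau> \<delta> * ?e \<tau> \<delta>))"
    proof (intro sum.cong refl)
      fix \<tau> \<delta> assume "\<delta> \<in> Gal"
      have "(\<Sum>\<gamma>\<in>Gal. ?D \<gamma> \<delta> * (w \<tau> \<gamma> * ?e \<tau> \<delta>))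
          = (\<Sum>\<gamma>\<in>Gal. if \<gamma> = \<delta> then coef h \<delta> * (w \<tau> \<delta> * ?e \<tau> \<delta>) else 0)"
        using \<open>\<delta> \<in> Gal\<close> by (intro sum.cong refl) (simp add: comult_coef)
      also have "\<dots> = coef h \<delta> * (w \<tau> \<delta> * ?e \<tau> \<delta>)" using \<open>\<delta> \<in> Gal\<close> G.finite_gal by simp
      finally show "(\<Sum>\<gamma>\<in>Gal. ?D \<gamma> \<delta> * (w \<tau> \<gamma> * ?e \<tau> \<delta>)) = coef h \<delta> * (w \<tau> \<delta> * ?e \<tau> \<delta>)" .
    qed
    also have "\<dots> = (\<Sum>\<delta>\<in>Gal. coef h \<delta> * (\<Sum>\<tau>\<in>Gal. w \<tau> \<delta> * ?e \<tau> \<delta>))"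
      unfolding sum_distrib_left by (rule sum.swap)
    finally show "(\<Sum>\<delta>\<in>Gal. coef h \<delta> * (\<Sum>\<tau>\<in>Gal. w \<tau> \<delta> * ?e \<tau> \<delta>)) = (\<Sum>\<delta>\<in>Gal. coef h \<delta> * (if \<rho> = id then 1 else 0))"
      by simp
  qed
  let ?i = "inv\<^bsub>star_group\<^esub> \<tau>"
  have i: "?i \<in> Gal" by (rule star_inv_gal[OF \<tau>])
  have "w \<tau> \<delta> = (if \<delta> = ?i then 1 else 0)" if \<delta>: "\<delta> \<in> Gal" for \<delta>
  proof -
    have "w \<tau> \<delta> = (\<Sum>\<tau>'\<in>Gal. if \<tau>' = \<tau> then w \<tau> \<delta> else 0)" using \<tau> G.finite_gal by simp
    also have "\<dots> = (\<Sum>\<tau>'\<in>Gal. w \<tau>' \<delta> * (if star \<tau>' \<delta> = star \<tau> \<delta> then 1 else 0))"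
    proof (intro sum.cong refl)
      fix \<tau>' assume "\<tau>' \<in> Gal"
      then have "star \<tau>' \<delta> = star \<tau> \<delta> \<longleftrightarrow> \<tau>' = \<tau>" using star.right_cancel[of \<delta> \<tau>' \<tau>] \<tau> \<delta> by simp
      then show "(if \<tau>' = \<tau> then w \<tau> \<delta> else 0) = w \<tau>' \<delta> * (if star \<tau>' \<delta> = star \<tau> \<delta> then 1 else 0)" by simp
    qed
    also have "\<dots> = (if star \<tau> \<delta> = id then 1 else 0)" by (rule conv[OF star_gal[OF \<tau> \<delta>] \<delta>])
    also have "star \<tau> \<delta> = id \<longleftrightarrow> \<delta> = ?i"
    proof
      assume "star \<tau> \<delta> = id"
      then have "star (star ?i \<tau>) \<delta> = star ?i id" by (simp only: star_assoc[OF i \<tau> \<delta>])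
      then show "\<delta> = ?i" by (simp add: star_inv[OF \<tau>] star_id \<delta> i)
    qed (simp add: star_inv[OF \<tau>])
    finally show ?thesis .
  qed
  then have "coef (S h) \<tau> = (\<Sum>\<delta>\<in>Gal. coef h \<delta> * (if \<delta> = ?i then 1 else 0))"
    unfolding w[OF \<tau>] by (intro sum.cong refl) simp
  also have "\<dots> = coef h ?i" using i G.finite_gal by (simp add: if_distrib cong: if_cong)
  finally show ?thesis .
qed

text \<open>The coordinate functionals of a finite basis \<open>B\<close> of \<open>H\<close> are
  L-combinations of the functionals \<open>\<lambda>h. coef h \<gamma>\<close>. So all coordinates
  of \<open>y\<close> on pairs from \<open>B\<close> vanish, and \<open>H \<otimes> H\<close> embeds
  in the functions on \<open>Gal \<times> Gal\<close>.\<close>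

lemma coef_tensor_inj2:
  assumes "\<And>\<gamma> \<delta>. \<gamma> \<in> Gal \<Longrightarrow> \<delta> \<in> Gal \<Longrightarrow> lin_ext sL (\<lambda>(a, b). coef a \<gamma> * coef b \<delta>) y = 0"
  shows "tensor_eq sH sH y 0"
proof -
  obtain B0 where B0: "finite B0" "span B0 = UNIV" using fin_dim by (auto simp: finite_dimensional_def)
  obtain B where B: "B \<subseteq> B0" "independent B" "B0 \<subseteq> span B"
    using maximal_independent_subset[of B0] by blast
  have finB: "finite B" using finite_subset[OF B(1) B0(1)] .
  have spanB: "span B = UNIV" using B(3) B0(2) span_minimal[OF B(3) subspace_span] by auto
  let ?r = "\<lambda>b h. representation B h b"
  have expand: "h = (\<Sum>b\<in>B. sH (?r b h) b)" for h
    using sum_representation_eq[OF B(2) _ finB order_refl, of h] spanB by simp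
  have "\<exists>w. \<forall>h. sL (?r b h) 1 = (\<Sum>\<gamma>\<in>Gal. coef h \<gamma> * w \<gamma>)" for b
  proof -
    have "Vector_Spaces.linear sH sL (\<lambda>h. sL (?r b h) 1)"
      using representation_add[OF B(2)] representation_scale[OF B(2)] spanB
      by (simp add: Vector_Spaces.linear_iff vector_space_axioms G.vector_space_axioms G.scale_left_distrib)
    then show ?thesis by (rule functional_representation) blast
  qed
  then have "\<forall>b. \<exists>w. \<forall>h. sL (?r b h) 1 = (\<Sum>\<gamma>\<in>Gal. coef h \<gamma> * w \<gamma>)" by blast
  then obtain w where w: "\<forall>b h. sL (?r b h) 1 = (\<Sum>\<gamma>\<in>Gal. coef h \<gamma> * w b \<gamma>)"
    by (rule choice[THEN exE])
  interpret F: vector_space "free_scale :: 'k \<Rightarrow> ('h \<times> 'h \<Rightarrow>\<^sub>0 'k) \<Rightarrow> _" by (rule vector_space_free_scale)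
  interpret K: vector_space "(*) :: 'k \<Rightarrow> 'k \<Rightarrow> 'k" by unfold_locales (simp_all add: algebra_simps)
  let ?t = "\<lambda>p. \<Sum>b\<in>B. \<Sum>b'\<in>B. free_scale (?r b (fst p) * ?r b' (snd p)) (basis_vec (b, b'))"
  have zero: "lin_ext (*) (\<lambda>p. ?r b (fst p) * ?r b' (snd p)) y = 0" for b b'
  proof -
    have lin: "Vector_Spaces.linear (*) sL (\<lambda>k. sL k 1)"
      by (simp add: Vector_Spaces.linear_iff K.vector_space_axioms G.vector_space_axioms G.scale_left_distrib)
    have prod: "sL (a * c) 1 = sL a 1 * sL c 1" for a c using G.scale_eq_mult[of a "sL c 1"] by simp
    have "sL (lin_ext (*) (\<lambda>p. ?r b (fst p) * ?r b' (snd p)) y) 1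
        = lin_ext sL (\<lambda>p. sL (?r b (fst p)) 1 * sL (?r b' (snd p)) 1) y"
      by (simp only: linear_apply_lin_ext[OF lin] prod)
    also have "\<dots> = lin_ext sL (\<lambda>p. \<Sum>\<gamma>\<in>Gal. \<Sum>\<delta>\<in>Gal. coef (fst p) \<gamma> * coef (snd p) \<delta> * (w b \<gamma> * w b' \<delta>)) y"
      by (simp only: w sum_product) (simp only: mult_ac)
    also have "\<dots> = (\<Sum>\<gamma>\<in>Gal. \<Sum>\<delta>\<in>Gal. lin_ext sL (\<lambda>(a, b). coef a \<gamma> * coef b \<delta>) y * (w b \<gamma> * w b' \<delta>))"
      by (simp only: lin_ext_coef_mult G.lin_ext_sum_fun)
    also have "\<dots> = 0" by (simp add: assms)
    finally show ?thesis by simp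
  qed
  have "tensor_eq sH sH (lin_ext free_scale basis_vec y)
      (lin_ext free_scale ?t y)"
  proof (rule tensor_eq_lin_ext)
    fix p :: "'h \<times> 'h"
    have "tensor_eq sH sH (basis_vec (\<Sum>b\<in>B. sH (?r b (fst p)) b, \<Sum>b'\<in>B. sH (?r b' (snd p)) b'))
      (?t p)"
      by (rule tensor_eq_bilinear_expansion)
    then show "tensor_eq sH sH (basis_vec p) (?t p)"
      by (simp only: expand[symmetric] prod.collapse)
  qed
  moreover
  have "lin_ext free_scale ?t y
      = (\<Sum>b\<in>B. \<Sum>b'\<in>B. free_scale (lin_ext (*) (\<lambda>p. ?r b (fst p) * ?r b' (snd p)) y) (basis_vec (b, b')))"
    unfolding F.lin_ext_sum_fun by (simp add: lin_ext_def F.scale_sum_left)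
  then have "lin_ext free_scale ?t y = 0"
    by (simp add: zero)
  ultimately show ?thesis by (simp add: lin_ext_basis_vec)
qed

section \<open>Supports of sub-Hopf algebras\<close>

definition support :: "'h set \<Rightarrow> ('l \<Rightarrow> 'l) set" where
  "support J = {\<gamma> \<in> Gal. \<exists>h\<in>J. coef h \<gamma> \<noteq> 0}"

text \<open>Represent \<open>\<Delta> h\<close> with all factors in \<open>J\<close> and apply
  \<open>w\<close> to the second factors. The result vanishes by assumption, but by
  \<open>comult_coef\<close> its coordinate at \<open>\<gamma>\<close> is
  \<open>coef h \<gamma> * w \<gamma>\<close>. This expresses that \<open>L \<otimes> J\<close> is
  spanned by the group-likes in \<open>support J\<close>.\<close>

lemma support_separating:
  assumes J: "sub_hopf_algebra sH \<Delta> S J"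
    and w: "\<And>h. h \<in> J \<Longrightarrow> (\<Sum>\<gamma>\<in>Gal. coef h \<gamma> * w \<gamma>) = 0"
    and \<gamma>: "\<gamma> \<in> support J"
  shows "w \<gamma> = 0"
proof -
  obtain h where h: "\<gamma> \<in> Gal" "h \<in> J" "coef h \<gamma> \<noteq> 0" using \<gamma> by (auto simp: support_def)
  obtain x where x: "Poly_Mapping.keys x \<subseteq> J \<times> J" "tensor_eq sH sH (\<Delta> h) x"
    using J h(2) by (auto simp: sub_hopf_algebra_def)
  have comult: "lin_ext sL (\<lambda>(a, b). coef a \<gamma> * coef b \<delta>) x = (if \<gamma> = \<delta> then coef h \<gamma> else 0)" if \<delta>: "\<delta> \<in> Gal" for \<delta>
  proof -
    have "lin_ext sL (\<lambda>(a, b). coef a \<gamma> * coef b \<delta>) (\<Delta> h) = lin_ext sL (\<lambda>(a, b). coef a \<gamma> * coef b \<delta>) x"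
    proof (rule G.lin_ext_tensor_eq[where B = "\<lambda>a b. coef a \<gamma> * coef b \<delta>" and sA = sH and sB = sH])
      show "coef a \<gamma> * coef (sH c b) \<delta> = sL c (coef a \<gamma> * coef b \<delta>)" for a b c
        by (simp only: coef_scale[OF \<delta>] G.scale_mult_right)
    qed (simp_all add: coef_add[OF h(1)] coef_add[OF \<delta>] coef_scale[OF h(1)] distrib_left distrib_right G.scale_mult_left x(2))
    then show ?thesis by (simp only: comult_coef[OF h(1) \<delta>])
  qed
  have "coef h \<gamma> * w \<gamma> = (\<Sum>\<delta>\<in>Gal. (if \<gamma> = \<delta> then coef h \<gamma> else 0) * w \<delta>)"
    using h(1) G.finite_gal by (simp add: if_distrib[of "\<lambda>z. z * _"] cong: if_cong)
  also have "\<dots> = (\<Sum>\<delta>\<in>Gal. lin_ext sL (\<lambda>(a, b). coef a \<gamma> * coef b \<delta>) x * w \<delta>)"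
    by (intro sum.cong refl) (simp only: comult)
  also have "\<dots> = (\<Sum>\<delta>\<in>Gal. lin_ext sL (\<lambda>p. coef (fst p) \<gamma> * (coef (snd p) \<delta> * w \<delta>)) x)"
    unfolding lin_ext_def by (simp add: sum_distrib_right case_prod_unfold G.scale_mult_left mult.assoc)
  also have "\<dots> = lin_ext sL (\<lambda>p. coef (fst p) \<gamma> * (\<Sum>\<delta>\<in>Gal. coef (snd p) \<delta> * w \<delta>)) x"
    by (simp only: G.lin_ext_sum_fun[symmetric] sum_distrib_left)
  also have "\<dots> = 0"
    unfolding lin_ext_def
  proof (rule sum.neutral, rule ballI)
    fix p assume "p \<in> Poly_Mapping.keys x"
    then have "snd p \<in> J" using x(1) by auto
    from w[OF this] show "sL (Poly_Mapping.lookup x p) (coef (fst p) \<gamma> * (\<Sum>\<delta>\<in>Gal. coef (snd p) \<delta> * w \<delta>)) = 0" by simp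
  qed
  finally show ?thesis using h(3) by simp
qed

lemma support_gal: "support J \<subseteq> Gal"
  by (auto simp: support_def)

lemma support_twist: "\<sigma> \<in> Gal \<Longrightarrow> \<gamma> \<in> support J \<Longrightarrow> twist \<sigma> \<gamma> \<in> support J"
proof -
  assume \<sigma>: "\<sigma> \<in> Gal" and "\<gamma> \<in> support J"
  then obtain h where h: "\<gamma> \<in> Gal" "h \<in> J" "coef h \<gamma> \<noteq> 0" by (auto simp: support_def)
  have "coef h (twist \<sigma> \<gamma>) \<noteq> 0"
    using coef_twist[OF \<sigma> h(1), of h] h(3) G.gal_zero[OF \<sigma>] by auto
  then show ?thesis using twist_gal[OF \<sigma> h(1)] h(2) by (auto simp: support_def)
qed

text \<open>Otherwise the coordinate at \<open>star \<gamma> \<delta>\<close> vanishes on all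
  products from \<open>J\<close>. Stripping the two factors with \<open>support_separating\<close>,
  one after the other, leaves the structure constant at \<open>\<gamma>\<close> and
  \<open>\<delta>\<close>, which is 1.\<close>

lemma support_star:
  assumes J: "sub_hopf_algebra sH \<Delta> S J" and \<gamma>: "\<gamma> \<in> support J" and \<delta>: "\<delta> \<in> support J"
  shows "star \<gamma> \<delta> \<in> support J"
proof (rule ccontr)
  let ?\<rho> = "star \<gamma> \<delta>"
  assume "?\<rho> \<notin> support J"
  moreover have \<rho>: "?\<rho> \<in> Gal" using \<gamma> \<delta> support_gal by (intro star_gal) auto
  ultimately have 0: "coef h ?\<rho> = 0" if "h \<in> J" for h using that by (auto simp: support_def)
  have "(\<Sum>\<beta>\<in>Gal. coef h \<beta> * (if star \<gamma> \<beta> = ?\<rho> then 1 else 0)) = 0" if h: "h \<in> J" for h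
  proof (rule support_separating[OF J _ \<gamma>,
        where w = "\<lambda>\<alpha>. \<Sum>\<beta>\<in>Gal. coef h \<beta> * (if star \<alpha> \<beta> = ?\<rho> then 1 else 0)"])
    fix g assume "g \<in> J"
    then have "g * h \<in> J" using J h by (auto simp: sub_hopf_algebra_def)
    from 0[OF this] show "(\<Sum>\<alpha>\<in>Gal. coef g \<alpha> * (\<Sum>\<beta>\<in>Gal. coef h \<beta> * (if star \<alpha> \<beta> = ?\<rho> then 1 else 0))) = 0"
      unfolding coef_mult[OF \<rho>] by (simp only: sum_distrib_left)
  qed
  from support_separating[OF J this \<delta>] show False by simp
qed

text \<open>Composition is recovered from \<open>star\<close>:
  \<open>\<gamma> \<circ> \<delta>\<close> is
  \<open>star \<gamma> (twist (inv_into UNIV \<gamma>) \<delta>)\<close>.\<close>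

lemma twist_star_closed_subgroup:
  assumes I: "I \<subseteq> Gal" "id \<in> I" "\<And>\<gamma> \<delta>. \<gamma> \<in> I \<Longrightarrow> \<delta> \<in> I \<Longrightarrow> star \<gamma> \<delta> \<in> I"
    "\<And>\<sigma> \<gamma>. \<sigma> \<in> Gal \<Longrightarrow> \<gamma> \<in> I \<Longrightarrow> twist \<sigma> \<gamma> \<in> I"
  shows "subgroup I (gal_group sL)"
proof -
  interpret gal: group "gal_group sL" by (rule G.group_gal)
  show ?thesis
  proof (rule gal.finite_submonoid_is_subgroup[OF G.finite_gal I(1)])
    fix \<gamma> \<delta> assume gd: "\<gamma> \<in> I" "\<delta> \<in> I"
    then have g: "\<gamma> \<in> Gal" "\<delta> \<in> Gal" using I(1) by auto
    have "star \<gamma> (twist (inv_into UNIV \<gamma>) \<delta>) = \<gamma> \<circ> \<delta>" by (simp add: star_def twist_inv[OF g])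
    then show "\<gamma> \<otimes>\<^bsub>gal_group sL\<^esub> \<delta> \<in> I" using I(3)[OF gd(1) I(4)[OF G.gal_inv[OF g(1)] gd(2)]] by (simp add: G.gal_mult_eq)
  qed (simp add: G.gal_one_eq I(2))
qed

lemma support_subgroup:
  assumes J: "sub_hopf_algebra sH \<Delta> S J"
  shows "subgroup (support J) (gal_group sL)"
proof (rule twist_star_closed_subgroup)
  have "1 \<in> J" using J by (simp add: sub_hopf_algebra_def)
  moreover have "coef 1 id \<noteq> 0" using coef_one[OF G.id_gal] by simp
  ultimately show "id \<in> support J" using G.id_gal unfolding support_def by blast
qed (use support_gal support_star[OF J] support_twist in auto)

lemma act_minus_counit: "act h x - sL (\<epsilon> h) x = (\<Sum>\<gamma>\<in>Gal. coef h \<gamma> * (\<gamma> x - x))"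
proof -
  have "sL (\<epsilon> h) x = (\<Sum>\<gamma>\<in>Gal. coef h \<gamma>) * x" using G.scale_eq_mult[of "\<epsilon> h" x] counit_eq[of h] by simp
  then show ?thesis by (simp add: act_eq[of h] right_diff_distrib sum_subtractf sum_distrib_right)
qed

text \<open>By \<open>act_minus_counit\<close>, one inclusion is \<open>support_separating\<close>
  for \<open>w \<gamma> = \<gamma> x - x\<close>; in the other every summand is zero.\<close>

lemma fixed_subfield_eq:
  assumes J: "sub_hopf_algebra sH \<Delta> S J"
  shows "fixed_subfield sL \<epsilon> act J = {x. \<forall>\<gamma>\<in>support J. \<gamma> x = x}"
proof (intro subset_antisym subsetI)
  fix x assume x: "x \<in> fixed_subfield sL \<epsilon> act J"
  have "\<gamma> x - x = 0" if "\<gamma> \<in> support J" for \<gamma>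
  proof (rule support_separating[OF J _ that])
    fix h assume "h \<in> J"
    then show "(\<Sum>\<gamma>\<in>Gal. coef h \<gamma> * (\<gamma> x - x)) = 0"
      using x by (simp add: act_minus_counit[symmetric] fixed_subfield_def)
  qed
  then show "x \<in> {x. \<forall>\<gamma>\<in>support J. \<gamma> x = x}" by simp
next
  fix x assume x: "x \<in> {x. \<forall>\<gamma>\<in>support J. \<gamma> x = x}"
  have "act h x - sL (\<epsilon> h) x = 0" if h: "h \<in> J" for h
    unfolding act_minus_counit
  proof (rule sum.neutral, rule ballI)
    fix \<gamma> assume "\<gamma> \<in> Gal"
    then show "coef h \<gamma> * (\<gamma> x - x) = 0" using x h by (cases "coef h \<gamma> = 0") (auto simp: support_def)
  qed
  then show "x \<in> fixed_subfield sL \<epsilon> act J" by (simp add: fixed_subfield_def)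
qed

text \<open>If \<open>h\<close> were outside \<open>J\<close>, some linear \<open>\<beta>\<close>
  would vanish on \<open>J\<close> and take the value 1 at \<open>h\<close>. Its family
  \<open>w\<close> vanishes on \<open>support J\<close>, while the coordinates of \<open>h\<close>
  vanish off it, so \<open>\<beta> h = 0\<close>.\<close>

lemma sub_hopf_algebra_eq_support:
  assumes J: "sub_hopf_algebra sH \<Delta> S J"
  shows "J = {h. \<forall>\<gamma>\<in>Gal - support J. coef h \<gamma> = 0}"
proof (intro subset_antisym subsetI)
  fix h assume "h \<in> J"
  then show "h \<in> {h. \<forall>\<gamma>\<in>Gal - support J. coef h \<gamma> = 0}" by (auto simp: support_def)
next
  fix h assume h: "h \<in> {h. \<forall>\<gamma>\<in>Gal - support J. coef h \<gamma> = 0}"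
  show "h \<in> J"
  proof (rule ccontr)
    assume hJ: "h \<notin> J"
    interpret VP: vector_space_pair sH sL
      by (simp add: vector_space_pair_def vector_space_axioms G.vector_space_axioms)
    have subJ: "subspace J" using J by (simp add: sub_hopf_algebra_def)
    obtain B where B: "B \<subseteq> J" "independent B" "J \<subseteq> span B"
      using maximal_independent_subset[of J] by blast
    have spanB: "span B = J" using B span_minimal[OF B(1) subJ] by auto
    have "independent (insert h B)" using hJ spanB B(2) by (intro independent_insertI) auto
    then obtain \<beta> where \<beta>: "Vector_Spaces.linear sH sL \<beta>" "\<forall>x\<in>insert h B. \<beta> x = (if x = h then 1 else 0)"
      using VP.linear_independent_extend[of "insert h B" "\<lambda>x. if x = h then 1 else 0"] by blast
    obtain w where w: "\<And>h. \<beta> h = (\<Sum>\<gamma>\<in>Gal. coef h \<gamma> * w \<gamma>)"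
      by (rule functional_representation[OF \<beta>(1)]) blast
    have "h \<notin> B" using hJ B(1) by auto
    then have "\<beta> b = 0" if "b \<in> B" for b using \<beta>(2) that by auto
    then have \<beta>J: "\<beta> g = 0" if "g \<in> J" for g
      using VP.linear_eq_0_on_span[OF \<beta>(1), of B g] that spanB by auto
    have "w \<gamma> = 0" if "\<gamma> \<in> support J" for \<gamma>
    proof (rule support_separating[OF J _ that, where w = w])
      fix g assume "g \<in> J"
      then show "(\<Sum>\<gamma>\<in>Gal. coef g \<gamma> * w \<gamma>) = 0" using \<beta>J[of g] w[of g] by simp
    qed
    then have "\<beta> h = 0" unfolding w using h by (intro sum.neutral) auto
    then show False using \<beta>(2) by simp
  qed
qed

text \<open>Projection to a \<open>twist\<close>-stable set of coordinates commutes with the Galois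
  action, so \<open>descent\<close> realises it on \<open>H\<close> itself.\<close>

lemma restrict_coef:
  assumes I: "\<And>\<sigma> \<gamma>. \<sigma> \<in> Gal \<Longrightarrow> \<gamma> \<in> I \<Longrightarrow> twist \<sigma> \<gamma> \<in> I" "I \<subseteq> Gal"
  obtains k where "\<And>\<gamma>. \<gamma> \<in> Gal \<Longrightarrow> coef k \<gamma> = (if \<gamma> \<in> I then coef h \<gamma> else 0)"
proof -
  let ?c = "\<lambda>\<gamma>. if \<gamma> \<in> I then coef h \<gamma> else 0"
  have c: "\<sigma> (?c (twist \<sigma> \<gamma>)) = ?c \<gamma>" if \<sigma>: "\<sigma> \<in> Gal" and \<gamma>: "\<gamma> \<in> Gal" for \<sigma> \<gamma>
  proof -
    have "twist \<sigma> \<gamma> \<in> I \<longleftrightarrow> \<gamma> \<in> I"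
      using I(1)[OF \<sigma>, of \<gamma>] I(1)[OF G.gal_inv[OF \<sigma>], of "twist \<sigma> \<gamma>"] twist_inv[OF \<sigma> \<gamma>] by auto
    then show ?thesis by (simp add: coef_twist[OF \<sigma> \<gamma>] G.gal_zero[OF \<sigma>])
  qed
  obtain u where u: "(\<Sum>\<gamma>\<in>Gal. \<gamma> u) = 1" by (rule G.trace_one_exists)
  obtain t where t: "\<And>\<gamma>. \<gamma> \<in> Gal \<Longrightarrow> lin_ext sL (\<lambda>(x, h). x * coef h \<gamma>) t = ?c \<gamma>"
    by (rule coef_surj[of ?c]) blast
  show ?thesis
  proof (rule that)
    fix \<gamma> assume "\<gamma> \<in> Gal"
    then show "coef (lin_ext sH (\<lambda>(x, h). sH (G.tr (u * x)) h) t) \<gamma> = ?c \<gamma>"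
      by (intro descent[where c = ?c, OF u]) (rule t c; assumption)+
  qed
qed

lemma keys_lin_ext_basis_vec:
  "Poly_Mapping.keys (lin_ext free_scale (\<lambda>p. basis_vec (f p)) x) \<subseteq> range f"
  unfolding lin_ext_def by (rule keys_sum_subset) (auto simp: free_scale_single)

text \<open>Restricting coefficients to \<open>I\<close> is a projection \<open>P\<close> of \<open>H\<close> onto the subspace in question, and
  \<open>(P \<otimes> P) \<circ> \<Delta> = \<Delta>\<close> there because \<open>H \<otimes> H\<close> embeds in the functions on \<open>Gal \<times> Gal\<close>.\<close>

lemma support_sub_hopf_algebra:
  assumes I: "subgroup I star_group" "\<And>\<sigma> \<gamma>. \<sigma> \<in> Gal \<Longrightarrow> \<gamma> \<in> I \<Longrightarrow> twist \<sigma> \<gamma> \<in> I"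
  defines "J \<equiv> {h. \<forall>\<gamma>\<in>Gal - I. coef h \<gamma> = 0}"
  shows "sub_hopf_algebra sH \<Delta> S J" "support J = I"
proof -
  have IG: "I \<subseteq> Gal" using subgroup.subset[OF I(1)] by simp
  have "\<exists>k. \<forall>\<gamma>\<in>Gal. coef k \<gamma> = (if \<gamma> \<in> I then coef h \<gamma> else 0)" for h
    by (rule restrict_coef[OF I(2) IG, of h]) blast+
  then obtain P where P: "\<And>h \<gamma>. \<gamma> \<in> Gal \<Longrightarrow> coef (P h) \<gamma> = (if \<gamma> \<in> I then coef h \<gamma> else 0)" by metis
  have PJ: "P h \<in> J" for h by (simp add: J_def P)
  show "support J = I"
  proof (intro subset_antisym subsetI)
    fix \<gamma> assume \<gamma>: "\<gamma> \<in> I"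
    then have g: "\<gamma> \<in> Gal" using IG by auto
    have "\<exists>h. coef h \<gamma> \<noteq> 0"
    proof (rule ccontr)
      assume "\<not> (\<exists>h. coef h \<gamma> \<noteq> 0)"
      then have "(\<Sum>\<delta>\<in>Gal. coef h \<delta> * (if \<delta> = \<gamma> then 1 else 0)) = 0" for h
        by (intro sum.neutral) auto
      from coef_separating[OF this g] show False by simp
    qed
    then obtain h where "coef h \<gamma> \<noteq> 0" by blast
    then have "coef (P h) \<gamma> \<noteq> 0" using P[OF g] \<gamma> by simp
    then show "\<gamma> \<in> support J" using PJ g by (auto simp: support_def)
  qed (auto simp: support_def J_def)
  show "sub_hopf_algebra sH \<Delta> S J"
    unfolding sub_hopf_algebra_def
  proof (intro conjI ballI)
    show "subspace J"
    proof (rule subspaceI)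
      show "0 \<in> J" using coef_scale[of _ 0 0] by (simp add: J_def)
    qed (simp_all add: J_def coef_add coef_scale)
    show "1 \<in> J" using subgroup.one_closed[OF I(1)] by (auto simp: J_def coef_one)
    fix a assume a: "a \<in> J"
    show "S a \<in> J"
      unfolding J_def
    proof (intro CollectI ballI)
      fix \<gamma> assume \<gamma>: "\<gamma> \<in> Gal - I"
      then have g: "\<gamma> \<in> Gal" by simp
      have "inv\<^bsub>star_group\<^esub> \<gamma> \<notin> I"
        using subgroup.m_inv_closed[OF I(1), of "inv\<^bsub>star_group\<^esub> \<gamma>"] star.inv_inv[of \<gamma>] \<gamma> by auto
      then show "coef (S a) \<gamma> = 0" using a star_inv_gal[OF g] by (simp add: coef_antipode[OF g] J_def)
    qed
    show "a * b \<in> J" if b: "b \<in> J" for b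
      unfolding J_def
    proof (intro CollectI ballI)
      fix \<rho> assume \<rho>: "\<rho> \<in> Gal - I"
      then have r: "\<rho> \<in> Gal" by simp
      show "coef (a * b) \<rho> = 0"
        unfolding coef_mult[OF r]
      proof (intro sum.neutral ballI)
        fix \<gamma> \<delta> assume gd: "\<gamma> \<in> Gal" "\<delta> \<in> Gal"
        show "coef a \<gamma> * (coef b \<delta> * (if star \<gamma> \<delta> = \<rho> then 1 else 0)) = 0"
        proof (cases "\<gamma> \<in> I \<and> \<delta> \<in> I")
          case True
          then have "star \<gamma> \<delta> \<in> I" using subgroup.m_closed[OF I(1), of \<gamma> \<delta>] by simp
          then show ?thesis using \<rho> by auto
        next
          case False
          then show ?thesis using a b gd by (auto simp: J_def)
        qed
      qed
    qed
    let ?x = "lin_ext free_scale (\<lambda>p. basis_vec (P (fst p), P (snd p))) (\<Delta> a)"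
    have "tensor_eq sH sH (\<Delta> a - ?x) 0"
    proof (rule coef_tensor_inj2)
      fix \<gamma> \<delta> assume gd: "\<gamma> \<in> Gal" "\<delta> \<in> Gal"
      let ?D = "lin_ext sL (\<lambda>(a, b). coef a \<gamma> * coef b \<delta>) (\<Delta> a)"
      have "lin_ext sL (\<lambda>(a, b). coef a \<gamma> * coef b \<delta>) ?x
          = lin_ext sL (\<lambda>p. coef (P (fst p)) \<gamma> * coef (P (snd p)) \<delta>) (\<Delta> a)"
        by (simp add: linear_apply_lin_ext[OF G.linear_lin_ext] G.lin_ext_single)
      also have "\<dots> = (if \<gamma> \<in> I \<and> \<delta> \<in> I then ?D else 0)"
        by (auto simp: P gd lin_ext_def case_prod_unfold intro!: sum.neutral)
      also have "\<dots> = ?D" using a gd by (auto simp: comult_coef J_def)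
      finally show "lin_ext sL (\<lambda>(a, b). coef a \<gamma> * coef b \<delta>) (\<Delta> a - ?x) = 0"
        by (simp add: G.lin_ext_diff)
    qed
    then have "tensor_eq sH sH (\<Delta> a) ?x" by (simp add: tensor_eq_def)
    moreover have "Poly_Mapping.keys ?x \<subseteq> J \<times> J"
      using keys_lin_ext_basis_vec[of "\<lambda>p. (P (fst p), P (snd p))" "\<Delta> a"] PJ by auto
    ultimately show "\<exists>x. Poly_Mapping.keys x \<subseteq> J \<times> J \<and> tensor_eq sH sH (\<Delta> a) x" by blast
  qed
qed

section \<open>The cyclic case\<close>

lemma star_group_iso_NN: "star_group \<cong> Perm\<lparr>carrier := NN\<rparr>"
proof -
  have "eta \<in> iso star_group (Perm\<lparr>carrier := NN\<rparr>)"
    unfolding iso_def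
  proof (intro CollectI conjI homI)
    show "bij_betw eta (carrier star_group) (carrier (Perm\<lparr>carrier := NN\<rparr>))"
      using eta_inj by (simp add: bij_betw_def NN_eq_eta)
  qed (simp_all add: NN_eq_eta eta_mult)
  then show ?thesis unfolding is_iso_def by blast
qed

lemma cyclic_star_group:
  assumes "prime p" "odd p" "order (gal_group sL) = p ^ n" "cyclic_group (gal_group sL)"
  shows "cyclic_group star_group"
proof -
  interpret gal: group "gal_group sL" by (rule G.group_gal)
  have "group (Perm\<lparr>carrier := NN\<rparr>)"
    by (rule group.subgroup_imp_group[OF group_BijGroup subgroup_NN])
  then show ?thesis
    using gal.regular_normalized_cyclic[OF assms regular_NN]
      isomorphic_group_cyclicity[OF star_group_iso_NN group_star] by simp
qed

lemma twist_star_pow: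
  assumes "\<sigma> \<in> Gal" "\<gamma> \<in> Gal"
  shows "twist \<sigma> (\<gamma> [^]\<^bsub>star_group\<^esub> (k::nat)) = twist \<sigma> \<gamma> [^]\<^bsub>star_group\<^esub> k"
proof (induction k)
  case (Suc k)
  have "\<gamma> [^]\<^bsub>star_group\<^esub> k \<in> Gal" using star.nat_pow_closed[of \<gamma> k] assms(2) by simp
  then show ?case using Suc by (simp add: twist_star[OF assms(1) _ assms(2)])
qed (simp only: star.nat_pow_0 star_group_simps twist_fixes_id[OF assms(1)])

text \<open>The subgroups of order \<open>d\<close> of the two cyclic groups \<open>Gal\<close> and \<open>star_group\<close> coincide: that of
  \<open>star_group\<close> is characteristic, hence stable under \<open>twist\<close>, hence closed under composition.\<close>

lemma gal_subgroup_is_star_subgroup: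
  assumes cyc: "cyclic_group (gal_group sL)" "cyclic_group star_group"
    and I: "subgroup I (gal_group sL)"
  shows "subgroup I star_group" "\<sigma> \<in> Gal \<Longrightarrow> \<gamma> \<in> I \<Longrightarrow> twist \<sigma> \<gamma> \<in> I"
proof -
  interpret gal: group "gal_group sL" by (rule G.group_gal)
  interpret starc: comm_group star_group by (rule star.cyclic_imp_abelian_group[OF cyc(2)])
  let ?d = "card I"
  let ?T = "{\<gamma> \<in> Gal. \<gamma> [^]\<^bsub>star_group\<^esub> ?d = id}"
  have "?d dvd order (gal_group sL)" using gal.lagrange[OF I] by (metis dvd_triv_right)
  then have "?d dvd order star_group" by (simp add: order_def)
  then have card: "card ?T = ?d"
    using star.card_roots_cyclic[OF cyc(2)] G.finite_gal by simp
  \<comment> \<open>Roots of exponent \<open>?d\<close> are closed under \<open>star\<close> because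
    a cyclic group is abelian.\<close>
  have T_star: "star \<gamma> \<delta> \<in> ?T" if "\<gamma> \<in> ?T" "\<delta> \<in> ?T" for \<gamma> \<delta>
    using that starc.nat_pow_distrib[of \<gamma> \<delta> ?d] by (simp add: star_gal star_id G.id_gal)
  have T_twist: "twist \<sigma> \<gamma> \<in> ?T" if "\<sigma> \<in> Gal" "\<gamma> \<in> ?T" for \<sigma> \<gamma>
    using that twist_star_pow[of \<sigma> \<gamma> ?d] by (simp add: twist_gal twist_fixes_id)
  have T_id: "id \<in> ?T" using G.id_gal star.nat_pow_one[of ?d] by simp
  have "subgroup ?T (gal_group sL)"
    by (rule twist_star_closed_subgroup) (use T_star T_twist T_id in auto)
  from gal.cyclic_subgroup_eq_roots[OF cyc(1) G.finite_gal this]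
    gal.cyclic_subgroup_eq_roots[OF cyc(1) G.finite_gal I]
  have IT: "I = ?T" unfolding card by simp
  show "twist \<sigma> \<gamma> \<in> I" if "\<sigma> \<in> Gal" "\<gamma> \<in> I"
    using T_twist[OF that(1), of \<gamma>] that(2) unfolding IT[symmetric] .
  have "subgroup ?T star_group"
    by (rule star.finite_submonoid_is_subgroup) (use T_star T_id G.finite_gal in auto)
  then show "subgroup I star_group" unfolding IT[symmetric] .
qed

text \<open>A sub-Hopf algebra is determined by its support, and the support, being a subgroup of
  \<open>Gal\<close>, by its fixed field.\<close>

lemma strong_correspondence:
  assumes cyc: "cyclic_group (gal_group sL)" "cyclic_group star_group"
  shows "strong_galois_correspondence sL sH \<Delta> \<epsilon> S act"
  unfolding strong_galois_correspondence_def bij_betw_def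
proof (intro conjI)
  let ?F = "fixed_subfield sL \<epsilon> act" and ?S = "{J. sub_hopf_algebra sH \<Delta> S J}"
  show "inj_on (?F) ?S"
  proof (rule inj_onI)
    fix J J' assume "J \<in> ?S" "J' \<in> ?S"
      and eq: "?F J = ?F J'"
    then have J: "sub_hopf_algebra sH \<Delta> S J" "sub_hopf_algebra sH \<Delta> S J'" by auto
    have "support J1 \<subseteq> support J2" if J12: "sub_hopf_algebra sH \<Delta> S J1" "sub_hopf_algebra sH \<Delta> S J2"
      and fixed: "?F J1 = ?F J2" for J1 J2
    proof
      fix \<gamma> assume \<gamma>: "\<gamma> \<in> support J1"
      have "{x. \<forall>\<gamma>\<in>support J1. \<gamma> x = x} = {x. \<forall>\<gamma>\<in>support J2. \<gamma> x = x}"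
        using fixed by (simp only: fixed_subfield_eq[OF J12(1)] fixed_subfield_eq[OF J12(2)])
      then have "\<gamma> x = x" if "\<And>\<delta>. \<delta> \<in> support J2 \<Longrightarrow> \<delta> x = x" for x
        using that \<gamma> by blast
      then show "\<gamma> \<in> support J2"
        by (rule G.fixes_fixed_imp_mem[OF support_subgroup[OF J12(2)] subsetD[OF support_gal \<gamma>]])
    qed
    from this[OF J eq] this[OF J(2,1) eq[symmetric]]
    have "support J = support J'" by (rule subset_antisym)
    then show "J = J'"
      using sub_hopf_algebra_eq_support[OF J(1)] sub_hopf_algebra_eq_support[OF J(2)] by simp
  qed
  show "?F ` ?S = {E. intermediate_field sL E}"
  proof (intro subset_antisym subsetI)
    fix E assume "E \<in> ?F ` ?S"
    then obtain J where "sub_hopf_algebra sH \<Delta> S J" "E = ?F J" by auto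
    then show "E \<in> {E. intermediate_field sL E}"
      using G.intermediate_fixed[OF support_gal] fixed_subfield_eq by simp
  next
    fix E assume "E \<in> {E. intermediate_field sL E}"
    then have E: "intermediate_field sL E" by simp
    let ?I = "{\<gamma> \<in> Gal. \<forall>y\<in>E. \<gamma> y = y}"
    interpret gal: group "gal_group sL" by (rule G.group_gal)
    have I: "subgroup ?I (gal_group sL)"
      by (rule gal.finite_submonoid_is_subgroup)
        (auto simp: G.finite_gal G.gal_one_eq G.id_gal G.gal_mult_eq G.gal_comp)
    note star = gal_subgroup_is_star_subgroup[OF cyc I]
    \<comment> \<open>The preimage of \<open>E\<close>: elements of \<open>H\<close> with
      coordinates supported on the pointwise stabiliser of \<open>E\<close>. In the cyclic case this
      subgroup is also a \<open>twist\<close>-stable subgroup of \<open>star_group\<close>, as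
      \<open>support_sub_hopf_algebra\<close> requires.\<close>
    let ?J = "{h. \<forall>\<gamma>\<in>Gal - ?I. coef h \<gamma> = 0}"
    have J: "sub_hopf_algebra sH \<Delta> S ?J" and supp: "support ?J = ?I"
      by (rule support_sub_hopf_algebra[OF star]; assumption)+
    have "?F ?J = {x. \<forall>\<gamma>\<in>?I. \<gamma> x = x}"
      by (simp only: fixed_subfield_eq[OF J] supp)
    also have "\<dots> = E" using G.intermediate_field_eq_fixed[OF E] by auto
    finally show "E \<in> ?F ` ?S" using J by blast
  qed
qed

lemma has_type_gal_group:
  assumes p: "prime p" "odd p" "order (gal_group sL) = p ^ n" and cyc: "cyclic_group (gal_group sL)"
  shows "has_type sL sH \<Delta> \<epsilon> act (gal_group sL)"
proof -
  interpret gal: group "gal_group sL" by (rule G.group_gal)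
  have NN: "group (Perm\<lparr>carrier := NN\<rparr>)"
    by (rule group.subgroup_imp_group[OF group_BijGroup subgroup_NN])
  have "gal_group sL \<cong> Perm\<lparr>carrier := NN\<rparr>"
    by (rule cyclic_group_iso[OF G.group_gal cyc NN gal.regular_normalized_cyclic[OF p cyc regular_NN] G.finite_gal])
      (use gal.regular_normalized_card[OF regular_NN] in \<open>simp add: order_def\<close>)
  then obtain \<alpha> where \<alpha>: "\<alpha> \<in> iso (gal_group sL) (Perm\<lparr>carrier := NN\<rparr>)" by (auto simp: is_iso_def)
  have "\<alpha> \<in> hom (gal_group sL) Perm"
    using \<alpha> subgroup.mem_carrier[OF subgroup_NN] by (auto simp: iso_def hom_def)
  moreover have "inj_on \<alpha> Gal" "\<alpha> ` Gal = NN" using \<alpha> by (auto simp: iso_def bij_betw_def)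
  ultimately show ?thesis
    unfolding has_type_def using G.group_gal gp_corresponds_NN by auto
qed

text \<open>Every subgroup that witnesses a type is regular and normalised, hence cyclic of the
  order of \<open>Gal\<close>.\<close>

lemma has_type_unique:
  assumes p: "prime p" "odd p" "order (gal_group sL) = p ^ n" and cyc: "cyclic_group (gal_group sL)"
    and G: "has_type sL sH \<Delta> \<epsilon> act M"
  shows "M \<cong> gal_group sL"
proof -
  interpret gal: group "gal_group sL" by (rule G.group_gal)
  obtain \<alpha> where \<alpha>: "\<alpha> \<in> hom M Perm" "inj_on \<alpha> (carrier M)" "regular_normalized (gal_group sL) (\<alpha> ` carrier M)"
    using G by (auto simp: has_type_def gp_corresponds_def)
  let ?N = "Perm\<lparr>carrier := \<alpha> ` carrier M\<rparr>"
  have sub: "subgroup (\<alpha> ` carrier M) Perm" using \<alpha>(3) by (simp add: regular_normalized_def)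
  have N: "group ?N" by (rule group.subgroup_imp_group[OF group_BijGroup sub])
  have ord: "order ?N = order (gal_group sL)"
    using gal.regular_normalized_card[OF \<alpha>(3)] by (simp add: order_def)
  have "\<alpha> \<in> iso M ?N"
    using \<alpha>(1,2) by (auto simp: iso_def hom_def bij_betw_def)
  moreover have "gal_group sL \<cong> ?N"
    by (rule cyclic_group_iso[OF G.group_gal cyc N gal.regular_normalized_cyclic[OF p cyc \<alpha>(3)] G.finite_gal])
      (simp add: ord)
  ultimately show ?thesis
    using iso_trans[of M ?N "gal_group sL"] gal.iso_sym[of ?N] unfolding is_iso_def by blast
qed

end

text \<open>As \<open>has_type\<close> is a relation, the type is pinned down by two clauses: one
  exhibits \<open>gal_group sL\<close> as a type, the other gives uniqueness up to isomorphism for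
  groups over an arbitrary carrier type.\<close>

theorem proposition4p3:
  fixes sL :: "'k::field \<Rightarrow> 'l::field \<Rightarrow> 'l"
    and sH :: "'k \<Rightarrow> 'h::ring_1 \<Rightarrow> 'h"
    and \<Delta> :: "'h \<Rightarrow> ('h \<times> 'h \<Rightarrow>\<^sub>0 'k)" and \<epsilon> :: "'h \<Rightarrow> 'k" and S :: "'h \<Rightarrow> 'h"
    and act :: "'h \<Rightarrow> 'l \<Rightarrow> 'l"
    and p n :: nat
  assumes "prime p" and "odd p"
    and "galois_extension sL"
    and "cyclic_group (gal_group sL)" and "order (gal_group sL) = p ^ n"
    and "hopf_galois_structure sL sH \<Delta> \<epsilon> S act"
  shows "has_type sL sH \<Delta> \<epsilon> act (gal_group sL) \<and>
    (\<forall>G :: ('g, 'm) monoid_scheme. has_type sL sH \<Delta> \<epsilon> act G \<longrightarrow> G \<cong> gal_group sL) \<and>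
    strong_galois_correspondence sL sH \<Delta> \<epsilon> S act"
proof -
  have "card (carrier (gal_group sL)) > 0"
    using assms(1,5) prime_gt_0_nat[of p] by (simp add: order_def)
  then have "finite (carrier (gal_group sL))" by (rule card_ge_0_finite)
  then interpret hopf_galois_on_galois sL sH \<Delta> \<epsilon> S act
    using assms(3,6)
    by (simp add: hopf_galois_on_galois_def finite_galois_extension_def finite_galois_extension_axioms_def)
  show ?thesis
    using has_type_gal_group[OF assms(1,2,5,4)] has_type_unique[OF assms(1,2,5,4)]
      strong_correspondence[OF assms(4) cyclic_star_group[OF assms(1,2,5,4)]] by blast
qed

end
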